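(* Let $M$ be a compact complex manifold, of complex dimension $m$, holomorphically immersed in $\mathbb{C}P^{N}$ with $N=m+1$. For each $p$ in $M$, let $K_1,K_2,\ldots,K_m$ be the holomorphic sectional curvatures (of $M$) of a family of holomorphic principal directions at $p$, and let $\pm\kappa_1,\ldots,\pm\kappa_m$ be the corresponding principal curvatures. Let $\sigma_i(K)$ represent the $i$-th elementary symmetric function of the $K_i$. Then $K_i=4-2\kappa_i^2$, and the total absolute curvature of $M$ is $$\mathcal{T}(M)=\frac{4\pi}{\mathrm{Vol}(\mathbb{C}P^N)}\int_M\int_0^{\frac{\pi}{2}}\left|\sum_{i=0}^{m}\left(1-3\sin^2(r)\right)^{m-i}\left(\frac{\sin^{2i}(r)}{2^i}\right)\sigma_i(K)\right|\cos(r)\sin^{2N-2m-1}(r)\,dr\,dVol_M.$$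
   Context: $\mathbb{C}P^N$ carries its canonical (Fubini–Study) metric, normalized to have holomorphic sectional curvature $4$, and $M$ carries the induced metric; $J$ is the complex structure. For a normal vector $\vec v$ to $M$ at $p$, $A_{\vec v}:T_pM\to T_pM$ denotes the second fundamental form (shape operator), $A_{\vec v}(x)=-(\nabla_x V)^{\top}$ for any normal field $V$ extending $\vec v$; eigenvectors and eigenvalues of $A_{\vec v}$ are called principal vectors and principal curvatures. Holomorphic principal directions: for a unit normal vector $\vec u$ at $p$ there is an orthonormal basis $e_1,J(e_1),\ldots,e_m,J(e_m)$ of $T_pM$ consisting of principal vectors for $A_{\vec u}$, with principal curvatures $\kappa_1,-\kappa_1,\ldots,\kappa_m,-\kappa_m$. The complex lines $\mathrm{Span}_{\mathbb{C}}(e_i)\subset T_pM$ are called holomorphic principal directions for the complex line $\mathrm{Span}_{\mathbb{C}}(\vec u)$ in the normal space $\nu_pM$ (they, and the $\kappa_i^2$, can be taken the same for all unit vectors in that line). For a hypersurface the normal space is a single complex line, and one speaks of holomorphic principal directions at $p$. The total absolute curvature of $M$ of complex dimension $m$ holomorphically immersed in $\mathbb{C}P^N$ is $$\mathcal{T}(M)=\frac{2}{\mathrm{Vol}(\mathbb{C}P^N)}\int_{\nu^{<\pi/2}M}\left|\det\left(\cos(r)\,\mathrm{Id}_{T_pM}-\left(\tfrac{\sin r}{r}\right)A_{\vec v}\right)\right|\cos(r)\left(\tfrac{\sin r}{r}\right)^{2N-2m-1}dVol_{\nu^{<\pi/2}M}(\vec v),$$ where $\nu^{<\pi/2}M$ is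 the bundle of normal vectors of length less than $\pi/2$ (with its natural volume form, $dVol_M$ times Lebesgue measure on the fibres), $p$ is the base point of $\vec v$, and $r=\|\vec v\|$. *)

theory Defs
  imports "HOL-Analysis.Analysis"
begin

section \<open>Complex manifolds\<close>

text \<open>A complex manifold is given by its atlas, which also determines the set of points and the
  topology. The complex dimension is the cardinality of the index type of the model space.\<close>

type_synonym ('a, 'm) chart = "'a set \<times> ('a \<Rightarrow> complex ^ 'm)"

definition chart_inv :: "('a, 'm) chart \<Rightarrow> complex ^ 'm \<Rightarrow> 'a" where
  "chart_inv c = inv_into (fst c) (snd c)"

definition holomorphic_map_on ::
  "(complex ^ 'm::finite \<Rightarrow> complex ^ 'n::finite) \<Rightarrow> (complex ^ 'm) set \<Rightarrow> bool" where
  "holomorphic_map_on F S \<longleftrightarrow> open S \<and>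
     (\<forall>x\<in>S. \<exists>L. (F has_derivative L) (at x) \<and> (\<forall>a v. L (a *s v) = a *s L v))"

definition complex_atlas :: "('a, 'm::finite) chart set \<Rightarrow> bool" where
  "complex_atlas \<A> \<longleftrightarrow>
     (\<forall>c\<in>\<A>. inj_on (snd c) (fst c)) \<and>
     (\<forall>c\<in>\<A>. \<forall>d\<in>\<A>. holomorphic_map_on (snd d \<circ> chart_inv c) (snd c ` (fst c \<inter> fst d)))"

definition points :: "('a, 'm::finite) chart set \<Rightarrow> 'a set" where
  "points \<A> = \<Union> (fst ` \<A>)"

definition manifold_topology :: "('a, 'm::finite) chart set \<Rightarrow> 'a topology" where
  "manifold_topology \<A> =
     topology (\<lambda>W. W \<subseteq> points \<A> \<and> (\<forall>c\<in>\<A>. open (snd c ` (W \<inter> fst c))))"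

text \<open>Second countability follows from compactness.\<close>

definition compact_complex_manifold :: "('a, 'm::finite) chart set \<Rightarrow> bool" where
  "compact_complex_manifold \<A> \<longleftrightarrow>
     complex_atlas \<A> \<and> Hausdorff_space (manifold_topology \<A>) \<and>
     compact_space (manifold_topology \<A>)"

definition local_rep ::
  "('a, 'm) chart \<Rightarrow> ('b, 'n) chart \<Rightarrow> ('a \<Rightarrow> 'b) \<Rightarrow> complex ^ 'm \<Rightarrow> complex ^ 'n" where
  "local_rep c d f = snd d \<circ> f \<circ> chart_inv c"

definition holomorphic_immersion ::
  "('a, 'm::finite) chart set \<Rightarrow> ('b, 'n::finite) chart set \<Rightarrow> ('a \<Rightarrow> 'b) \<Rightarrow> bool" where
  "holomorphic_immersion \<A> \<B> f \<longleftrightarrow>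
     continuous_map (manifold_topology \<A>) (manifold_topology \<B>) f \<and>
     f ` points \<A> \<subseteq> points \<B> \<and>
     (\<forall>c\<in>\<A>. \<forall>d\<in>\<B>.
        holomorphic_map_on (local_rep c d f) (snd c ` (fst c \<inter> f -` fst d)) \<and>
        (\<forall>x \<in> snd c ` (fst c \<inter> f -` fst d). inj (frechet_derivative (local_rep c d f) (at x))))"

text \<open>The tangent space at a point \<open>p\<close> is the model space: a tangent vector is given by its
  components in the chart \<open>chart_at \<A> p\<close>. The complex structure \<open>J\<close> is multiplication by \<open>\<i>\<close>.\<close>

definition chart_at :: "('a, 'm::finite) chart set \<Rightarrow> 'a \<Rightarrow> ('a, 'm) chart" where
  "chart_at \<A> p = (SOME c. c \<in> \<A> \<and> p \<in> fst c)"

section \<open>Riemannian geometry in coordinates\<close>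

type_synonym 'e riem_metric = "'e \<Rightarrow> 'e \<Rightarrow> 'e \<Rightarrow> real"

abbreviation dir_deriv ::
  "('d::real_normed_vector \<Rightarrow> 'e::real_normed_vector) \<Rightarrow> 'd \<Rightarrow> 'd \<Rightarrow> 'e" where
  "dir_deriv F x u \<equiv> frechet_derivative F (at x) u"

text \<open>\<open>christoffel g x u v\<close> is \<open>\<nabla>\<^sub>u v\<close> at \<open>x\<close> for the constant fields \<open>u\<close>, \<open>v\<close>, determined by the
  Koszul formula; \<open>\<nabla>\<close> is the Levi-Civita connection of \<open>g\<close>.\<close>

definition christoffel :: "'e::euclidean_space riem_metric \<Rightarrow> 'e \<Rightarrow> 'e \<Rightarrow> 'e \<Rightarrow> 'e" where
  "christoffel g x u v = (THE w. \<forall>t. g x w t =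
     (dir_deriv (\<lambda>y. g y v t) x u + dir_deriv (\<lambda>y. g y u t) x v
       - dir_deriv (\<lambda>y. g y u v) x t) / 2)"

text \<open>The covariant derivative of a vector field \<open>V\<close> along a map \<open>F\<close>.\<close>

definition cov_deriv ::
  "'e::euclidean_space riem_metric \<Rightarrow> ('d::euclidean_space \<Rightarrow> 'e) \<Rightarrow> ('d \<Rightarrow> 'e) \<Rightarrow> 'd \<Rightarrow> 'd \<Rightarrow> 'e"
where
  "cov_deriv g F V x u = dir_deriv V x u + christoffel g (F x) (dir_deriv F x u) (V x)"

text \<open>\<open>R(u,v)w = \<nabla>\<^sub>u\<nabla>\<^sub>v w - \<nabla>\<^sub>v\<nabla>\<^sub>u w\<close> for constant fields \<open>u\<close>, \<open>v\<close>, \<open>w\<close>.\<close>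

definition curvature_tensor :: "'e::euclidean_space riem_metric \<Rightarrow> 'e \<Rightarrow> 'e \<Rightarrow> 'e \<Rightarrow> 'e \<Rightarrow> 'e" where
  "curvature_tensor g x u v w =
     cov_deriv g id (\<lambda>y. christoffel g y v w) x u - cov_deriv g id (\<lambda>y. christoffel g y u w) x v"

definition sectional_curvature :: "'e::euclidean_space riem_metric \<Rightarrow> 'e \<Rightarrow> 'e \<Rightarrow> 'e \<Rightarrow> real" where
  "sectional_curvature g x u v =
     g x (curvature_tensor g x u v v) u / (g x u u * g x v v - (g x u v)\<^sup>2)"

definition pullback_metric ::
  "'e::euclidean_space riem_metric \<Rightarrow> ('d::euclidean_space \<Rightarrow> 'e) \<Rightarrow> 'd riem_metric" where
  "pullback_metric g F x u v = g (F x) (dir_deriv F x u) (dir_deriv F x v)"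

definition normal_vectors ::
  "'e::euclidean_space riem_metric \<Rightarrow> ('d::euclidean_space \<Rightarrow> 'e) \<Rightarrow> 'd \<Rightarrow> 'e set" where
  "normal_vectors g F x = {v. \<forall>t. g (F x) v (dir_deriv F x t) = 0}"

definition normal_field_extending ::
  "'e::euclidean_space riem_metric \<Rightarrow> ('d::euclidean_space \<Rightarrow> 'e) \<Rightarrow> 'd \<Rightarrow> 'e \<Rightarrow> ('d \<Rightarrow> 'e) \<Rightarrow> bool" where
  "normal_field_extending g F x v V \<longleftrightarrow> V x = v \<and>
     (\<exists>S. open S \<and> x \<in> S \<and> V differentiable_on S \<and> (\<forall>y\<in>S. V y \<in> normal_vectors g F y))"

text \<open>\<open>A\<^sub>v(u) = - (\<nabla>\<^sub>u V)\<^sup>\<top>\<close> for a normal field \<open>V\<close> along the immersion \<open>F\<close> with \<open>V x = v\<close>: the vector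
  \<open>w\<close> whose image under \<open>dF\<close> has the same inner products with all tangent vectors as \<open>- \<nabla>\<^sub>u V\<close>.\<close>

definition shape_operator ::
  "'e::euclidean_space riem_metric \<Rightarrow> ('d::euclidean_space \<Rightarrow> 'e) \<Rightarrow> 'd \<Rightarrow> 'e \<Rightarrow> 'd \<Rightarrow> 'd" where
  "shape_operator g F x v u = (THE w. \<exists>V. normal_field_extending g F x v V \<and>
     (\<forall>t. g (F x) (dir_deriv F x w) (dir_deriv F x t)
        = - g (F x) (cov_deriv g F V x u) (dir_deriv F x t)))"

section \<open>Complex projective space\<close>

text \<open>Homogeneous coordinates are indexed by \<open>'n option\<close>, so the dimension is \<open>CARD('n)\<close>. A point
  is a complex line in \<open>complex ^ ('n option)\<close>.\<close>

definition cproj :: "(complex ^ ('n::finite option)) set set" where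
  "cproj = {{a *s z | a. True} | z. z \<noteq> 0}"

text \<open>The affine chart \<open>[z] \<mapsto> (z\<^sub>k / z\<^sub>j)\<close>, \<open>k \<noteq> j\<close>, on the set of \<open>[z]\<close> with \<open>z\<^sub>j \<noteq> 0\<close>. The indices \<open>k \<noteq> j\<close>
  are enumerated as the images of \<open>Some i\<close> under the transposition of \<open>None\<close> and \<open>j\<close>.\<close>

definition affine_chart ::
  "'n::finite option \<Rightarrow> ((complex ^ ('n option)) set, 'n) chart" where
  "affine_chart j =
     ({l \<in> cproj. \<exists>z\<in>l. z $ j \<noteq> 0},
      \<lambda>l. \<chi> i. (THE z. z \<in> l \<and> z $ j = 1) $ Transposition.transpose None j (Some i))"

definition cproj_atlas :: "((complex ^ ('n::finite option)) set, 'n) chart set" where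
  "cproj_atlas = range affine_chart"

definition hermitian :: "complex ^ 'n::finite \<Rightarrow> complex ^ 'n \<Rightarrow> complex" where
  "hermitian u v = (\<Sum>i\<in>UNIV. u $ i * cnj (v $ i))"

text \<open>The Fubini--Study metric in an affine chart (the expression is the same in each of them). It
  is the quotient metric of the unit sphere under the Hopf action, so its holomorphic sectional
  curvature is 4.\<close>

definition fubini_study :: "(complex ^ 'n::finite) riem_metric" where
  "fubini_study w u v =
     Re ((1 + hermitian w w) * hermitian u v - hermitian u w * hermitian w v)
       / (1 + (norm w)\<^sup>2)\<^sup>2"

section \<open>Immersions into complex projective space\<close>

text \<open>The metric induced on \<open>M\<close>, in the chart \<open>c\<close>.\<close>

definition induced_metric ::
  "('a \<Rightarrow> (complex ^ ('n::finite option)) set) \<Rightarrow> ('a, 'm::finite) chart \<Rightarrow> (complex ^ 'm) riem_metric"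
where
  "induced_metric f c x =
     pullback_metric fubini_study (local_rep c (chart_at cproj_atlas (f (chart_inv c x))) f) x"

text \<open>The local expression of \<open>f\<close> in the charts that represent the tangent spaces at \<open>p\<close> and \<open>f p\<close>.\<close>

definition rep_at ::
  "('a, 'm::finite) chart set \<Rightarrow> ('a \<Rightarrow> (complex ^ ('n::finite option)) set) \<Rightarrow> 'a
     \<Rightarrow> complex ^ 'm \<Rightarrow> complex ^ 'n" where
  "rep_at \<A> f p = local_rep (chart_at \<A> p) (chart_at cproj_atlas (f p)) f"

definition tangent_inner ::
  "('a, 'm::finite) chart set \<Rightarrow> ('a \<Rightarrow> (complex ^ ('n::finite option)) set) \<Rightarrow> 'a
     \<Rightarrow> complex ^ 'm \<Rightarrow> complex ^ 'm \<Rightarrow> real" where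
  "tangent_inner \<A> f p u v = induced_metric f (chart_at \<A> p) (snd (chart_at \<A> p) p) u v"

definition fs_inner ::
  "(complex ^ ('n::finite option)) set \<Rightarrow> complex ^ 'n \<Rightarrow> complex ^ 'n \<Rightarrow> real" where
  "fs_inner l u v = fubini_study (snd (chart_at cproj_atlas l) l) u v"

definition fs_norm :: "(complex ^ ('n::finite option)) set \<Rightarrow> complex ^ 'n \<Rightarrow> real" where
  "fs_norm l v = sqrt (fs_inner l v v)"

definition normal_space_at ::
  "('a, 'm::finite) chart set \<Rightarrow> ('a \<Rightarrow> (complex ^ ('n::finite option)) set) \<Rightarrow> 'a
     \<Rightarrow> (complex ^ 'n) set" where
  "normal_space_at \<A> f p = normal_vectors fubini_study (rep_at \<A> f p) (snd (chart_at \<A> p) p)"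

definition shape_op ::
  "('a, 'm::finite) chart set \<Rightarrow> ('a \<Rightarrow> (complex ^ ('n::finite option)) set) \<Rightarrow> 'a
     \<Rightarrow> complex ^ 'n \<Rightarrow> complex ^ 'm \<Rightarrow> complex ^ 'm" where
  "shape_op \<A> f p v = shape_operator fubini_study (rep_at \<A> f p) (snd (chart_at \<A> p) p) v"

definition holomorphic_sectional_curvature ::
  "('a, 'm::finite) chart set \<Rightarrow> ('a \<Rightarrow> (complex ^ ('n::finite option)) set) \<Rightarrow> 'a
     \<Rightarrow> complex ^ 'm \<Rightarrow> real" where
  "holomorphic_sectional_curvature \<A> f p e =
     sectional_curvature (induced_metric f (chart_at \<A> p)) (snd (chart_at \<A> p) p) e (\<i> *s e)"

text \<open>\<open>e\<^sub>1, J e\<^sub>1, \<dots>, e\<^sub>m, J e\<^sub>m\<close> is an orthonormal family of \<open>2m\<close> vectors, hence a basis of the tangent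
  space, and consists of principal vectors of the unit normal vector \<open>u\<close> with principal curvatures
  \<open>\<kappa>\<^sub>1, -\<kappa>\<^sub>1, \<dots>, \<kappa>\<^sub>m, -\<kappa>\<^sub>m\<close>; the complex lines spanned by the \<open>e\<^sub>i\<close> are the holomorphic principal
  directions.\<close>

definition holomorphic_principal_family ::
  "('a, 'm::finite) chart set \<Rightarrow> ('a \<Rightarrow> (complex ^ ('n::finite option)) set) \<Rightarrow> 'a
     \<Rightarrow> complex ^ 'n \<Rightarrow> ('m \<Rightarrow> complex ^ 'm) \<Rightarrow> ('m \<Rightarrow> real) \<Rightarrow> bool" where
  "holomorphic_principal_family \<A> f p u e \<kappa> \<longleftrightarrow>
     u \<in> normal_space_at \<A> f p \<and> fs_norm (f p) u = 1 \<and>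
     (\<forall>i k. tangent_inner \<A> f p (e i) (e k) = (if i = k then 1 else 0) \<and>
            tangent_inner \<A> f p (\<i> *s e i) (\<i> *s e k) = (if i = k then 1 else 0) \<and>
            tangent_inner \<A> f p (e i) (\<i> *s e k) = 0) \<and>
     (\<forall>i. shape_op \<A> f p u (e i) = \<kappa> i *\<^sub>R e i \<and>
          shape_op \<A> f p u (\<i> *s e i) = (- \<kappa> i) *\<^sub>R (\<i> *s e i))"

definition elem_sym :: "nat \<Rightarrow> ('m::finite \<Rightarrow> real) \<Rightarrow> real" where
  "elem_sym i K = (\<Sum>S | S \<subseteq> (UNIV :: 'm set) \<and> card S = i. \<Prod>k\<in>S. K k)"

section \<open>Volume\<close>

text \<open>The standard basis of \<open>complex ^ 'm\<close> as a real vector space, and the determinant of a real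
  linear endomorphism.\<close>

definition real_basis :: "'m::finite + 'm \<Rightarrow> complex ^ 'm" where
  "real_basis k = (case k of Inl i \<Rightarrow> axis i 1 | Inr i \<Rightarrow> axis i \<i>)"

definition real_det :: "(complex ^ 'm::finite \<Rightarrow> complex ^ 'm) \<Rightarrow> real" where
  "real_det T = det (\<chi> i k. T (real_basis k) \<bullet> real_basis i :: real ^ ('m + 'm) ^ ('m + 'm))"

definition manifold_borel :: "('a, 'm::finite) chart set \<Rightarrow> 'a measure" where
  "manifold_borel \<A> = sigma (points \<A>) {W. openin (manifold_topology \<A>) W}"

text \<open>The measure \<open>sqrt (det g\<^sub>i\<^sub>k) dx\<close> of the chart \<open>c\<close>, extended by zero to the whole manifold.\<close>

definition chart_volume ::
  "('a, 'm::finite) chart set \<Rightarrow> ('a \<Rightarrow> (complex ^ ('n::finite option)) set) \<Rightarrow> ('a, 'm) chart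
     \<Rightarrow> 'a measure" where
  "chart_volume \<A> f c =
     distr
       (density (restrict_space lborel (snd c ` fst c))
          (\<lambda>x. ennreal (sqrt (det (\<chi> i k. induced_metric f c x (real_basis i) (real_basis k)
                                 :: real ^ ('m + 'm) ^ ('m + 'm))))))
       (manifold_borel \<A>) (chart_inv c)"

text \<open>The chart volumes agree on overlaps. Hence their supremum (in the lattice of measures) is the
  measure that restricts to the chart volume on each chart domain: that measure dominates every
  chart volume, and a set cut into countably many pieces, each inside a chart domain, shows that it
  is the least one to do so.\<close>

definition riemannian_volume ::
  "('a, 'm::finite) chart set \<Rightarrow> ('a \<Rightarrow> (complex ^ ('n::finite option)) set) \<Rightarrow> 'a measure" where
  "riemannian_volume \<A> f = (SUP c\<in>\<A>. chart_volume \<A> f c)"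

definition cproj_volume :: "'n::finite itself \<Rightarrow> real" where
  "cproj_volume _ =
     measure (riemannian_volume (cproj_atlas :: ((complex ^ ('n option)) set, 'n) chart set) id) cproj"

text \<open>Lebesgue measure on a subspace \<open>W\<close> with inner product \<open>g\<close>: the image of the product measure under
  the coordinate isomorphism of an orthonormal basis, and independent of the basis.\<close>

definition orthonormal_basis_of ::
  "('e::euclidean_space \<Rightarrow> 'e \<Rightarrow> real) \<Rightarrow> 'e set \<Rightarrow> 'e set \<Rightarrow> bool" where
  "orthonormal_basis_of g W B \<longleftrightarrow> finite B \<and> B \<subseteq> W \<and> span B = W \<and>
     (\<forall>a\<in>B. \<forall>b\<in>B. g a b = (if a = b then 1 else 0))"

definition subspace_lebesgue ::
  "('e::euclidean_space \<Rightarrow> 'e \<Rightarrow> real) \<Rightarrow> 'e set \<Rightarrow> 'e measure" where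
  "subspace_lebesgue g W =
     (let B = (SOME B. orthonormal_basis_of g W B)
      in distr (PiM B (\<lambda>_. lborel)) borel (\<lambda>t. \<Sum>b\<in>B. t b *\<^sub>R b))"

definition normal_bundle ::
  "('a, 'm::finite) chart set \<Rightarrow> ('a \<Rightarrow> (complex ^ ('n::finite option)) set)
     \<Rightarrow> ('a \<times> (complex ^ 'n)) set" where
  "normal_bundle \<A> f = {(p, v). p \<in> points \<A> \<and> v \<in> normal_space_at \<A> f p}"

text \<open>The coordinates, with respect to a chart \<open>c\<close> of \<open>M\<close> and a chart \<open>d\<close> of projective space, of a
  normal vector \<open>v\<close> at \<open>p\<close>. As \<open>v\<close> is given by components in the chart chosen at \<open>f p\<close>, these have to be
  transformed to \<open>d\<close>.\<close>

definition bundle_coords ::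
  "('a \<Rightarrow> (complex ^ ('n::finite option)) set) \<Rightarrow> ('a, 'm::finite) chart
     \<Rightarrow> ((complex ^ ('n option)) set, 'n) chart
     \<Rightarrow> 'a \<times> (complex ^ 'n) \<Rightarrow> (complex ^ 'm) \<times> (complex ^ 'n)"
where
  "bundle_coords f c d = (\<lambda>(p, v).
     (snd c p,
      let d0 = chart_at cproj_atlas (f p) in dir_deriv (snd d \<circ> chart_inv d0) (snd d0 (f p)) v))"

text \<open>The Borel sets of the normal bundle are those which are Borel in all bundle coordinates.\<close>

definition bundle_borel_sets ::
  "('a, 'm::finite) chart set \<Rightarrow> ('a \<Rightarrow> (complex ^ ('n::finite option)) set)
     \<Rightarrow> ('a \<times> (complex ^ 'n)) set set" where
  "bundle_borel_sets \<A> f = {S. S \<subseteq> normal_bundle \<A> f \<and>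
     (\<forall>c\<in>\<A>. \<forall>d\<in>cproj_atlas.
        bundle_coords f c d ` {(p, v) \<in> S. p \<in> fst c \<and> f p \<in> fst d} \<in> sets borel)}"

definition normal_bundle_volume ::
  "('a, 'm::finite) chart set \<Rightarrow> ('a \<Rightarrow> (complex ^ ('n::finite option)) set)
     \<Rightarrow> ('a \<times> (complex ^ 'n)) measure" where
  "normal_bundle_volume \<A> f =
     measure_of (normal_bundle \<A> f) (bundle_borel_sets \<A> f)
       (\<lambda>S. \<integral>\<^sup>+ p. emeasure (subspace_lebesgue (fs_inner (f p)) (normal_space_at \<A> f p)) {v. (p, v) \<in> S}
              \<partial>riemannian_volume \<A> f)"

text \<open>The zero section, where \<open>sin r / r\<close> takes the junk value 0, is a null set if \<open>CARD('n) > CARD('m)\<close>.\<close>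

definition total_absolute_curvature ::
  "('a, 'm::finite) chart set \<Rightarrow> ('a \<Rightarrow> (complex ^ ('n::finite option)) set) \<Rightarrow> real" where
  "total_absolute_curvature \<A> f =
     2 / cproj_volume TYPE('n) *
     (LINT (p, v) : {(p, v) \<in> normal_bundle \<A> f. fs_norm (f p) v < pi / 2} | normal_bundle_volume \<A> f.
        (let r = fs_norm (f p) v in
           \<bar>real_det (\<lambda>x. cos r *\<^sub>R x - (sin r / r) *\<^sub>R shape_op \<A> f p v x)\<bar>
             * cos r * (sin r / r) ^ (2 * CARD('n) - 2 * CARD('m) - 1)))"

end

theory Submission
  imports Defs "HOL-Complex_Analysis.Cauchy_Integral_Formula"
begin

text \<open>The Gauss equation for a complex hypersurface gives \<open>K\<^sub>i = 4 - 2\<kappa>\<^sub>i\<^sup>2\<close>: the second fundamental form is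
  complex bilinear and takes values in the complex line of normal vectors, so its value on a principal
  vector \<open>e\<^sub>i\<close> is \<open>\<kappa>\<^sub>i\<close> times the unit normal. Complex bilinearity also gives \<open>A\<^sub>\<zeta>\<^sub>u = \<zeta> A\<^sub>u\<close> with \<open>A\<^sub>u\<close>
  antilinear, hence for \<open>\<zeta> = r c\<^sup>2\<close> with \<open>|c| = 1\<close> the vectors \<open>c e\<^sub>i\<close>, \<open>\<i> c e\<^sub>i\<close> are eigenvectors of \<open>A\<^sub>\<zeta>\<^sub>u\<close> for
  \<open>\<plusminus> r \<kappa>\<^sub>i\<close>, and the determinant in the total absolute curvature is the product of the
  \<open>cos\<^sup>2 r - \<kappa>\<^sub>i\<^sup>2 sin\<^sup>2 r = (1 - 3 sin\<^sup>2 r) + K\<^sub>i sin\<^sup>2 r / 2\<close>, independently of the argument of \<open>\<zeta>\<close>. Expanding the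
  product gives the elementary symmetric functions, and polar coordinates in the normal lines give the
  factor \<open>2\<pi>\<close>.\<close>

section \<open>Holomorphic maps of several variables\<close>

text \<open>Two obstacles shape the development. Holomorphy is given only as pointwise complex
  differentiability, whereas the second fundamental form and the curvature involve derivatives up to
  order three; their existence, complex linearity and symmetry have to be extracted from Cauchy's
  formula. Moreover the representing charts \<open>chart_at\<close> and the unit normals
  \<open>u p\<close> are arbitrary choices, with no regularity in \<open>p\<close>. Measurability is
  therefore proved in fixed pairs of charts, with locally continuous unit normals, and carried over
  because the metric, the determinant and the fibre measure do not depend on the choices. Tangential
  parts are written by Cramer's rule on a complex Gram matrix, so that their regularity can be read
  off a formula. The constant 4 arises in \<open>dbar_christoffel\<close> as the antiholomorphic
  derivative of the ambient Christoffel symbols; the factor 2 before \<open>\<kappa>\<^sup>2\<close>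
  arises because the Hermitian product is linear in one slot and conjugate linear in the
  other.\<close>

lemma bounded_linear_axis: "bounded_linear (axis k :: 'a::euclidean_space \<Rightarrow> 'a ^ 'n::finite)"
proof -
  have "linear (axis k :: 'a \<Rightarrow> 'a ^ 'n)"
    by (rule linearI) (auto simp: axis_def vec_eq_iff)
  then show ?thesis by (simp add: linear_conv_bounded_linear)
qed

lemma vec_eq_sum_axis: "(v :: 'a::comm_monoid_add ^ 'n::finite) = (\<Sum>k\<in>UNIV. axis k (v $ k))"
  by (auto simp: vec_eq_iff axis_def sum.delta if_distrib cong: if_cong)

lemma norm_vector_smult: "norm (c *s (v::complex ^ 'n::finite)) = norm c * norm v"
  by (simp add: norm_vec_def norm_mult L2_set_right_distrib)

lemma has_derivative_vecI:
  fixes F :: "'d::real_normed_vector \<Rightarrow> 'a::euclidean_space ^ 'n::finite"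
  assumes "\<And>k. ((\<lambda>x. F x $ k) has_derivative (\<lambda>h. L h $ k)) net"
  shows "(F has_derivative L) net"
proof -
  have "((\<lambda>x. \<Sum>k\<in>UNIV. axis k (F x $ k)) has_derivative (\<lambda>h. \<Sum>k\<in>UNIV. axis k (L h $ k))) net"
    by (intro has_derivative_sum bounded_linear.has_derivative[OF bounded_linear_axis] assms)
  then show ?thesis using vec_eq_sum_axis[where 'a='a and 'n='n] by simp
qed

lemma has_derivative_frechet:
  assumes "(F has_derivative L) (at x)"
  shows "frechet_derivative F (at x) = L"
  using frechet_derivative_at[OF assms] by simp

text \<open>Cauchy's formula for the first derivative divides by the square of u. The speed
  \<open>2 * pi * \<i> * u\<close> of the circle cancels one factor u and the normalising constant,
  which leaves a mean over the parameter interval.\<close>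

lemma cauchy_mean:
  fixes \<phi> :: "complex \<Rightarrow> complex" and \<rho> :: real
  assumes "\<phi> holomorphic_on ball 0 R" "0 < \<rho>" "\<rho> < R"
  shows "((\<lambda>t. \<phi> (of_real \<rho> * exp (2 * of_real pi * \<i> * of_real t)) / (of_real \<rho> * exp (2 * of_real pi * \<i> * of_real t)))
      has_integral deriv \<phi> 0) {0..1}"
proof -
  have circ: "circlepath 0 \<rho> t = of_real \<rho> * exp (2 * of_real pi * \<i> * of_real t)" for t
    by (simp add: circlepath_def part_circlepath_def linepath_def mult_ac)
  have h: "((\<lambda>u. \<phi> u / (u - 0) ^ (Suc 1)) has_contour_integral
        (2 * pi * \<i>) / (fact 1) * (deriv ^^ 1) \<phi> 0) (circlepath 0 \<rho>)"
    by (rule Cauchy_has_contour_integral_higher_derivative_circlepath)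
      (use assms in \<open>auto intro!: holomorphic_on_imp_continuous_on holomorphic_on_subset[OF assms(1)]\<close>)
  then have *: "((\<lambda>t. \<phi> (circlepath 0 \<rho> t) / (circlepath 0 \<rho> t)\<^sup>2 *
      vector_derivative (circlepath 0 \<rho>) (at t within {0..1})) has_integral 2 * pi * \<i> * deriv \<phi> 0) {0..1}"
    by (simp add: has_contour_integral_def power2_eq_square)
  have "((\<lambda>t. 2 * pi * \<i> * (\<phi> (of_real \<rho> * exp (2 * of_real pi * \<i> * of_real t)) / (of_real \<rho> * exp (2 * of_real pi * \<i> * of_real t)))) 
      has_integral 2 * pi * \<i> * deriv \<phi> 0) {0..1}"
    using *
    by (rule has_integral_eq[rotated])
       (use \<open>0 < \<rho>\<close> in \<open>auto simp: vector_derivative_circlepath01 circ power2_eq_square field_simps\<close>)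
  then have "((\<lambda>t. inverse (2 * pi * \<i>) * (2 * pi * \<i> * (\<phi> (of_real \<rho> * exp (2 * of_real pi * \<i> * of_real t)) / (of_real \<rho> * exp (2 * of_real pi * \<i> * of_real t))))) 
      has_integral inverse (2 * pi * \<i>) * (2 * pi * \<i> * deriv \<phi> 0)) {0..1}"
    by (rule has_integral_mult_right)
  then show ?thesis by (simp add: field_simps)
qed

text \<open>Cauchy's formula on a complex line in the direction \<open>a\<close> writes \<open>D x a\<close> as a mean of \<open>G\<close> over a circle.
  Hence \<open>D x a\<close> is continuous in \<open>x\<close>, and then the mean can be differentiated under the integral.\<close>

locale holomorphic_fun =
  fixes G :: "complex ^ 'm::finite \<Rightarrow> complex" and D :: "complex ^ 'm \<Rightarrow> complex ^ 'm \<Rightarrow> complex"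
    and S :: "(complex ^ 'm) set"
  assumes S: "open S"
    and deriv: "\<And>x. x \<in> S \<Longrightarrow> (G has_derivative D x) (at x)"
    and clin: "\<And>x c v. x \<in> S \<Longrightarrow> D x (c *s v) = c * D x v"
begin

lemma slice:
  assumes "z + \<zeta> *s a \<in> S"
  shows "((\<lambda>\<zeta>. G (z + \<zeta> *s a)) has_field_derivative D (z + \<zeta> *s a) a) (at \<zeta>)"
proof -
  have "bounded_linear (\<lambda>\<zeta>. \<zeta> *s a)"
    by (simp add: linear_conv_bounded_linear[symmetric])
       (rule linearI; simp add: vec_eq_iff algebra_simps)
  note bl = bounded_linear_imp_has_derivative[OF this]
  have 1: "((\<lambda>\<zeta>. z + \<zeta> *s a) has_derivative (\<lambda>\<zeta>. \<zeta> *s a)) (at \<zeta>)"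
    using has_derivative_add[OF has_derivative_const bl, of z] by simp
  have "((\<lambda>\<zeta>. G (z + \<zeta> *s a)) has_derivative (\<lambda>h. D (z + \<zeta> *s a) (h *s a))) (at \<zeta>)"
    by (rule has_derivative_compose[OF 1 deriv[OF assms]])
  then show ?thesis unfolding has_field_derivative_def by (simp add: clin[OF assms] mult.commute[of _ "D _ _"] )
qed

definition "kern \<rho> t = (complex_of_real \<rho> * exp (2 * of_real pi * \<i> * of_real (t::real)))"

lemma kern_norm: "0 < \<rho> \<Longrightarrow> norm (kern \<rho> t) = \<rho>"
  by (simp add: kern_def norm_mult)

text \<open>One radius has to serve all centres near \<open>z0\<close>, so that the circle means
  become integrals depending on a parameter. The factor 2 keeps the circle of radius
  \<open>\<rho>\<close> inside an open disc of holomorphy.\<close>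

lemma room:
  assumes "z0 \<in> S"
  obtains \<delta> \<rho> where "\<delta> > 0" "\<rho> > 0" "\<And>z \<zeta>. z \<in> ball z0 \<delta> \<Longrightarrow> \<zeta> \<in> ball 0 (2 * \<rho>) \<Longrightarrow> z + \<zeta> *s a \<in> S"
proof -
  obtain d where d: "d > 0" "ball z0 d \<subseteq> S" using S assms by (meson openE)
  \<comment> \<open>The summand 1 covers the direction \<open>a = 0\<close>.\<close>
  define \<rho> where "\<rho> = d / (4 * (norm a + 1))"
  have n: "norm a + 1 > 0" by (smt (verit) norm_ge_zero)
  have "\<rho> > 0" using d n by (simp add: \<rho>_def)
  have "z + \<zeta> *s a \<in> S" if z: "z \<in> ball z0 (d/2)" and w: "\<zeta> \<in> ball 0 (2 * \<rho>)" for z \<zeta>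
  proof -
    have "norm (\<zeta> *s a) \<le> 2 * \<rho> * norm a"
      using w by (simp add: norm_vector_smult mult_right_mono)
    also have "\<dots> \<le> 2 * \<rho> * (norm a + 1)" using \<open>\<rho> > 0\<close> by (simp add: algebra_simps)
    also have "\<dots> = d / 2" using n by (simp add: \<rho>_def field_simps)
    finally have "norm (\<zeta> *s a) \<le> d / 2" .
    then have "dist z0 (z + \<zeta> *s a) < d"
      using z norm_triangle_ineq4[of "z0 - z" "\<zeta> *s a"] by (simp add: dist_norm diff_diff_eq)
    then show ?thesis using d by auto
  qed
  with d \<open>\<rho> > 0\<close> show thesis by (intro that[of "d/2" \<rho>]) auto
qed

end

locale holomorphic_fun_disc = holomorphic_fun +
  fixes z0 a \<delta> \<rho>
  assumes pos: "\<delta> > 0" "\<rho> > 0"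
    and room': "\<And>z \<zeta>. z \<in> ball z0 \<delta> \<Longrightarrow> \<zeta> \<in> ball 0 (2 * \<rho>) \<Longrightarrow> z + \<zeta> *s a \<in> S"
begin

lemma kern_in: "z \<in> ball z0 \<delta> \<Longrightarrow> z + kern \<rho> t *s a \<in> S"
  by (rule room') (use pos in \<open>auto simp: kern_norm\<close>)

lemma mean:
  assumes z: "z \<in> ball z0 \<delta>"
  shows "((\<lambda>t. G (z + kern \<rho> t *s a) / kern \<rho> t) has_integral D z a) {0..1}"
proof -
  have *: "((\<lambda>\<zeta>. G (z + \<zeta> *s a)) has_field_derivative D (z + \<zeta> *s a) a) (at \<zeta>)" if "\<zeta> \<in> ball 0 (2*\<rho>)" for \<zeta>
    by (rule slice[OF room'[OF z that]])
  have hol: "(\<lambda>\<zeta>. G (z + \<zeta> *s a)) holomorphic_on ball 0 (2*\<rho>)"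
    by (subst holomorphic_on_open) (use * in \<open>auto intro!: exI\<close>)
  have "deriv (\<lambda>\<zeta>. G (z + \<zeta> *s a)) 0 = D z a"
    using DERIV_imp_deriv[OF *[of 0]] pos by simp
  then show ?thesis using cauchy_mean[OF hol, of \<rho>] pos by (simp add: kern_def)
qed

lemma cont_kern: "continuous_on A (\<lambda>x. kern \<rho> (g x))" if "continuous_on A g" 
  unfolding kern_def by (intro continuous_intros that)

lemma cont_sm: "continuous_on A (\<lambda>x. g x *s a)" if "continuous_on A g"
  unfolding vector_scalar_mult_def by (intro continuous_intros that)

text \<open>Only values of \<open>G\<close> occur under the integral in \<open>mean\<close>, so the
  continuity of \<open>G\<close> is passed on to its derivative.\<close>

lemma contD_local: "continuous_on (ball z0 \<delta>) (\<lambda>z. D z a)"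
proof -
  have cG: "continuous_on S G" using deriv by (meson has_derivative_at_withinI has_derivative_continuous_on)
  have "continuous_on (ball z0 \<delta> \<times> cbox 0 1) (\<lambda>(z,t). G (z + kern \<rho> t *s a) / kern \<rho> t)"
    unfolding case_prod_unfold
    by (intro continuous_intros continuous_on_compose2[OF cG] cont_kern cont_sm)
       (use pos kern_in in \<open>auto simp: kern_def\<close>)
  from integral_continuous_on_param[OF this]
  have "continuous_on (ball z0 \<delta>) (\<lambda>z. integral (cbox 0 1) (\<lambda>t. G (z + kern \<rho> t *s a) / kern \<rho> t))" .
  then show ?thesis
    by (rule continuous_on_cong[THEN iffD1, rotated -1]) (use integral_unique[OF mean] in auto)
qed

end

context holomorphic_fun begin

lemma roomE:
  assumes "z0 \<in> S" obtains \<delta> \<rho> where "holomorphic_fun_disc G D S z0 a \<delta> \<rho>"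
  using room[OF assms, of a] holomorphic_fun_disc.intro[OF holomorphic_fun_axioms] unfolding holomorphic_fun_disc_axioms_def by metis

lemma contD: "continuous_on S (\<lambda>z. D z a)"
proof -
  have "isCont (\<lambda>z. D z a) z0" if z0: "z0 \<in> S" for z0
  proof -
    obtain \<delta> \<rho> where "holomorphic_fun_disc G D S z0 a \<delta> \<rho>" using roomE[OF z0] by blast
    then interpret holomorphic_fun_disc G D S z0 a \<delta> \<rho> .
    show ?thesis using contD_local pos by (simp add: continuous_on_eq_continuous_at)
  qed
  then show ?thesis by (simp add: S continuous_on_eq_continuous_at)
qed

end

context holomorphic_fun_disc begin

lemma bl: "x \<in> S \<Longrightarrow> bounded_linear (D x)"
  using deriv has_derivative_bounded_linear by blast

text \<open>The derivative in \<open>z\<close> of the integrand of \<open>mean\<close>. It is packed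
  as a \<open>blinfun\<close> because \<open>leibniz_rule\<close> differentiates under the integral
  in that form.\<close>

definition "fx z t = Blinfun (\<lambda>b. D (z + kern \<rho> t *s a) b / kern \<rho> t)"

lemma fx: "z \<in> ball z0 \<delta> \<Longrightarrow> blinfun_apply (fx z t) = (\<lambda>b. D (z + kern \<rho> t *s a) b / kern \<rho> t)"
  unfolding fx_def
  by (rule bounded_linear_Blinfun_apply) (intro bounded_linear_divide[THEN bounded_linear_compose] bl kern_in)

lemma continuous_fx: "continuous_on (ball z0 \<delta> \<times> cbox 0 1) (\<lambda>(z,t). fx z t)"
proof (rule continuous_on_blinfun_componentwise)
  fix i
  have "continuous_on (ball z0 \<delta> \<times> cbox 0 1) (\<lambda>(z,t). D (z + kern \<rho> t *s a) i / kern \<rho> t)"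
    unfolding case_prod_unfold
    by (intro continuous_intros continuous_on_compose2[OF contD] cont_kern cont_sm)
       (use pos kern_in in \<open>auto simp: kern_def\<close>)
  then show "continuous_on (ball z0 \<delta> \<times> cbox 0 1) (\<lambda>x. blinfun_apply (case x of (z, t) \<Rightarrow> fx z t) i)"
    by (rule continuous_on_cong[THEN iffD1, rotated -1]) (auto simp: fx)
qed

lemma fx_integrable: "z \<in> ball z0 \<delta> \<Longrightarrow> fx z integrable_on cbox 0 1"
proof (rule integrable_continuous)
  assume "z \<in> ball z0 \<delta>"
  moreover have "continuous_on (cbox 0 1) (Pair z :: real \<Rightarrow> _)" by (intro continuous_intros)
  ultimately show "continuous_on (cbox 0 1) (fx z)"
    using continuous_on_compose2[OF continuous_fx, of "cbox 0 1" "Pair z"] by force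
qed

lemma deriv2: "((\<lambda>z. D z a) has_derivative integral {0..1} (fx z0)) (at z0)"
proof -
  have "((\<lambda>z. integral (cbox 0 1) (\<lambda>t. G (z + kern \<rho> t *s a) / kern \<rho> t)) has_derivative integral (cbox 0 1) (fx z0)) (at z0 within ball z0 \<delta>)"
  proof (rule leibniz_rule)
    fix z and t :: real assume z: "z \<in> ball z0 \<delta>"
    have "((\<lambda>z. G (z + kern \<rho> t *s a)) has_derivative D (z + kern \<rho> t *s a)) (at z)"
      by (rule has_derivative_compose[where f="\<lambda>z. z + kern \<rho> t *s a", OF _ deriv[OF kern_in[OF z]]]) 
         (auto intro!: derivative_eq_intros)
    then have "((\<lambda>z. G (z + kern \<rho> t *s a) / kern \<rho> t) has_derivative (\<lambda>b. D (z + kern \<rho> t *s a) b / kern \<rho> t)) (at z)"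
      by (rule bounded_linear.has_derivative[OF bounded_linear_divide])
    then show "((\<lambda>z. G (z + kern \<rho> t *s a) / kern \<rho> t) has_derivative blinfun_apply (fx z t)) (at z within ball z0 \<delta>)"
      using fx[OF z] by (simp add: has_derivative_at_withinI)
  qed (use mean pos continuous_fx in auto)
  then have "((\<lambda>z. integral (cbox 0 1) (\<lambda>t. G (z + kern \<rho> t *s a) / kern \<rho> t)) has_derivative integral (cbox 0 1) (fx z0)) (at z0)"
    by (subst (asm) at_within_open) (use pos in auto)
  then show ?thesis unfolding cbox_interval
    by (rule has_derivative_transform_within_open[where s="ball z0 \<delta>"])
       (use mean pos in \<open>auto simp: cbox_interval integral_unique\<close>)
qed

text \<open>The source of both complex linearity and symmetry: the second derivative in the
  directions \<open>a\<close>, \<open>b\<close> is the circle mean, along \<open>a\<close>, of the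
  first derivative in the direction \<open>b\<close>.\<close>

lemma deriv2_apply: "((\<lambda>t. D (z0 + kern \<rho> t *s a) b / kern \<rho> t) has_integral blinfun_apply (integral {0..1} (fx z0)) b) {0..1}"
proof -
  have z: "z0 \<in> ball z0 \<delta>" using pos by simp
  have "((\<lambda>t. blinfun_apply (fx z0 t) b) has_integral blinfun_apply (integral {0..1} (fx z0)) b) {0..1}"
    using has_integral_linear[OF integrable_integral[OF fx_integrable[OF z]] blinfun.bounded_linear_left[of b]]
    by (simp add: o_def)
  then show ?thesis by (simp add: fx[OF z])
qed

lemma deriv2_clin: "blinfun_apply (integral {0..1} (fx z0)) (c *s b) = c * blinfun_apply (integral {0..1} (fx z0)) b"
proof -
  have z: "z0 \<in> ball z0 \<delta>" using pos by simp
  have "((\<lambda>t. c * (D (z0 + kern \<rho> t *s a) b / kern \<rho> t)) has_integral c * blinfun_apply (integral {0..1} (fx z0)) b) {0..1}"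
    by (rule has_integral_mult_right[OF deriv2_apply])
  moreover have "(\<lambda>t. c * (D (z0 + kern \<rho> t *s a) b / kern \<rho> t)) = (\<lambda>t. D (z0 + kern \<rho> t *s a) (c *s b) / kern \<rho> t)"
    by (simp add: clin kern_in[OF z])
  ultimately show ?thesis using has_integral_unique[OF deriv2_apply] by auto
qed

end

context holomorphic_fun begin

text \<open>Closes the class under differentiation, so that it can be iterated to the third
  derivatives in the curvature.\<close>

lemma deriv_holomorphic_fun: "\<exists>D2. holomorphic_fun (\<lambda>z. D z a) D2 S"
proof -
  have "\<exists>L. ((\<lambda>z. D z a) has_derivative L) (at z0) \<and> (\<forall>c b. L (c *s b) = c * L b)" if z0: "z0 \<in> S" for z0
  proof -
    obtain \<delta> \<rho> where "holomorphic_fun_disc G D S z0 a \<delta> \<rho>" using roomE[OF z0] by blast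
    then interpret holomorphic_fun_disc G D S z0 a \<delta> \<rho> .
    show ?thesis using deriv2 deriv2_clin by blast
  qed
  then have "\<forall>z\<in>S. \<exists>L. ((\<lambda>z. D z a) has_derivative L) (at z) \<and> (\<forall>c b. L (c *s b) = c * L b)" by blast
  from bchoice[OF this] obtain D2 where "\<forall>z\<in>S. ((\<lambda>z. D z a) has_derivative D2 z) (at z) \<and> (\<forall>c b. D2 z (c *s b) = c * D2 z b)" ..
  then have "holomorphic_fun (\<lambda>z. D z a) D2 S" using S unfolding holomorphic_fun_def by blast
  then show ?thesis by blast
qed

text \<open>By \<open>deriv2_apply\<close> the left side is the mean along \<open>a\<close> of the
  function \<open>D z b\<close>. That function is itself holomorphic, so \<open>mean\<close>
  evaluates the same integral as its derivative in the direction \<open>a\<close>.\<close>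

lemma sym2:
  assumes "holomorphic_fun (\<lambda>z. D z a) Da S" "holomorphic_fun (\<lambda>z. D z b) Db S" "z0 \<in> S"
  shows "Da z0 b = Db z0 a"
proof -
  obtain \<delta> \<rho> where r: "holomorphic_fun_disc G D S z0 a \<delta> \<rho>" using roomE[OF assms(3)] by blast
  interpret holomorphic_fun_disc G D S z0 a \<delta> \<rho> by fact
  have "holomorphic_fun_disc (\<lambda>z. D z b) Db S z0 a \<delta> \<rho>"
    using assms(2) r unfolding holomorphic_fun_disc_def by blast
  from holomorphic_fun_disc.mean[OF this, of z0] pos 
  have "((\<lambda>t. D (z0 + kern \<rho> t *s a) b / kern \<rho> t) has_integral Db z0 a) {0..1}" by simp
  with deriv2_apply[of b] have "blinfun_apply (integral {0..1} (fx z0)) b = Db z0 a"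
    using has_integral_unique by blast
  moreover have "blinfun_apply (integral {0..1} (fx z0)) = Da z0"
    using has_derivative_unique[OF deriv2] holomorphic_fun.deriv[OF assms(1,3)] by blast
  ultimately show ?thesis by simp
qed

end

lemma holomorphic_map_on_has_derivative:
  assumes "holomorphic_map_on F S" "x \<in> S"
  shows "(F has_derivative dir_deriv F x) (at x)" "dir_deriv F x (c *s v) = c *s dir_deriv F x v"
  using assms has_derivative_frechet unfolding holomorphic_map_on_def by metis+

lemma holomorphic_map_on_component:
  assumes "holomorphic_map_on F S"
  shows "holomorphic_fun (\<lambda>z. F z $ k) (\<lambda>z v. dir_deriv F z v $ k) S"
  using assms holomorphic_map_on_has_derivative[OF assms]
  by unfold_locales (auto simp: holomorphic_map_on_def intro: bounded_linear.has_derivative[OF bounded_linear_vec_nth])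

lemma holomorphic_map_on_deriv:
  assumes "holomorphic_map_on F S"
  shows "holomorphic_map_on (\<lambda>z. dir_deriv F z a) S"
proof -
  have "\<forall>k. \<exists>D2. holomorphic_fun (\<lambda>z. dir_deriv F z a $ k) D2 S"
    using holomorphic_fun.deriv_holomorphic_fun[OF holomorphic_map_on_component[OF assms]] by blast
  from choice[OF this] obtain D2 where D2: "\<And>k. holomorphic_fun (\<lambda>z. dir_deriv F z a $ k) (D2 k) S" by blast
  show ?thesis unfolding holomorphic_map_on_def
  proof (intro conjI ballI exI allI)
    show "open S" using assms by (simp add: holomorphic_map_on_def)
    fix x assume x: "x \<in> S"
    show "((\<lambda>z. dir_deriv F z a) has_derivative (\<lambda>h. \<chi> k. D2 k x h)) (at x)"
      by (rule has_derivative_vecI) (use holomorphic_fun.deriv[OF D2 x] in simp)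
    show "(\<chi> k. D2 k x (c *s v)) = c *s (\<chi> k. D2 k x v)" for c v
      using holomorphic_fun.clin[OF D2 x] by (simp add: vec_eq_iff)
  qed
qed

lemma holomorphic_map_on_second_deriv_sym:
  assumes "holomorphic_map_on F S" "x \<in> S"
  shows "dir_deriv (\<lambda>z. dir_deriv F z a) x b = dir_deriv (\<lambda>z. dir_deriv F z b) x a"
proof (rule iffD2[OF vec_eq_iff], rule allI)
  fix k
  let ?D2 = "\<lambda>a z v. dir_deriv (\<lambda>z. dir_deriv F z a) z v $ k"
  have c: "holomorphic_fun (\<lambda>z. F z $ k) (\<lambda>z v. dir_deriv F z v $ k) S"
    by (rule holomorphic_map_on_component[OF assms(1)])
  have c2: "holomorphic_fun (\<lambda>z. dir_deriv F z a $ k) (?D2 a) S" for a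
    by (rule holomorphic_map_on_component[OF holomorphic_map_on_deriv[OF assms(1)]])
  show "dir_deriv (\<lambda>z. dir_deriv F z a) x b $ k = dir_deriv (\<lambda>z. dir_deriv F z b) x a $ k"
    using holomorphic_fun.sym2[where D = "\<lambda>z v. dir_deriv F z v $ k" and Da = "?D2 a" and Db = "?D2 b" and a = a and b = b and S = S
          and G = "\<lambda>z. F z $ k", OF c c2[of a] c2[of b] assms(2)] by assumption
qed

section \<open>The Fubini--Study metric\<close>

lemma hermitian_simps:
  "hermitian (a + b) c = hermitian a c + hermitian b c"
  "hermitian a (b + c) = hermitian a b + hermitian a c"
  "hermitian (a - b) c = hermitian a c - hermitian b c"
  "hermitian a (b - c) = hermitian a b - hermitian a c"
  "hermitian (- a) c = - hermitian a c"
  "hermitian a (- c) = - hermitian a c"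
  "hermitian (z *s a) c = z * hermitian a c"
  "hermitian a (z *s c) = cnj z * hermitian a c"
  "hermitian (r *\<^sub>R a) c = of_real r * hermitian a c"
  "hermitian a (r *\<^sub>R c) = of_real r * hermitian a c"
  "hermitian 0 c = 0" "hermitian a 0 = 0"
  by (simp_all add: hermitian_def algebra_simps sum.distrib sum_subtractf sum_negf sum_distrib_left scaleR_conv_of_real[where 'a=complex])

lemma cnj_hermitian: "cnj (hermitian a b) = hermitian b a"
  by (simp add: hermitian_def mult.commute)

lemma hermitian_self: "hermitian a a = of_real ((norm a)\<^sup>2)"
  by (simp add: hermitian_def norm_vec_def L2_set_def sum_nonneg complex_norm_square[symmetric])

lemma Re_hermitian: "Re (hermitian a b) = a \<bullet> b"
  by (simp add: hermitian_def inner_vec_def inner_complex_def)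

lemma bounded_bilinear_hermitian:
  "bounded_bilinear (hermitian :: complex ^ 'n::finite \<Rightarrow> complex ^ 'n \<Rightarrow> complex)"
  unfolding bilinear_conv_bounded_bilinear[symmetric] bilinear_def
  by (auto intro!: linearI simp: hermitian_simps scaleR_conv_of_real[where 'a=complex])

lemmas has_derivative_hermitian [derivative_intros] = bounded_bilinear.FDERIV[OF bounded_bilinear_hermitian]
lemmas continuous_on_hermitian [continuous_intros] = bounded_bilinear.continuous_on[OF bounded_bilinear_hermitian]

lemma bounded_bilinear_vector_smult:
  "bounded_bilinear ((*s) :: complex \<Rightarrow> complex ^ 'n::finite \<Rightarrow> complex ^ 'n)"
  unfolding bilinear_conv_bounded_bilinear[symmetric] bilinear_def
  by (auto intro!: linearI simp: vec_eq_iff algebra_simps)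

lemmas has_derivative_vector_smult [derivative_intros] = bounded_bilinear.FDERIV[OF bounded_bilinear_vector_smult]
lemmas continuous_on_vector_smult [continuous_intros] = bounded_bilinear.continuous_on[OF bounded_bilinear_vector_smult]

lemma scaleR_eq_smult: "r *\<^sub>R (v :: complex ^ 'n::finite) = complex_of_real r *s v"
  by (simp add: vec_eq_iff scaleR_conv_of_real[where 'a=complex])

lemma cmod_hermitian_le: "cmod (hermitian a b) \<le> norm a * norm b"
proof (cases "hermitian a b = 0")
  case False
  \<comment> \<open>The conjugate phase makes the Hermitian product real, so the real
    Cauchy--Schwarz inequality applies.\<close>
  define c where "c = cnj (sgn (hermitian a b))"
  have "of_real (cmod (hermitian a b)) = hermitian (c *s a) b"
    using False by (simp add: hermitian_simps c_def sgn_div_norm complex_norm_square[symmetric] scaleR_conv_of_real[where 'a=complex] power2_eq_square field_simps)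
  then have "cmod (hermitian a b) = (c *s a) \<bullet> b" by (metis Re_complex_of_real Re_hermitian)
  also have "\<dots> \<le> norm (c *s a) * norm b" by (rule norm_cauchy_schwarz)
  also have "norm (c *s a) = norm a" using False by (simp add: norm_vector_smult c_def norm_sgn)
  finally show ?thesis .
qed simp

text \<open>The complex-valued form whose real part is the metric: one Hermitian identity
  replaces the pair of real ones for \<open>u\<close> and \<open>\<i> u\<close>.\<close>

definition fs_herm :: "complex ^ 'n::finite \<Rightarrow> complex ^ 'n \<Rightarrow> complex ^ 'n \<Rightarrow> complex" where
  "fs_herm w u v = ((1 + hermitian w w) * hermitian u v - hermitian u w * hermitian w v) / (1 + hermitian w w)\<^sup>2"

lemma fubini_study_eq: "fubini_study w u v = Re (fs_herm w u v)"
proof -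
  have "(1 + hermitian w w)\<^sup>2 = of_real ((1 + (norm w)\<^sup>2)\<^sup>2)" by (simp add: hermitian_self)
  then show ?thesis unfolding fubini_study_def fs_herm_def by (metis Re_divide_of_real)
qed

lemma one_plus_hermitian_neq_0 [simp]: "1 + hermitian w w \<noteq> 0"
proof
  assume "1 + hermitian w w = 0"
  then have "complex_of_real (1 + (norm w)\<^sup>2) = 0" by (simp add: hermitian_self)
  then have "1 + (norm w)\<^sup>2 = 0" using of_real_eq_0_iff by blast
  then show False by (smt (verit) zero_le_power2)
qed

lemma cnj_hermitian_self [simp]: "cnj (hermitian w w) = hermitian w w"
  by (rule cnj_hermitian)

lemma fs_herm_simps:
  "fs_herm w (a + b) c = fs_herm w a c + fs_herm w b c"
  "fs_herm w a (b + c) = fs_herm w a b + fs_herm w a c"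
  "fs_herm w (a - b) c = fs_herm w a c - fs_herm w b c"
  "fs_herm w a (b - c) = fs_herm w a b - fs_herm w a c"
  "fs_herm w (- a) c = - fs_herm w a c"
  "fs_herm w a (- c) = - fs_herm w a c"
  "fs_herm w (z *s a) c = z * fs_herm w a c"
  "fs_herm w a (z *s c) = cnj z * fs_herm w a c"
  "fs_herm w (r *\<^sub>R a) c = of_real r * fs_herm w a c"
  "fs_herm w a (r *\<^sub>R c) = of_real r * fs_herm w a c"
  "fs_herm w 0 c = 0" "fs_herm w a 0 = 0"
  by (simp_all add: fs_herm_def hermitian_simps diff_divide_distrib[symmetric] add_divide_distrib[symmetric]
      minus_divide_left algebra_simps)

lemma fs_herm_sum:
  "fs_herm w (\<Sum>i\<in>A. f i) c = (\<Sum>i\<in>A. fs_herm w (f i) c)"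
  "fs_herm w c (\<Sum>i\<in>A. f i) = (\<Sum>i\<in>A. fs_herm w c (f i))"
  by (induction A rule: infinite_finite_induct) (simp_all add: fs_herm_simps)

lemma cnj_fs_herm: "cnj (fs_herm w a b) = fs_herm w b a"
  by (simp add: fs_herm_def cnj_hermitian mult.commute)

lemma fs_herm_self: "fs_herm w a a = of_real (fubini_study w a a)"
proof -
  have "cnj (fs_herm w a a) = fs_herm w a a" by (rule cnj_fs_herm)
  then show ?thesis by (simp add: complex_eq_iff fubini_study_eq)
qed

text \<open>Cauchy--Schwarz bounds the subtracted term by the product of the squared norms of
  \<open>a\<close> and \<open>w\<close>, which leaves at least the squared norm of \<open>a\<close>
  in the numerator.\<close>

lemma fubini_study_pos:
  assumes "a \<noteq> 0" shows "fubini_study w a a > 0"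
proof -
  have "hermitian a w * hermitian w a = of_real ((cmod (hermitian a w))\<^sup>2)"
    by (metis cnj_hermitian complex_norm_square)
  then have e: "fubini_study w a a = ((1 + (norm w)\<^sup>2) * (norm a)\<^sup>2 - (cmod (hermitian a w))\<^sup>2) / (1 + (norm w)\<^sup>2)\<^sup>2"
    unfolding fubini_study_def by (simp add: hermitian_self)
  have "(cmod (hermitian a w))\<^sup>2 \<le> (norm a * norm w)\<^sup>2"
    by (rule power_mono[OF cmod_hermitian_le norm_ge_zero])
  then have "(1 + (norm w)\<^sup>2) * (norm a)\<^sup>2 - (cmod (hermitian a w))\<^sup>2 \<ge> (norm a)\<^sup>2"
    by (simp add: power_mult_distrib algebra_simps)
  moreover have "(norm a)\<^sup>2 > 0" using assms by simp
  moreover have "1 + (norm w)\<^sup>2 > 0" by (smt (verit) zero_le_power2)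
  ultimately show ?thesis unfolding e by (intro divide_pos_pos) (smt (verit), simp)
qed

lemma fs_herm_self_eq_0_iff [simp]: "fs_herm w a a = 0 \<longleftrightarrow> a = 0"
proof
  assume "fs_herm w a a = 0"
  then have "fubini_study w a a = 0" by (metis fs_herm_self of_real_eq_0_iff)
  then show "a = 0" using fubini_study_pos[of a w] by fastforce
qed (simp add: fs_herm_simps)

lemma fs_herm_nondegenerate:
  assumes "\<And>t. Re (fs_herm w a t) = 0" shows "a = 0"
  using assms[of a] fubini_study_pos[of a w] by (force simp: fubini_study_eq)

text \<open>The Christoffel symbols of the Fubini--Study metric in an affine chart (see
  \<open>christoffel_fubini_study\<close>). They are complex bilinear, as for every Kaehler metric
  in holomorphic coordinates.\<close>

definition fs_christoffel :: "complex ^ 'n::finite \<Rightarrow> complex ^ 'n \<Rightarrow> complex ^ 'n \<Rightarrow> complex ^ 'n" where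
  "fs_christoffel w u v = (- 1 / (1 + hermitian w w)) *s (hermitian u w *s v + hermitian v w *s u)"

lemma fs_christoffel_simps:
  "fs_christoffel w (a + b) c = fs_christoffel w a c + fs_christoffel w b c"
  "fs_christoffel w a (b + c) = fs_christoffel w a b + fs_christoffel w a c"
  "fs_christoffel w (a - b) c = fs_christoffel w a c - fs_christoffel w b c"
  "fs_christoffel w a (b - c) = fs_christoffel w a b - fs_christoffel w a c"
  "fs_christoffel w (z *s a) c = z *s fs_christoffel w a c"
  "fs_christoffel w a (z *s c) = z *s fs_christoffel w a c"
  by (simp_all add: fs_christoffel_def hermitian_simps vec_eq_iff algebra_simps add_divide_distrib[symmetric] diff_divide_distrib[symmetric])

lemma fs_christoffel_commute: "fs_christoffel w a b = fs_christoffel w b a"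
  by (simp add: fs_christoffel_def add.commute)

lemma fs_herm_christoffel:
  "fs_herm w (fs_christoffel w a b) c = - (hermitian a w * fs_herm w b c + hermitian b w * fs_herm w a c) / (1 + hermitian w w)"
  "fs_herm w c (fs_christoffel w a b) = - (hermitian w a * fs_herm w c b + hermitian w b * fs_herm w c a) / (1 + hermitian w w)"
  by (simp_all add: fs_christoffel_def fs_herm_simps cnj_hermitian diff_divide_distrib)

text \<open>Metric compatibility of the connection along a map, in Hermitian form: the product rule
  with covariant derivatives. The orthogonality relations below are differentiated through
  it.\<close>

lemma has_derivative_fs_herm:
  assumes "(W has_derivative W') (at x)" "(A has_derivative A') (at x)" "(C has_derivative C') (at x)"
  shows "((\<lambda>y. fs_herm (W y) (A y) (C y)) has_derivative
     (\<lambda>b. fs_herm (W x) (A' b + fs_christoffel (W x) (W' b) (A x)) (C x)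
        + fs_herm (W x) (A x) (C' b + fs_christoffel (W x) (W' b) (C x)))) (at x)"
proof -
  define s where "s = 1 + hermitian (W x) (W x)"
  have s0: "s \<noteq> 0" by (simp add: s_def)
  let ?w = "W x" and ?a = "A x" and ?c = "C x"
  have "((\<lambda>y. hermitian (W y) (W y)) has_derivative (\<lambda>b. hermitian ?w (W' b) + hermitian (W' b) ?w)) (at x)"
    by (rule has_derivative_hermitian[OF assms(1,1)])
  then have 1: "((\<lambda>y. 1 + hermitian (W y) (W y)) has_derivative (\<lambda>b. hermitian ?w (W' b) + hermitian (W' b) ?w)) (at x)"
    by (auto intro: derivative_eq_intros)
  have 2: "((\<lambda>y. (1 + hermitian (W y) (W y))\<^sup>2) has_derivative
      (\<lambda>b. 2 * s * (hermitian ?w (W' b) + hermitian (W' b) ?w))) (at x)"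
    unfolding power2_eq_square by (rule has_derivative_eq_rhs[OF has_derivative_mult[OF 1 1]]) (simp add: s_def algebra_simps)
  note 3 = has_derivative_diff[OF has_derivative_mult[OF 1 has_derivative_hermitian[OF assms(2,3)]]
      has_derivative_mult[OF has_derivative_hermitian[OF assms(2,1)] has_derivative_hermitian[OF assms(1,3)]]]
  have "(1 + hermitian ?w ?w)\<^sup>2 \<noteq> 0" by simp
  note 4 = has_derivative_divide'[OF 3 2 this, folded fs_herm_def]
  show ?thesis
    apply (rule has_derivative_eq_rhs[OF 4])
    apply (rule ext)
    apply (simp only: fs_herm_simps fs_herm_christoffel)
    apply (simp only: fs_herm_def)
    apply (fold s_def)
    using s0 by (simp add: field_simps power2_eq_square)
qed

text \<open>Both functions have the same derivatives at \<open>x\<close>, hence the same chosen one,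
  whether or not any exists.\<close>

lemma frechet_derivative_cong:
  assumes "open S" "x \<in> S" "\<And>y. y \<in> S \<Longrightarrow> f y = g y"
  shows "frechet_derivative f (at x) = frechet_derivative g (at x)"
proof -
  have "(f has_derivative L) (at x) \<longleftrightarrow> (g has_derivative L) (at x)" for L
    using assms has_derivative_transform_within_open[of f L x UNIV S g]
      has_derivative_transform_within_open[of g L x UNIV S f] by auto
  then show ?thesis by (simp add: frechet_derivative_def)
qed

lemma christoffelI:
  assumes "\<And>t. g x w t = (dir_deriv (\<lambda>y. g y v t) x u + dir_deriv (\<lambda>y. g y u t) x v
       - dir_deriv (\<lambda>y. g y u v) x t) / 2"
    and "\<And>w'. (\<And>t. g x w' t = g x w t) \<Longrightarrow> w' = w"
  shows "christoffel g x u v = w"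
  unfolding christoffel_def
proof (rule the_equality)
  fix w' assume "\<forall>t. g x w' t = (dir_deriv (\<lambda>y. g y v t) x u + dir_deriv (\<lambda>y. g y u t) x v
       - dir_deriv (\<lambda>y. g y u v) x t) / 2"
  then show "w' = w" by (intro assms(2)) (simp add: assms(1))
qed (use assms(1) in blast)

text \<open>Compatibility expands the three derivatives of the Koszul formula; the symmetry of
  \<open>fs_christoffel\<close> cancels all terms except two equal ones.\<close>

lemma christoffel_fubini_study: "christoffel fubini_study w u v = fs_christoffel w u v"
proof (rule christoffelI)
  have d: "dir_deriv (\<lambda>y. fubini_study y a c) w b =
      Re (fs_herm w (fs_christoffel w b a) c + fs_herm w a (fs_christoffel w b c))" for a b c
  proof -
    have "((\<lambda>y. fubini_study y a c) has_derivative (\<lambda>b. Re (fs_herm w (0 + fs_christoffel w b a) c + fs_herm w a (0 + fs_christoffel w b c)))) (at w)"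
      unfolding fubini_study_eq
      by (intro bounded_linear.has_derivative[OF bounded_linear_Re] has_derivative_fs_herm has_derivative_const has_derivative_ident)
    from has_derivative_frechet[OF this] show ?thesis by simp
  qed
  have s: "Re (fs_herm w a b) = Re (fs_herm w b a)" for a b
    using cnj_fs_herm[of w a b] by (metis cnj.simps(1))
  show "fubini_study w (fs_christoffel w u v) t = (dir_deriv (\<lambda>y. fubini_study y v t) w u + dir_deriv (\<lambda>y. fubini_study y u t) w v
       - dir_deriv (\<lambda>y. fubini_study y u v) w t) / 2" for t
    unfolding d unfolding fubini_study_eq
    using fs_christoffel_commute[of w] s[of v "fs_christoffel w u t"]  s[of u "fs_christoffel w v t"]
    by simp
  fix w' assume "\<And>t. fubini_study w w' t = fubini_study w (fs_christoffel w u v) t"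
  then have "w' - fs_christoffel w u v = 0"
    by (intro fs_herm_nondegenerate[of w]) (simp add: fubini_study_eq fs_herm_simps)
  then show "w' = fs_christoffel w u v" by simp
qed

section \<open>Complex Gram matrices and Cramer's rule\<close>

definition gram :: "complex ^ 'n::finite \<Rightarrow> ('m::finite \<Rightarrow> complex ^ 'n) \<Rightarrow> complex ^ 'm ^ 'm" where
  "gram w E = (\<chi> i k. fs_herm w (E k) (E i))"

text \<open>Cramer's rule for the coefficients of the vector in the complex span of \<open>E\<close>
  that has the products \<open>r i\<close> with \<open>E i\<close>. Being a quotient of
  determinants, it inherits differentiability and continuity from the data.\<close>

definition gram_solve :: "complex ^ 'n::finite \<Rightarrow> ('m::finite \<Rightarrow> complex ^ 'n) \<Rightarrow> ('m \<Rightarrow> complex) \<Rightarrow> complex ^ 'm" where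
  "gram_solve w E r = (\<chi> k. det (\<chi> i j. if j = k then r i else gram w E $ i $ j) / det (gram w E))"

text \<open>A kernel vector of the Gram matrix gives a combination of the \<open>E i\<close>
  orthogonal to each of them, hence to itself, hence zero by definiteness.\<close>

lemma
  assumes indep: "\<And>t. (\<Sum>k\<in>UNIV. t $ k *s E k) = 0 \<Longrightarrow> t = 0"
  shows det_gram: "det (gram w E) \<noteq> 0"
    and gram_solve_iff: "(\<forall>i. fs_herm w (\<Sum>k\<in>UNIV. c $ k *s E k) (E i) = r i) \<longleftrightarrow> c = gram_solve w E r"
proof -
  have mult: "(gram w E *v t) $ i = fs_herm w (\<Sum>k\<in>UNIV. t $ k *s E k) (E i)" for t i
    by (simp add: matrix_vector_mult_def gram_def fs_herm_sum fs_herm_simps mult.commute)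
  have "t = 0" if "gram w E *v t = 0" for t
  proof -
    let ?v = "\<Sum>k\<in>UNIV. t $ k *s E k"
    have "fs_herm w ?v (E i) = 0" for i using mult[of t i] that by simp
    then have "fs_herm w ?v ?v = 0" by (subst fs_herm_sum(2)) (simp add: fs_herm_simps)
    then show "t = 0" using indep by simp
  qed
  then have "invertible (gram w E)"
    by (simp add: matrix_left_invertible_ker invertible_left_inverse)
  then show d: "det (gram w E) \<noteq> 0" by (simp add: invertible_det_nz)
  have "(\<forall>i. fs_herm w (\<Sum>k\<in>UNIV. c $ k *s E k) (E i) = r i) \<longleftrightarrow> gram w E *v c = (\<chi> i. r i)"
    by (simp add: vec_eq_iff mult)
  also have "\<dots> \<longleftrightarrow> c = gram_solve w E r"
    unfolding cramer[OF d] gram_solve_def by (simp cong: if_cong)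
  finally show "(\<forall>i. fs_herm w (\<Sum>k\<in>UNIV. c $ k *s E k) (E i) = r i) \<longleftrightarrow> c = gram_solve w E r" .
qed

lemma has_derivative_imp_differentiable: "(f has_derivative L) F \<Longrightarrow> f differentiable F"
  by (auto simp: differentiable_def)

lemma differentiable_det:
  fixes M :: "'d::real_normed_vector \<Rightarrow> 'a::real_normed_field ^ 'm::finite ^ 'm"
  assumes "\<And>i j. (\<lambda>x. M x $ i $ j) differentiable at x"
  shows "(\<lambda>x. det (M x)) differentiable at x"
proof -
  have "(\<lambda>x. \<Prod>i\<in>UNIV. M x $ i $ p i) differentiable at x" for p
  proof -
    obtain M' where "\<And>i j. ((\<lambda>x. M x $ i $ j) has_derivative M' i j) (at x)"
      using assms unfolding differentiable_def by metis
    then show ?thesis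
      by (intro has_derivative_imp_differentiable[OF has_derivative_prod[where f = "\<lambda>i x. M x $ i $ p i" and f' = "\<lambda>i. M' i (p i)"]])
  qed
  then show ?thesis unfolding det_def by (intro differentiable_sum differentiable_mult differentiable_const) auto
qed

lemma differentiable_vecI:
  fixes F :: "'d::real_normed_vector \<Rightarrow> 'a::euclidean_space ^ 'n::finite"
  assumes "\<And>k. (\<lambda>x. F x $ k) differentiable at x"
  shows "F differentiable at x"
proof -
  obtain L where "\<And>k. ((\<lambda>x. F x $ k) has_derivative L k) (at x)"
    using assms unfolding differentiable_def by metis
  then have "(F has_derivative (\<lambda>h. \<chi> k. L k h)) (at x)" by (intro has_derivative_vecI) simp
  then show ?thesis by (rule has_derivative_imp_differentiable)
qed

lemma differentiable_fs_herm:
  assumes "W differentiable at x" "A differentiable at x" "C differentiable at x"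
  shows "(\<lambda>y. fs_herm (W y) (A y) (C y)) differentiable at x"
  using assms has_derivative_fs_herm unfolding differentiable_def by blast

lemma differentiable_gram_solve:
  assumes "W differentiable at x" "\<And>i. (\<lambda>y. E y i) differentiable at x" "\<And>i. (\<lambda>y. r y i) differentiable at x"
    and "\<And>t. (\<Sum>k\<in>UNIV. t $ k *s E x k) = 0 \<Longrightarrow> t = 0"
  shows "(\<lambda>y. gram_solve (W y) (E y) (r y)) differentiable at x"
  unfolding gram_solve_def
  apply (rule differentiable_vecI)
  apply simp
  apply (rule differentiable_divide)
    apply (rule differentiable_det)
    apply (simp add: gram_def)
  subgoal for k i j by (cases "j = k") (auto simp: gram_def intro: differentiable_fs_herm assms)
   apply (rule differentiable_det)
   apply (auto simp add: gram_def intro: differentiable_fs_herm assms)[1]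
  using det_gram[OF assms(4)] by auto

section \<open>Holomorphic immersions in coordinates\<close>

lemma vec_eq_sum_smult_axis: "(v :: complex ^ 'm::finite) = (\<Sum>k\<in>UNIV. v $ k *s axis k 1)"
  by (simp add: vec_eq_iff axis_def if_distrib sum.delta cong: if_cong)

locale hol_immersion =
  fixes F :: "complex ^ 'm::finite \<Rightarrow> complex ^ 'n::finite" and S :: "(complex ^ 'm) set"
  assumes hol: "holomorphic_map_on F S" and inj: "\<And>x. x \<in> S \<Longrightarrow> inj (dir_deriv F x)"
begin

abbreviation "D \<equiv> dir_deriv F"
definition "D2 x u v = dir_deriv (\<lambda>z. D z v) x u"
text \<open>The ambient covariant derivative along \<open>F\<close> of the image of the constant
  field \<open>v\<close>. Its tangential part is the induced connection, its normal part the second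
  fundamental form.\<close>

definition "B x u v = D2 x u v + fs_christoffel (F x) (D x u) (D x v)"
text \<open>The components of the tangential part of \<open>a\<close>. As the tangent space is a
  complex subspace, the Hermitian projection is also the Riemannian one.\<close>

definition "tan_coef x a = gram_solve (F x) (\<lambda>k. D x (axis k 1)) (\<lambda>i. fs_herm (F x) a (D x (axis i 1)))"
abbreviation "H x \<equiv> fs_herm (F x)"
abbreviation "h \<equiv> pullback_metric fubini_study F"

lemma openS: "open S" using hol by (simp add: holomorphic_map_on_def)

lemma deriv_F: "x \<in> S \<Longrightarrow> (F has_derivative D x) (at x)"
  by (rule holomorphic_map_on_has_derivative(1)[OF hol])

lemma deriv_D: "x \<in> S \<Longrightarrow> ((\<lambda>z. D z v) has_derivative (\<lambda>u. D2 x u v)) (at x)"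
  unfolding D2_def by (rule holomorphic_map_on_has_derivative(1)[OF holomorphic_map_on_deriv[OF hol]])

lemma deriv_D2: "x \<in> S \<Longrightarrow> ((\<lambda>z. D2 z u v) has_derivative dir_deriv (\<lambda>z. D2 z u v) x) (at x)"
  "x \<in> S \<Longrightarrow> dir_deriv (\<lambda>z. D2 z u v) x (c *s b) = c *s dir_deriv (\<lambda>z. D2 z u v) x b"
  unfolding D2_def by (rule holomorphic_map_on_has_derivative[OF holomorphic_map_on_deriv[OF holomorphic_map_on_deriv[OF hol]]]; assumption)+

lemma D_lin:
  assumes "x \<in> S"
  shows "D x (c *s v) = c *s D x v" "D x (u + v) = D x u + D x v" "D x (u - v) = D x u - D x v"
    "D x (- v) = - D x v" "D x 0 = 0" "D x (r *\<^sub>R v) = r *\<^sub>R D x v" "D x (sum f A) = (\<Sum>a\<in>A. D x (f a))"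
  using holomorphic_map_on_has_derivative(2)[OF hol assms]
    has_derivative_linear[OF deriv_F[OF assms]]
  by (simp_all add: linear_add linear_diff linear_neg linear_0 linear_cmul linear_sum)

lemma D2_sym: "x \<in> S \<Longrightarrow> D2 x u v = D2 x v u"
  unfolding D2_def by (rule holomorphic_map_on_second_deriv_sym[OF hol])

lemma D2_lin:
  assumes "x \<in> S"
  shows "D2 x (c *s u) v = c *s D2 x u v" "D2 x u (c *s v) = c *s D2 x u v"
    "D2 x (a + b) v = D2 x a v + D2 x b v" "D2 x v (a + b) = D2 x v a + D2 x v b"
    "D2 x (r *\<^sub>R u) v = r *\<^sub>R D2 x u v"
proof -
  show 1: "D2 x (c *s u) v = c *s D2 x u v" for u v c
    unfolding D2_def by (rule holomorphic_map_on_has_derivative(2)[OF holomorphic_map_on_deriv[OF hol] assms])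
  show "D2 x u (c *s v) = c *s D2 x u v" using 1 D2_sym[OF assms] by metis
  show 2: "D2 x (a + b) v = D2 x a v + D2 x b v" for a b v
    using linear_add[OF has_derivative_linear[OF deriv_D[OF assms]]] .
  show "D2 x v (a + b) = D2 x v a + D2 x v b" using 2 D2_sym[OF assms] by metis
  show "D2 x (r *\<^sub>R u) v = r *\<^sub>R D2 x u v"
    using linear_cmul[OF has_derivative_linear[OF deriv_D[OF assms]]] .
qed

lemma B_lin:
  assumes "x \<in> S"
  shows "B x (c *s u) v = c *s B x u v" "B x u (c *s v) = c *s B x u v" "B x u v = B x v u"
  using D2_sym[OF assms, of u v]
  by (simp_all add: B_def D2_lin[OF assms] D_lin[OF assms] fs_christoffel_simps vector_add_ldistrib fs_christoffel_commute)

lemma D_eq_0: "x \<in> S \<Longrightarrow> D x v = 0 \<Longrightarrow> v = 0"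
  using inj[of x] D_lin(5)[of x] by (metis injD)

lemma D_sum_axis: "x \<in> S \<Longrightarrow> (\<Sum>k\<in>UNIV. t $ k *s D x (axis k 1)) = D x t"
  by (subst (2) vec_eq_sum_smult_axis) (simp add: D_lin)

lemma tan_coef:
  assumes "x \<in> S" shows "H x (a - D x (tan_coef x a)) (D x t) = 0"
proof -
  have "\<forall>i. H x (\<Sum>k\<in>UNIV. tan_coef x a $ k *s D x (axis k 1)) (D x (axis i 1)) = H x a (D x (axis i 1))"
    unfolding tan_coef_def by (subst gram_solve_iff) (simp_all add: D_sum_axis[OF assms] D_eq_0[OF assms])
  then have "H x (a - D x (tan_coef x a)) (D x (axis k 1)) = 0" for k
    by (simp add: D_sum_axis[OF assms] fs_herm_simps)
  then show ?thesis
    by (subst D_sum_axis[OF assms, of t, symmetric]) (simp add: fs_herm_sum fs_herm_simps)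
qed

text \<open>Tangent spaces are closed under multiplication by \<open>\<i>\<close>; testing with
  \<open>\<i> *s t\<close> supplies the imaginary part.\<close>

lemma normal_complex:
  assumes "x \<in> S" "\<And>t. Re (H x a (D x t)) = 0" shows "H x a (D x t) = 0"
  using assms(2)[of t] assms(2)[of "\<i> *s t"]
  by (simp add: D_lin[OF assms(1)] fs_herm_simps complex_eq_iff)

lemma tan_coef_unique:
  assumes "x \<in> S" "\<And>t. Re (H x (a - D x c) (D x t)) = 0" shows "tan_coef x a = c"
proof -
  have "H x (D x (tan_coef x a - c)) (D x t) = 0" for t
    using normal_complex[OF assms] tan_coef[OF assms(1), of a t] 
    by (simp add: D_lin[OF assms(1)] fs_herm_simps)
  then have "D x (tan_coef x a - c) = 0" using fs_herm_self_eq_0_iff by blast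
  then show ?thesis using D_eq_0[OF assms(1)] by fastforce
qed

lemma tan_coef_smult: "x \<in> S \<Longrightarrow> tan_coef x (c *s a) = c *s tan_coef x a"
proof (rule tan_coef_unique)
  fix t assume "x \<in> S"
  then have "H x (c *s a - D x (c *s tan_coef x a)) (D x t) = c * H x (a - D x (tan_coef x a)) (D x t)"
    by (simp add: D_lin fs_herm_simps right_diff_distrib)
  then show "Re (H x (c *s a - D x (c *s tan_coef x a)) (D x t)) = 0" using tan_coef[OF \<open>x \<in> S\<close>] by simp
qed

lemma tan_coef_differentiable:
  assumes "x \<in> S" "A differentiable at x"
  shows "(\<lambda>y. tan_coef y (A y)) differentiable at x"
  unfolding tan_coef_def
  by (rule differentiable_gram_solve)
    (use assms deriv_F deriv_D in \<open>auto intro!: differentiable_fs_herm intro: has_derivative_imp_differentiable D_eq_0 simp: D_sum_axis\<close>)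

lemma D2_sum_axis:
  assumes "x \<in> S" shows "(\<Sum>k\<in>UNIV. t $ k *s D2 x b (axis k 1)) = D2 x b t"
proof -
  have "linear (D2 x b)"
    by (rule linearI) (simp_all add: D2_lin[OF assms] scaleR_eq_smult)
  then show ?thesis
    by (subst (2) vec_eq_sum_smult_axis[of t]) (simp add: linear_sum D2_lin[OF assms])
qed

text \<open>Differentiability of \<open>D\<close> in the base point is available for fixed
  directions, so the moving direction \<open>g y\<close> is expanded in the standard basis
  first.\<close>

lemma has_derivative_D_comp:
  assumes U: "open U" "x \<in> U" "\<And>y. y \<in> U \<Longrightarrow> \<tau> y \<in> S"
    and "(\<tau> has_derivative \<tau>') (at x)" "(g has_derivative g') (at x)"
  shows "((\<lambda>y. D (\<tau> y) (g y)) has_derivative (\<lambda>b. D2 (\<tau> x) (\<tau>' b) (g x) + D (\<tau> x) (g' b))) (at x)"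
proof -
  have 1: "((\<lambda>y. g y $ k) has_derivative (\<lambda>b. g' b $ k)) (at x)" for k
    by (rule bounded_linear.has_derivative[OF bounded_linear_vec_nth assms(5)])
  have 2: "((\<lambda>y. D (\<tau> y) (axis k 1)) has_derivative (\<lambda>b. D2 (\<tau> x) (\<tau>' b) (axis k 1))) (at x)" for k
    by (rule has_derivative_compose[OF assms(4) deriv_D]) (use U in auto)
  have "((\<lambda>y. \<Sum>k\<in>UNIV. g y $ k *s D (\<tau> y) (axis k 1)) has_derivative
      (\<lambda>b. \<Sum>k\<in>UNIV. g x $ k *s D2 (\<tau> x) (\<tau>' b) (axis k 1) + g' b $ k *s D (\<tau> x) (axis k 1))) (at x)"
    by (intro has_derivative_sum has_derivative_vector_smult 1 2)
  then have "((\<lambda>y. \<Sum>k\<in>UNIV. g y $ k *s D (\<tau> y) (axis k 1)) has_derivative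
      (\<lambda>b. D2 (\<tau> x) (\<tau>' b) (g x) + D (\<tau> x) (g' b))) (at x)"
    using U by (simp add: sum.distrib D2_sum_axis D_sum_axis)
  then show ?thesis
    by (rule has_derivative_transform_within_open[OF _ U(1,2)]) (simp add: D_sum_axis U)
qed

lemma has_derivative_H:
  assumes "x \<in> S" "(A has_derivative A') (at x)"
  shows "((\<lambda>y. H y (A y) (D y v)) has_derivative
    (\<lambda>b. H x (A' b + fs_christoffel (F x) (D x b) (A x)) (D x v) + H x (A x) (B x b v))) (at x)"
  unfolding B_def by (rule has_derivative_fs_herm[OF deriv_F[OF assms(1)] assms(2) deriv_D[OF assms(1)]])

lemma h_eq: "h x u v = Re (H x (D x u) (D x v))"
  by (simp add: pullback_metric_def fubini_study_eq)

lemma Re_H_commute: "Re (H x a b) = Re (H x b a)"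
  using cnj_fs_herm[of "F x" a b] by (metis cnj.simps(1))

lemma h_nondeg:
  assumes "x \<in> S" "\<And>t. h x a t = h x b t" shows "a = b"
proof -
  have "Re (H x (D x (a - b)) (D x (a - b))) = 0"
    using assms(2)[of "a - b"] by (simp add: h_eq D_lin[OF assms(1)] fs_herm_simps)
  then have "D x (a - b) = 0"
    by (metis fs_herm_self_eq_0_iff fs_herm_self of_real_0 fubini_study_eq)
  then show ?thesis using D_eq_0[OF assms(1)] by fastforce
qed

text \<open>The Gauss formula: the Levi-Civita connection of the induced metric is the tangential
  part of the ambient one. Koszul applies as in the ambient case, \<open>B\<close> being
  symmetric.\<close>

lemma christoffel_h:
  assumes "x \<in> S" shows "christoffel h x u v = tan_coef x (B x u v)"
proof (rule christoffelI)
  have d: "dir_deriv (\<lambda>y. h y a c) x b = Re (H x (B x b a) (D x c) + H x (D x a) (B x b c))" for a b c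
  proof -
    have "((\<lambda>y. h y a c) has_derivative (\<lambda>b. Re (H x (B x b a) (D x c) + H x (D x a) (B x b c)))) (at x)"
      unfolding h_eq B_def[of _ _ a]
      by (intro bounded_linear.has_derivative[OF bounded_linear_Re] has_derivative_H deriv_D assms)
    from has_derivative_frechet[OF this] show ?thesis by simp
  qed
  have "h x (tan_coef x (B x u v)) t = Re (H x (B x u v) (D x t))" for t
    using tan_coef[OF assms, of "B x u v" t] by (simp add: h_eq fs_herm_simps)
  then show "h x (tan_coef x (B x u v)) t = (dir_deriv (\<lambda>y. h y v t) x u + dir_deriv (\<lambda>y. h y u t) x v
       - dir_deriv (\<lambda>y. h y u v) x t) / 2" for t
    unfolding d B_lin(3)[OF assms, of v u] B_lin(3)[OF assms, of t u] B_lin(3)[OF assms, of t v]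
    using Re_H_commute[of x "D x v" "B x u t"] Re_H_commute[of x "D x u" "B x v t"] by simp
qed (use h_nondeg[OF assms] in blast)

end

context hol_immersion begin

section \<open>Holomorphic sectional curvature\<close>

lemma christoffel_h_lin:
  assumes "x \<in> S"
  shows "christoffel h x (c *s u) v = c *s christoffel h x u v"
    and "christoffel h x u (c *s v) = c *s christoffel h x u v"
  by (simp_all add: christoffel_h assms B_lin[OF assms] tan_coef_smult)

text \<open>The ambient curvature term. The combination \<open>C u + \<i> *s C (\<i> *s u)\<close>
  is twice a d-bar derivative: it kills the holomorphic dependence through \<open>D2\<close> and
  keeps the antiholomorphic one through the second slot of \<open>hermitian\<close>.\<close>

lemma dbar_christoffel:
  assumes x: "x \<in> S"
  obtains C where "((\<lambda>y. fs_christoffel (F y) (D y u) (D y u)) has_derivative C) (at x)"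
    "C u + \<i> *s C (\<i> *s u) = (- 4 * H x (D x u) (D x u)) *s D x u"
proof -
  define s where "s = (\<lambda>y. 1 + hermitian (F y) (F y))"
  have s0: "s y \<noteq> 0" for y by (simp add: s_def)
  define s' where "s' = (\<lambda>b. hermitian (F x) (D x b) + hermitian (D x b) (F x))"
  define n' where "n' = (\<lambda>b. hermitian (D x u) (D x b) + hermitian (D2 x b u) (F x))"
  have s': "(s has_derivative s') (at x)"
    unfolding s_def s'_def using has_derivative_hermitian[OF deriv_F[OF x] deriv_F[OF x]]
    by (auto intro: derivative_eq_intros)
  have n': "((\<lambda>y. hermitian (D y u) (F y)) has_derivative n') (at x)"
    unfolding n'_def by (rule has_derivative_hermitian[OF deriv_D[OF x] deriv_F[OF x]])
  define q where "q = (\<lambda>y. - 2 * (hermitian (D y u) (F y) / s y))"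
  define q' where "q' = (\<lambda>b. - 2 * ((n' b * s x - hermitian (D x u) (F x) * s' b) / (s x * s x)))"
  have q': "(q has_derivative q') (at x)"
    unfolding q_def q'_def by (intro has_derivative_mult_right has_derivative_divide' n' s' s0)
  \<comment> \<open>On the diagonal the symbol is a scalar multiple of \<open>D y u\<close>, so only
    the scalar \<open>q\<close> has an antiholomorphic part.\<close>
  have eq: "fs_christoffel (F y) (D y u) (D y u) = q y *s D y u" for y
    by (simp add: fs_christoffel_def q_def s_def vec_eq_iff)
  have 1: "((\<lambda>y. fs_christoffel (F y) (D y u) (D y u)) has_derivative (\<lambda>b. q x *s D2 x b u + q' b *s D x u)) (at x)"
    unfolding eq by (rule has_derivative_vector_smult[OF q' deriv_D[OF x]])
  have nn: "n' u + \<i> * n' (\<i> *s u) = 2 * hermitian (D x u) (D x u)"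
    and ss: "s' u + \<i> * s' (\<i> *s u) = 2 * hermitian (F x) (D x u)"
    by (simp_all add: n'_def s'_def D_lin[OF x] D2_lin[OF x] hermitian_simps algebra_simps)
  have "q' u + \<i> * q' (\<i> *s u) =
      - 2 * (((n' u + \<i> * n' (\<i> *s u)) * s x - hermitian (D x u) (F x) * (s' u + \<i> * s' (\<i> *s u))) / (s x * s x))"
    unfolding q'_def using s0[of x] by (simp add: field_simps)
  also have "\<dots> = - 4 * H x (D x u) (D x u)"
    unfolding nn ss fs_herm_def by (simp add: s_def power2_eq_square field_simps)
  finally have "q' u + \<i> * q' (\<i> *s u) = - 4 * H x (D x u) (D x u)" .
  then have "(q x *s D2 x u u + q' u *s D x u) + \<i> *s (q x *s D2 x (\<i> *s u) u + q' (\<i> *s u) *s D x u) =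
      (- 4 * H x (D x u) (D x u)) *s D x u"
    by (simp only: D2_lin[OF x] vec_eq_iff vector_add_component vector_smult_component)
       (simp add: algebra_simps flip: distrib_right mult.assoc)
  with 1 show thesis by (rule that)
qed

text \<open>The second fundamental form on the diagonal, which determines the holomorphic sectional
  curvature in the Gauss equation.\<close>

definition "sff x u = B x u u - D x (tan_coef x (B x u u))"

lemma sff_normal: "x \<in> S \<Longrightarrow> H x (sff x u) (D x t) = 0"
  unfolding sff_def by (rule tan_coef)

text \<open>The connection term in \<open>B x u u\<close> is a multiple of \<open>D x u\<close>;
  against a normal vector it vanishes together with the tangential part that was subtracted.\<close>

lemma H_sff: 
  assumes "x \<in> S" "\<And>t. H x v (D x t) = 0" shows "H x v (sff x u) = H x v (D2 x u u)"
  by (simp add: sff_def B_def fs_herm_simps fs_herm_christoffel assms)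

text \<open>In holomorphic coordinates the Christoffel symbols are complex bilinear, so the quadratic terms of
  \<open>R(u, \<i>u)\<i>u\<close> cancel and the curvature is minus the \<open>\<partial>\<close>-bar derivative of \<open>\<Gamma>(u, u)\<close> in the direction \<open>u\<close>.
  Differentiating the orthogonality of \<open>sff\<close> to the tangent space turns it into the Gauss equation.\<close>

lemma sectional_curvature_holomorphic:
  assumes x: "x \<in> S" and unit: "h x u u = 1"
  shows "sectional_curvature h x u (\<i> *s u) = 4 - 2 * Re (H x (sff x u) (sff x u))"
proof -
  define \<gamma> where "\<gamma> = (\<lambda>y. tan_coef y (B y u u))"
  let ?v = "\<i> *s u"
  obtain C where C: "((\<lambda>y. fs_christoffel (F y) (D y u) (D y u)) has_derivative C) (at x)"
    and dbarC: "C u + \<i> *s C ?v = (- 4 * H x (D x u) (D x u)) *s D x u"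
    using dbar_christoffel[OF x] by blast
  let ?E = "dir_deriv (\<lambda>z. D2 z u u) x"
  have B': "((\<lambda>y. B y u u) has_derivative (\<lambda>b. ?E b + C b)) (at x)"
    unfolding B_def by (rule has_derivative_add[OF deriv_D2(1)[OF x] C])
  then have "\<gamma> differentiable at x"
    unfolding \<gamma>_def by (intro tan_coef_differentiable x has_derivative_imp_differentiable)
  then obtain \<gamma>' where \<gamma>': "(\<gamma> has_derivative \<gamma>') (at x)" by (auto simp: differentiable_def)
  let ?w = "\<gamma>' u + \<i> *s \<gamma>' ?v"
  have curv: "curvature_tensor h x u ?v ?v = - ?w"
  proof -
    have neg: "((\<lambda>y. - \<gamma> y) has_derivative (\<lambda>b. - \<gamma>' b)) (at x)"
      by (rule has_derivative_minus[OF \<gamma>'])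
    have im: "((\<lambda>y. \<i> *s \<gamma> y) has_derivative (\<lambda>b. \<i> *s \<gamma>' b)) (at x)"
      using has_derivative_vector_smult[OF has_derivative_const \<gamma>', of \<i>] by simp
    have e1: "christoffel h y ?v ?v = - \<gamma> y" and e2: "christoffel h y u ?v = \<i> *s \<gamma> y" if "y \<in> S" for y
      unfolding christoffel_h_lin[OF that]
      using that by (simp_all add: christoffel_h \<gamma>_def vector_smult_assoc vector_smult_lneg)
    have d1: "dir_deriv (\<lambda>y. christoffel h y ?v ?v) x u = - \<gamma>' u"
      by (simp only: frechet_derivative_cong[OF openS x e1] has_derivative_frechet[OF neg])
    have d2: "dir_deriv (\<lambda>y. christoffel h y u ?v) x ?v = \<i> *s \<gamma>' ?v"
      by (simp only: frechet_derivative_cong[OF openS x e2] has_derivative_frechet[OF im])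
    have did: "dir_deriv id x b = b" for b :: "complex ^ 'm"
      using has_derivative_frechet[OF has_derivative_id] by (metis id_apply id_def)
    have "christoffel h x u (- a) = - christoffel h x u a" for a
      using christoffel_h_lin(2)[OF x, of u "-1" a] by (simp add: vector_sneg_minus1[symmetric])
    then show ?thesis
      unfolding curvature_tensor_def cov_deriv_def d1 d2 did
      by (simp add: e1[OF x] e2[OF x] christoffel_h_lin[OF x] vector_smult_assoc)
  qed
  define \<nu>' where "\<nu>' = (\<lambda>b. ?E b + C b - (D2 x b (\<gamma> x) + D x (\<gamma>' b)))"
  have \<nu>': "((\<lambda>y. sff y u) has_derivative \<nu>') (at x)"
    using has_derivative_diff[OF B' has_derivative_D_comp[OF openS x _ has_derivative_ident \<gamma>']]
    by (simp add: sff_def \<nu>'_def \<gamma>_def)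
  have Ei: "?E ?v = \<i> *s ?E u" by (rule deriv_D2(2)[OF x])
  \<comment> \<open>The third derivative \<open>?E\<close> and the term in \<open>D2\<close> are
    complex linear in the direction, so they cancel in this combination.\<close>
  have dbar\<nu>: "\<nu>' u + \<i> *s \<nu>' ?v = (- 4 * H x (D x u) (D x u)) *s D x u - D x ?w"
    unfolding dbarC[symmetric] \<nu>'_def
    by (simp add: Ei D2_lin[OF x] D_lin[OF x] vec_eq_iff algebra_simps)
  have zero: "H x (\<nu>' b + fs_christoffel (F x) (D x b) (sff x u)) (D x u) + H x (sff x u) (B x b u) = 0" for b
  proof -
    have "((\<lambda>y. H y (sff y u) (D y u)) has_derivative (\<lambda>b. 0)) (at x)"
      by (rule has_derivative_transform_within_open[where f = "\<lambda>_. 0" and s = S]) (simp_all add: sff_normal openS x)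
    from has_derivative_unique[OF has_derivative_H[OF x \<nu>'] this] show ?thesis by metis
  qed
  \<comment> \<open>Adding \<open>\<i>\<close> times the equation for \<open>\<i> u\<close> cancels
    \<open>?c\<close>, which is linear in the direction, and doubles \<open>?s\<close>, where the
    direction stands in the conjugate linear slot.\<close>
  have "H x (\<nu>' u + \<i> *s \<nu>' ?v) (D x u) + 2 * H x (sff x u) (B x u u) = 0"
  proof -
    let ?c = "H x (fs_christoffel (F x) (D x u) (sff x u)) (D x u)" and ?s = "H x (sff x u) (B x u u)"
    have e1: "H x (\<nu>' u) (D x u) = - ?s - ?c"
      using zero[of u] by (simp add: fs_herm_simps algebra_simps eq_neg_iff_add_eq_0)
    have e2: "H x (\<nu>' ?v) (D x u) = \<i> * ?s - \<i> * ?c"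
      using zero[of ?v] by (simp add: fs_herm_simps D_lin[OF x] B_lin[OF x] fs_christoffel_simps eq_diff_eq)
    show ?thesis by (simp only: fs_herm_simps e1 e2) (simp add: algebra_simps)
  qed
  then have "- (4 * H x (D x u) (D x u)) * H x (D x u) (D x u) - H x (D x ?w) (D x u) + 2 * H x (sff x u) (B x u u) = 0"
    unfolding dbar\<nu> by (simp add: fs_herm_simps)
  moreover have "H x (sff x u) (B x u u) = H x (sff x u) (sff x u)"
  proof -
    have b: "B x u u = sff x u + D x (tan_coef x (B x u u))" by (simp add: sff_def)
    show ?thesis by (subst b) (simp add: fs_herm_simps sff_normal[OF x])
  qed
  moreover have Du: "H x (D x u) (D x u) = 1"
    using unit by (simp add: h_eq fs_herm_self fubini_study_eq[symmetric])
  ultimately have "H x (D x ?w) (D x u) = 2 * H x (sff x u) (sff x u) - 4"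
    by (simp add: algebra_simps eq_diff_eq)
  then have "h x (- ?w) u = 4 - 2 * Re (H x (sff x u) (sff x u))"
    unfolding h_eq by (subst D_lin(4)[OF x]) (simp add: fs_herm_simps)
  moreover have "h x ?v ?v = 1" "h x u ?v = 0"
    unfolding h_eq by (simp_all add: D_lin[OF x] fs_herm_simps Du)
  ultimately show ?thesis
    unfolding sectional_curvature_def curv by (simp add: unit)
qed

section \<open>The shape operator\<close>

lemma normal_vectors_iff:
  assumes "x \<in> S" shows "v \<in> normal_vectors fubini_study F x \<longleftrightarrow> (\<forall>t. H x v (D x t) = 0)"
  using normal_complex[OF assms] by (auto simp: normal_vectors_def fubini_study_eq)

text \<open>The constant vector \<open>v\<close> is projected to the normal space at each point; at
  \<open>x\<close> the projection does not change it. Without a witness the \<open>THE\<close> in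
  \<open>shape_operator\<close> would be vacuous.\<close>

lemma normal_field_exists:
  assumes "x \<in> S" "v \<in> normal_vectors fubini_study F x"
  shows "\<exists>V. normal_field_extending fubini_study F x v V"
proof -
  have "(\<lambda>y. v - D y (tan_coef y v)) differentiable at y" if y: "y \<in> S" for y
  proof -
    obtain g' where "((\<lambda>y. tan_coef y v) has_derivative g') (at y)"
      using tan_coef_differentiable[OF y, of "\<lambda>_. v"] by (auto simp: differentiable_def)
    from has_derivative_D_comp[OF openS y _ has_derivative_ident this] show ?thesis
      by (intro differentiable_diff differentiable_const has_derivative_imp_differentiable)
  qed
  moreover have "tan_coef x v = 0"
    by (rule tan_coef_unique) (use assms normal_vectors_iff in \<open>auto simp: D_lin\<close>)
  ultimately show ?thesis
    unfolding normal_field_extending_def using openS assms(1) tan_coef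
    by (intro exI[of _ "\<lambda>y. v - D y (tan_coef y v)"] conjI exI[of _ S])
       (auto simp: normal_vectors_iff D_lin differentiable_on_def intro: differentiable_at_withinI)
qed

text \<open>The Weingarten equation, by differentiating the orthogonality of \<open>V\<close> to the
  tangent vectors. The right side involves only \<open>v\<close>, so it is the same for all
  extensions.\<close>

lemma cov_deriv_normal_field:
  assumes x: "x \<in> S" and V: "normal_field_extending fubini_study F x v V"
  shows "fubini_study (F x) (cov_deriv fubini_study F V x u) (D x t) = - Re (H x v (D2 x u t))"
proof -
  obtain S' where S': "open S'" "x \<in> S'" "V differentiable_on S'"
    and n: "\<And>y. y \<in> S' \<Longrightarrow> V y \<in> normal_vectors fubini_study F y" and Vx: "V x = v"
    using V by (auto simp: normal_field_extending_def)
  have V': "(V has_derivative dir_deriv V x) (at x)"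
    using S' by (metis at_within_open differentiable_on_def frechet_derivative_works)
  have "((\<lambda>y. H y (V y) (D y t)) has_derivative (\<lambda>b. 0)) (at x)"
    by (rule has_derivative_transform_within_open[where f = "\<lambda>_. 0" and s = "S \<inter> S'"])
       (use openS x S' n normal_vectors_iff in auto)
  from has_derivative_unique[OF has_derivative_H[OF x V'] this]
  have "H x (dir_deriv V x u + fs_christoffel (F x) (D x u) (V x)) (D x t) + H x (V x) (B x u t) = 0" by metis
  moreover have "H x (V x) (B x u t) = H x v (D2 x u t)"
    using n[OF S'(2)] Vx by (simp add: B_def fs_herm_simps fs_herm_christoffel normal_vectors_iff[OF x])
  ultimately have "H x (dir_deriv V x u + fs_christoffel (F x) (D x u) (V x)) (D x t) = - H x v (D2 x u t)"
    by (simp add: eq_neg_iff_add_eq_0)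
  then show ?thesis by (simp add: cov_deriv_def christoffel_fubini_study fubini_study_eq)
qed

abbreviation "A x \<equiv> shape_operator fubini_study F x"

text \<open>Independence of the extension makes the description in \<open>shape_operator\<close>
  unique. The real identity becomes a Hermitian one on replacing \<open>t\<close> by
  \<open>\<i> *s t\<close>, as \<open>D\<close> and \<open>D2\<close> are complex linear in
  \<open>t\<close>.\<close>

lemma H_shape_operator:
  assumes x: "x \<in> S" and v: "v \<in> normal_vectors fubini_study F x"
  shows "H x (D x (A x v u)) (D x t) = H x v (D2 x u t)"
proof -
  obtain V where V: "normal_field_extending fubini_study F x v V" using normal_field_exists[OF assms] ..
  define w where "w = tan_coef x (- cov_deriv fubini_study F V x u)"
  have w: "Re (H x (D x w) (D x t)) = Re (H x v (D2 x u t))" for t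
    using arg_cong[OF tan_coef[OF x, of "- cov_deriv fubini_study F V x u" t], of Re] cov_deriv_normal_field[OF x V, of u t]
    by (simp add: w_def[symmetric] fs_herm_simps fubini_study_eq)
  have "A x v u = w"
    unfolding shape_operator_def
  proof (rule the_equality)
    show "\<exists>V. normal_field_extending fubini_study F x v V \<and>
      (\<forall>t. fubini_study (F x) (D x w) (D x t) = - fubini_study (F x) (cov_deriv fubini_study F V x u) (D x t))"
      by (rule exI[of _ V]) (use V w cov_deriv_normal_field[OF x V, of u] in \<open>auto simp: fubini_study_eq\<close>)
    fix w' assume "\<exists>V. normal_field_extending fubini_study F x v V \<and>
      (\<forall>t. fubini_study (F x) (D x w') (D x t) = - fubini_study (F x) (cov_deriv fubini_study F V x u) (D x t))"
    then have "Re (H x (D x w') (D x t)) = Re (H x v (D2 x u t))" for t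
      using cov_deriv_normal_field[OF x] by (auto simp: fubini_study_eq)
    with w show "w' = w" by (intro h_nondeg[OF x]) (simp add: h_eq)
  qed
  then have *: "Re (H x (D x (A x v u)) (D x t)) = Re (H x v (D2 x u t))" for t using w by simp
  from *[of t] *[of "\<i> *s t"] show ?thesis
    by (simp add: D_lin[OF x] D2_lin[OF x] fs_herm_simps complex_eq_iff)
qed

lemma shape_operator_eqI:
  assumes "x \<in> S" "v \<in> normal_vectors fubini_study F x" "\<And>t. H x (D x w) (D x t) = H x v (D2 x u t)"
  shows "A x v u = w"
  by (rule h_nondeg[OF assms(1)]) (simp add: h_eq H_shape_operator assms)

text \<open>In \<open>H_shape_operator\<close> the argument \<open>u\<close> enters the right side
  in the conjugate linear slot, but its image enters the left side in the linear one; hence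
  antilinearity in \<open>u\<close>. The normal vector stands in linear slots on both sides.\<close>

lemma shape_operator_lin:
  assumes x: "x \<in> S" and v: "v \<in> normal_vectors fubini_study F x"
  shows "A x v (c *s u) = cnj c *s A x v u" "A x v (a + b) = A x v a + A x v b"
    "A x (c *s v) u = c *s A x v u"
proof -
  show "A x v (c *s u) = cnj c *s A x v u"
    by (rule shape_operator_eqI[OF assms]) (simp add: D_lin[OF x] D2_lin[OF x] fs_herm_simps H_shape_operator[OF assms])
  show "A x v (a + b) = A x v a + A x v b"
    by (rule shape_operator_eqI[OF assms]) (simp add: D_lin[OF x] D2_lin[OF x] fs_herm_simps H_shape_operator[OF assms])
  have "c *s v \<in> normal_vectors fubini_study F x" using v by (simp add: normal_vectors_iff[OF x] fs_herm_simps)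
  then show "A x (c *s v) u = c *s A x v u"
    by (rule shape_operator_eqI[OF x]) (simp add: D_lin[OF x] D2_lin[OF x] fs_herm_simps H_shape_operator[OF assms])
qed

text \<open>Tangent space and \<open>v\<close> span everything: the map \<open>L\<close> is
  injective, and codimension one makes the real dimensions equal. The difference of the two sides is
  orthogonal to all of this span, hence zero.\<close>

lemma normal_line:
  assumes card: "CARD('n) = CARD('m) + 1" and x: "x \<in> S"
    and v: "\<And>t. H x v (D x t) = 0" "H x v v = 1" and a: "\<And>t. H x a (D x t) = 0"
  shows "a = H x a v *s v"
proof -
  define L where "L = (\<lambda>(t, c). D x t + c *s v)"
  have v': "H x (D x t) v = 0" for t using v(1)[of t] by (metis cnj_fs_herm complex_cnj_zero)
  have lin: "linear L"
    by (rule linearI) (auto simp: L_def D_lin[OF x] vec_eq_iff algebra_simps)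
  have "p = 0" if "L p = 0" for p
  proof -
    obtain t c where p: "p = (t, c)" by fastforce
    have 0: "D x t + c *s v = 0" using that by (simp add: L_def p)
    then have "H x (D x t + c *s v) v = 0" by (simp add: fs_herm_simps)
    then have "c = 0" by (simp add: fs_herm_simps v' v)
    with 0 show ?thesis using D_eq_0[OF x] by (simp add: p zero_prod_def)
  qed
  then have "inj L" using lin by (simp add: linear_injective_0)
  then have "dim (range L) = DIM((complex ^ 'm) \<times> complex)"
    using dim_image_eq[OF lin, of UNIV] by simp
  then have "dim (range L) = DIM(complex ^ 'n)" by (simp add: card)
  then have "range L = UNIV"
    using dim_eq_full[of "range L"] linear_subspace_image[OF lin subspace_UNIV] span_eq_iff[of "range L"] by simp
  then obtain q where q: "a - H x a v *s v = L q" by (metis UNIV_I imageE)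
  obtain t c where "q = (t, c)" by fastforce
  with q have p: "a - H x a v *s v = D x t + c *s v" by (simp add: L_def)
  have "H x (a - H x a v *s v) (D x t + c *s v) = 0"
    by (simp add: fs_herm_simps a v algebra_simps)
  then show ?thesis unfolding p[symmetric] by simp
qed

lemma sectional_curvature_principal:
  assumes card: "CARD('n) = CARD('m) + 1" and x: "x \<in> S"
    and v: "v \<in> normal_vectors fubini_study F x" "fubini_study (F x) v v = 1"
    and e: "h x e e = 1" "A x v e = \<kappa> *\<^sub>R e"
  shows "sectional_curvature h x e (\<i> *s e) = 4 - 2 * \<kappa>\<^sup>2"
proof -
  have vn: "H x v (D x t) = 0" for t using v(1) by (simp add: normal_vectors_iff[OF x])
  have vv: "H x v v = 1" using v(2) by (simp add: fs_herm_self)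
  have ee: "H x (D x e) (D x e) = 1"
    using e(1) by (simp add: h_eq fs_herm_self fubini_study_eq[symmetric])
  have "H x v (D2 x e e) = \<kappa>"
    using H_shape_operator[OF x v(1), of e e] by (simp add: e(2) D_lin[OF x] fs_herm_simps ee)
  then have "H x v (sff x e) = \<kappa>" using H_sff[OF x vn] by simp
  then have k: "H x (sff x e) v = \<kappa>" by (metis cnj_fs_herm complex_cnj_complex_of_real)
  have "sff x e = of_real \<kappa> *s v"
    using normal_line[OF card x vn vv, of "sff x e"] sff_normal[OF x] k by simp
  then have "H x (sff x e) (sff x e) = of_real (\<kappa>\<^sup>2)"
    by (simp add: fs_herm_simps vv power2_eq_square)
  then show ?thesis using sectional_curvature_holomorphic[OF x e(1)] by simp
qed

end

section \<open>Affine charts of projective space\<close>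

definition cline :: "complex ^ 'k::finite \<Rightarrow> (complex ^ 'k) set" where
  "cline z = {a *s z | a. True}"

text \<open>The representative with coordinate \<open>j\<close> equal to 1: a lift of the inverse of
  \<open>affine_chart j\<close> to vectors.\<close>

definition homog :: "'n::finite option \<Rightarrow> complex ^ 'n \<Rightarrow> complex ^ ('n option)" where
  "homog j w = (\<chi> k. case Transposition.transpose None j k of None \<Rightarrow> 1 | Some i \<Rightarrow> w $ i)"

text \<open>The linear part of the affine map \<open>homog j\<close>, hence its derivative at every
  point.\<close>

definition homog_lin :: "'n::finite option \<Rightarrow> complex ^ 'n \<Rightarrow> complex ^ ('n option)" where
  "homog_lin j w = (\<chi> k. case Transposition.transpose None j k of None \<Rightarrow> 0 | Some i \<Rightarrow> w $ i)"

text \<open>The change from affine chart \<open>j\<close> to affine chart \<open>k\<close>;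
  \<open>dtrans_map\<close> is its derivative, by the quotient rule.\<close>

definition trans_map :: "'n::finite option \<Rightarrow> 'n option \<Rightarrow> complex ^ 'n \<Rightarrow> complex ^ 'n" where
  "trans_map j k w = (\<chi> i. homog j w $ Transposition.transpose None k (Some i) / homog j w $ k)"

definition dtrans_map :: "'n::finite option \<Rightarrow> 'n option \<Rightarrow> complex ^ 'n \<Rightarrow> complex ^ 'n \<Rightarrow> complex ^ 'n" where
  "dtrans_map j k w u = (\<chi> i. (homog_lin j u $ Transposition.transpose None k (Some i) * homog j w $ k
     - homog j w $ Transposition.transpose None k (Some i) * homog_lin j u $ k) / (homog j w $ k)\<^sup>2)"

lemma cproj_eq: "cproj = cline ` {z. z \<noteq> 0}"
  by (auto simp: cproj_def cline_def)

lemma homog_base [simp]: "homog j w $ j = 1" "homog_lin j w $ j = 0"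
  by (simp_all add: homog_def homog_lin_def)

lemma homog_transpose [simp]: "homog j w $ Transposition.transpose None j (Some i) = w $ i"
  "homog_lin j w $ Transposition.transpose None j (Some i) = w $ i"
  by (simp_all add: homog_def homog_lin_def)

lemma homog_neq_0 [simp]: "homog j w \<noteq> 0"
  using homog_base(1)[of j w] by (metis zero_index zero_neq_one)

lemma option_transpose_cases:
  obtains "k = j" | i where "k = Transposition.transpose None j (Some i)"
  by (metis not_None_eq transpose_involutory transpose_apply_first)

lemma homog_eqI:
  assumes "z $ j = 1" "\<And>i. z $ Transposition.transpose None j (Some i) = w $ i" shows "z = homog j w"
  unfolding vec_eq_iff
proof
  fix k show "z $ k = homog j w $ k"
    by (rule option_transpose_cases[of k j]) (use assms in auto)
qed

lemma homog_lin_eqI: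
  assumes "z $ j = 0" "\<And>i. z $ Transposition.transpose None j (Some i) = w $ i" shows "z = homog_lin j w"
  unfolding vec_eq_iff
proof
  fix k show "z $ k = homog_lin j w $ k"
    by (rule option_transpose_cases[of k j]) (use assms in auto)
qed

lemma cline_in_chart: "z $ j \<noteq> 0 \<Longrightarrow> cline z \<in> fst (affine_chart j)"
  unfolding affine_chart_def cproj_eq by (force simp: cline_def intro: exI[of _ 1])

lemma cline_in_chart_iff: "z \<noteq> 0 \<Longrightarrow> cline z \<in> fst (affine_chart j) \<longleftrightarrow> z $ j \<noteq> 0"
  using cline_in_chart[of z j] unfolding affine_chart_def by (auto simp: cline_def)

lemma affine_chart_cline:
  assumes "z $ j \<noteq> 0"
  shows "snd (affine_chart j) (cline z) = (\<chi> i. z $ Transposition.transpose None j (Some i) / z $ j)"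
proof -
  have "(THE z'. z' \<in> cline z \<and> z' $ j = 1) = (1 / z $ j) *s z"
  proof (rule the_equality)
    show "(1 / z $ j) *s z \<in> cline z \<and> ((1 / z $ j) *s z) $ j = 1"
      using assms by (auto simp: cline_def)
    fix z' assume "z' \<in> cline z \<and> z' $ j = 1"
    then show "z' = (1 / z $ j) *s z" using assms by (auto simp: cline_def field_simps)
  qed
  then show ?thesis by (simp add: affine_chart_def)
qed

lemma cline_smult: "c \<noteq> 0 \<Longrightarrow> cline (c *s z) = cline z"
  unfolding cline_def by (auto simp: vector_smult_assoc) (metis nonzero_eq_divide_eq)

lemma affine_chart_homog: "snd (affine_chart j) (cline (homog j w)) = w"
  by (subst affine_chart_cline) (simp_all add: vec_eq_iff)

lemma cline_homog_affine_chart: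
  assumes "l \<in> fst (affine_chart j)" shows "cline (homog j (snd (affine_chart j) l)) = l"
proof -
  obtain z where z: "l = cline z" "z \<noteq> 0" using assms by (auto simp: affine_chart_def cproj_eq)
  then have zj: "z $ j \<noteq> 0" using assms cline_in_chart_iff by blast
  have "(1 / z $ j) *s z = homog j (snd (affine_chart j) l)"
    by (rule homog_eqI) (simp_all add: z affine_chart_cline zj)
  then show ?thesis using cline_smult[of "1 / z $ j" z] zj z by simp
qed

lemma inj_on_affine_chart: "inj_on (snd (affine_chart j)) (fst (affine_chart j))"
  by (rule inj_on_inverseI[where g = "\<lambda>w. cline (homog j w)"]) (rule cline_homog_affine_chart)

lemma chart_inv_affine: "chart_inv (affine_chart j) w = cline (homog j w)"
  unfolding chart_inv_def
  by (rule inv_into_f_eq[OF inj_on_affine_chart]) (simp_all add: cline_in_chart affine_chart_homog)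

lemma affine_chart_in_iff: "chart_inv (affine_chart j) w \<in> fst (affine_chart k) \<longleftrightarrow> homog j w $ k \<noteq> 0"
  unfolding chart_inv_affine by (rule cline_in_chart_iff) simp

lemma affine_transition:
  "homog j w $ k \<noteq> 0 \<Longrightarrow> snd (affine_chart k) (chart_inv (affine_chart j) w) = trans_map j k w"
  by (simp add: chart_inv_affine affine_chart_cline trans_map_def)

lemma homog_trans_map: "homog j w $ k \<noteq> 0 \<Longrightarrow> homog k (trans_map j k w) = (1 / homog j w $ k) *s homog j w"
  by (rule homog_eqI[symmetric]) (simp_all add: trans_map_def)

text \<open>The derivative of the rescaling in \<open>homog_trans_map\<close>: tangent vectors are
  rescaled alike, up to a multiple of the base vector, which \<open>homog_form\<close> does not
  see.\<close>

lemma homog_lin_dtrans_map: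
  "homog j w $ k \<noteq> 0 \<Longrightarrow> homog_lin k (dtrans_map j k w u) =
     (1 / homog j w $ k) *s homog_lin j u + (- homog_lin j u $ k / (homog j w $ k)\<^sup>2) *s homog j w"
  by (rule homog_lin_eqI[symmetric]) (simp_all add: dtrans_map_def field_simps power2_eq_square)

lemma homog_lin_simps:
  "homog_lin j (a + b) = homog_lin j a + homog_lin j b"
  "homog_lin j (c *s b) = c *s homog_lin j b"
  "homog_lin j (r *\<^sub>R b) = r *\<^sub>R homog_lin j b"
  by (simp_all add: homog_lin_def vec_eq_iff split: option.splits)

lemma homog_add: "homog j (a + b) = homog j a + homog_lin j b"
  by (simp add: homog_def homog_lin_def vec_eq_iff split: option.splits)

lemma bounded_linear_homog_lin: "bounded_linear (homog_lin j)"
  unfolding linear_conv_bounded_linear[symmetric] by (rule linearI) (simp_all add: homog_lin_simps)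

lemma has_derivative_homog: "(homog j has_derivative homog_lin j) (at w)"
proof -
  have "((\<lambda>w. homog j 0 + homog_lin j w) has_derivative homog_lin j) (at w)"
    using has_derivative_add[OF has_derivative_const bounded_linear_imp_has_derivative[OF bounded_linear_homog_lin]]
    by simp
  moreover have "(\<lambda>w. homog j 0 + homog_lin j w) = homog j"
    by (rule ext) (metis add_0 homog_add)
  ultimately show ?thesis by metis
qed

lemma has_derivative_homog_lin_nth:
  assumes "(W has_derivative W') (at x)"
  shows "((\<lambda>y. homog_lin j (W y) $ k) has_derivative (\<lambda>u. homog_lin j (W' u) $ k)) (at x)"
  by (rule bounded_linear.has_derivative[OF bounded_linear_vec_nth
      bounded_linear.has_derivative[OF bounded_linear_homog_lin assms]])

lemma has_derivative_homog_nth [derivative_intros]: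
  assumes "(W has_derivative W') (at x)"
  shows "((\<lambda>y. homog j (W y) $ k) has_derivative (\<lambda>u. homog_lin j (W' u) $ k)) (at x)"
  using bounded_linear.has_derivative[OF bounded_linear_vec_nth has_derivative_compose[OF assms has_derivative_homog]] .

lemma has_derivative_trans_map:
  assumes "homog j w $ k \<noteq> 0"
  shows "(trans_map j k has_derivative dtrans_map j k w) (at w)"
proof (rule has_derivative_vecI)
  fix i
  show "((\<lambda>w. trans_map j k w $ i) has_derivative (\<lambda>u. dtrans_map j k w u $ i)) (at w)"
    unfolding trans_map_def dtrans_map_def vec_lambda_beta power2_eq_square
    by (intro has_derivative_divide' has_derivative_homog_nth has_derivative_ident assms)
qed

text \<open>Projective flatness: the second derivative of a transition map lies in the complex span of its
  first derivatives, so it contributes nothing in the direction of a normal vector.\<close>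

lemma has_derivative_dtrans_map:
  assumes W: "(W has_derivative W') (at x)" and C: "(C has_derivative C') (at x)"
    and nz: "homog j (W x) $ k \<noteq> 0"
  shows "((\<lambda>y. dtrans_map j k (W y) (C y)) has_derivative
     (\<lambda>a. (- homog_lin j (W' a) $ k / homog j (W x) $ k) *s dtrans_map j k (W x) (C x)
        + (- homog_lin j (C x) $ k / homog j (W x) $ k) *s dtrans_map j k (W x) (W' a)
        + dtrans_map j k (W x) (C' a))) (at x)"
proof (rule has_derivative_vecI)
  fix i
  have sq: "(homog j (W x) $ k)\<^sup>2 \<noteq> 0" using nz by simp
  let ?i = "Transposition.transpose None k (Some i)"
  have "((\<lambda>y. (homog j (W y) $ k)\<^sup>2) has_derivative (\<lambda>a. 2 * homog j (W x) $ k * homog_lin j (W' a) $ k)) (at x)"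
    unfolding power2_eq_square
    by (rule has_derivative_eq_rhs[OF has_derivative_mult[OF has_derivative_homog_nth[OF W]
      has_derivative_homog_nth[OF W]]]) (simp add: algebra_simps)
  note 1 = has_derivative_divide'[OF has_derivative_diff[OF
      has_derivative_mult[OF has_derivative_homog_lin_nth[OF C, of j ?i] has_derivative_homog_nth[OF W, of j k]]
      has_derivative_mult[OF has_derivative_homog_nth[OF W, of j ?i] has_derivative_homog_lin_nth[OF C, of j k]]] this sq]
  show "((\<lambda>y. dtrans_map j k (W y) (C y) $ i) has_derivative
     (\<lambda>a. ((- homog_lin j (W' a) $ k / homog j (W x) $ k) *s dtrans_map j k (W x) (C x)
        + (- homog_lin j (C x) $ k / homog j (W x) $ k) *s dtrans_map j k (W x) (W' a)
        + dtrans_map j k (W x) (C' a)) $ i)) (at x)"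
    unfolding dtrans_map_def vec_lambda_beta
    apply (rule has_derivative_eq_rhs[OF 1])
    apply (rule ext)
    using nz by (simp add: field_simps power2_eq_square)
qed

section \<open>The Fubini--Study metric in homogeneous coordinates\<close>

lemma hermitian_option: "hermitian u v = hermitian (\<chi> i. u $ Some i) (\<chi> i. v $ Some i) + u $ None * cnj (v $ None)"
  by (simp add: hermitian_def UNIV_option_conv sum.reindex add.commute)

lemma hermitian_transpose:
  "hermitian u v = hermitian (\<chi> i. u $ Transposition.transpose None j i) (\<chi> i. v $ Transposition.transpose None j i)"
  unfolding hermitian_def
  by (subst sum.reindex_bij_betw[OF bij_betw_byWitness, of UNIV "Transposition.transpose None j" "Transposition.transpose None j" UNIV, symmetric]) auto

lemma hermitian_homog:
  "hermitian (homog j w) (homog j w) = 1 + hermitian w w"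
  "hermitian (homog_lin j u) (homog j w) = hermitian u w"
  "hermitian (homog j w) (homog_lin j u) = hermitian w u"
  "hermitian (homog_lin j u) (homog_lin j v) = hermitian u v"
  by (subst hermitian_transpose[of _ _ j], subst hermitian_option, simp add: homog_base)+

text \<open>The Fubini--Study form on the cone over projective space: it compares the components
  orthogonal to the line of \<open>z\<close> and is invariant under rescaling.\<close>

definition homog_form :: "complex ^ 'k::finite \<Rightarrow> complex ^ 'k \<Rightarrow> complex ^ 'k \<Rightarrow> complex" where
  "homog_form z u v = (hermitian z z * hermitian u v - hermitian u z * hermitian z v) / (hermitian z z)\<^sup>2"

lemma fs_herm_homog: "fs_herm w u v = homog_form (homog j w) (homog_lin j u) (homog_lin j v)"
  by (simp add: fs_herm_def homog_form_def hermitian_homog)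

lemma homog_form_invariant:
  assumes "c \<noteq> 0" "z \<noteq> 0"
  shows "homog_form (c *s z) (c *s u + a *s z) (c *s v + b *s z) = homog_form z u v"
proof -
  have "hermitian z z \<noteq> 0" using assms by (simp add: hermitian_self)
  then show ?thesis using assms
    by (simp add: homog_form_def hermitian_simps field_simps power2_eq_square)
qed

text \<open>Two affine charts use proportional representatives of a point, so invariance of
  \<open>homog_form\<close> makes the transition an isometry.\<close>

lemma fs_herm_dtrans_map:
  assumes "homog j w $ k \<noteq> 0"
  shows "fs_herm (trans_map j k w) (dtrans_map j k w u) (dtrans_map j k w v) = fs_herm w u v"
  unfolding fs_herm_homog[of "trans_map j k w" _ _ k] fs_herm_homog[of w u v j]
      homog_trans_map[OF assms] homog_lin_dtrans_map[OF assms]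
  by (rule homog_form_invariant) (use assms in auto)

lemma dtrans_map_lin:
  "dtrans_map j k w (a + b) = dtrans_map j k w a + dtrans_map j k w b"
  "dtrans_map j k w (c *s b) = c *s dtrans_map j k w b"
  "dtrans_map j k w (r *\<^sub>R b) = r *\<^sub>R dtrans_map j k w b"
  by (simp_all add: dtrans_map_def homog_lin_simps vec_eq_iff field_simps add_divide_distrib[symmetric]
     diff_divide_distrib[symmetric] scaleR_conv_of_real[where 'a=complex])

lemma dtrans_map_inj:
  assumes "homog j w $ k \<noteq> 0" shows "inj (dtrans_map j k w)"
proof -
  have "linear (dtrans_map j k w)" by (rule linearI) (simp_all add: dtrans_map_lin)
  moreover have "u = 0" if "dtrans_map j k w u = 0" for u
    using fs_herm_dtrans_map[OF assms, of u u] that by (simp add: fs_herm_simps)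
  ultimately show ?thesis by (simp add: linear_injective_0)
qed

section \<open>Change of coordinates\<close>

text \<open>Two coordinate expressions of one immersion: \<open>\<tau>\<close> changes the chart of
  the source, \<open>trans_map j k\<close> that of the target.\<close>

locale hol_immersion_change =
  X: hol_immersion F S + Y: hol_immersion G T
  for F :: "complex ^ 'm::finite \<Rightarrow> complex ^ 'n::finite" and S
    and G :: "complex ^ 'm \<Rightarrow> complex ^ 'n" and T +
  fixes \<tau> :: "complex ^ 'm \<Rightarrow> complex ^ 'm" and U j k
  assumes \<tau>: "holomorphic_map_on \<tau> U" and US: "U \<subseteq> S" and UT: "\<tau> ` U \<subseteq> T"
    and chart: "\<And>y. y \<in> U \<Longrightarrow> homog j (F y) $ k \<noteq> 0"
    and comm: "\<And>y. y \<in> U \<Longrightarrow> G (\<tau> y) = trans_map j k (F y)"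
begin

abbreviation "\<tau>' \<equiv> dir_deriv \<tau>"
abbreviation "N x \<equiv> dtrans_map j k (F x)"

lemma openU: "open U" using \<tau> by (simp add: holomorphic_map_on_def)

lemma comm_deriv:
  assumes x: "x \<in> U" shows "Y.D (\<tau> x) (\<tau>' x u) = N x (X.D x u)"
proof -
  have "(\<tau> has_derivative \<tau>' x) (at x)" by (rule holomorphic_map_on_has_derivative(1)[OF \<tau> x])
  then have 1: "((\<lambda>y. G (\<tau> y)) has_derivative (\<lambda>u. Y.D (\<tau> x) (\<tau>' x u))) (at x)"
    by (rule has_derivative_compose) (use Y.deriv_F UT x in blast)
  have 2: "((\<lambda>y. trans_map j k (F y)) has_derivative (\<lambda>u. N x (X.D x u))) (at x)"
    by (rule has_derivative_compose[OF X.deriv_F has_derivative_trans_map]) (use US x chart in auto)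
  have "((\<lambda>y. G (\<tau> y)) has_derivative (\<lambda>u. N x (X.D x u))) (at x)"
    by (rule has_derivative_transform_within_open[OF 2 openU x]) (simp add: comm)
  from has_derivative_unique[OF 1 this] show ?thesis by metis
qed

lemma H_N: "x \<in> U \<Longrightarrow> Y.H (\<tau> x) (N x u) (N x v) = X.H x u v"
  by (simp add: comm fs_herm_dtrans_map chart)

lemma \<tau>'_lin: "x \<in> U \<Longrightarrow> linear (\<tau>' x)"
  using has_derivative_linear holomorphic_map_on_has_derivative(1)[OF \<tau>] by blast

text \<open>The locale provides no inverse of \<open>\<tau>\<close>; injectivity is inherited
  through the chain rule from the transition and the immersion \<open>F\<close>.\<close>

lemma inj_\<tau>': assumes x: "x \<in> U" shows "inj (\<tau>' x)"
proof -
  have "u = 0" if "\<tau>' x u = 0" for u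
  proof -
    have "x \<in> S" "\<tau> x \<in> T" using x US UT by auto
    then have "N x (X.D x u) = N x 0"
      using comm_deriv[OF x, of u] that dtrans_map_lin(2)[of j k "F x" 0 0] by (simp add: Y.D_lin)
    then have "X.D x u = 0" using dtrans_map_inj[OF chart[OF x]] by (metis injD)
    then show "u = 0" using X.D_eq_0 \<open>x \<in> S\<close> by blast
  qed
  then show ?thesis using \<tau>'_lin[OF x] by (simp add: linear_injective_0)
qed

lemma surj_\<tau>': "x \<in> U \<Longrightarrow> surj (\<tau>' x)"
  by (simp add: inj_\<tau>' \<tau>'_lin linear_injective_imp_surjective)

lemma surj_N: "x \<in> U \<Longrightarrow> surj (N x)"
  by (intro linear_injective_imp_surjective dtrans_map_inj chart linearI) (simp_all add: dtrans_map_lin)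

lemma normal_vectors_N:
  assumes x: "x \<in> U"
  shows "N x v \<in> normal_vectors fubini_study G (\<tau> x) \<longleftrightarrow> v \<in> normal_vectors fubini_study F x"
proof -
  have "(\<forall>t. fubini_study (G (\<tau> x)) (N x v) (Y.D (\<tau> x) t) = 0) \<longleftrightarrow>
    (\<forall>t. fubini_study (G (\<tau> x)) (N x v) (Y.D (\<tau> x) (\<tau>' x t)) = 0)"
    using surj_\<tau>'[OF x] by (metis surjD)
  then show ?thesis by (simp add: normal_vectors_def comm_deriv[OF x] fubini_study_eq H_N[OF x])
qed

text \<open>Differentiating \<open>comm_deriv\<close> once more adds a term in the image of
  \<open>Y.D\<close>, from \<open>\<tau>\<close>, and multiples of transported tangent vectors, from
  the transition. All are tangential and vanish against a normal vector, so the second fundamental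
  form transforms as a tensor.\<close>

lemma comm_deriv2:
  assumes x: "x \<in> U" and v: "v \<in> normal_vectors fubini_study F x"
  shows "Y.H (\<tau> x) (N x v) (Y.D2 (\<tau> x) (\<tau>' x a) (\<tau>' x b)) = X.H x v (X.D2 x a b)"
proof -
  have xS: "x \<in> S" and tT: "\<tau> x \<in> T" using x US UT by auto
  have dt: "(\<tau> has_derivative \<tau>' x) (at x)" by (rule holomorphic_map_on_has_derivative(1)[OF \<tau> x])
  obtain \<tau>2 where \<tau>2: "((\<lambda>y. \<tau>' y b) has_derivative \<tau>2) (at x)"
    using holomorphic_map_on_has_derivative(1)[OF holomorphic_map_on_deriv[OF \<tau>] x] by blast
  have d1: "((\<lambda>y. Y.D (\<tau> y) (\<tau>' y b)) has_derivative
     (\<lambda>a. Y.D2 (\<tau> x) (\<tau>' x a) (\<tau>' x b) + Y.D (\<tau> x) (\<tau>2 a))) (at x)"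
    by (rule Y.has_derivative_D_comp[OF openU x _ dt \<tau>2]) (use UT in auto)
  note d2 = has_derivative_dtrans_map[OF X.deriv_F[OF xS] X.deriv_D[OF xS, of b] chart[OF x]]
  have "((\<lambda>y. Y.D (\<tau> y) (\<tau>' y b)) has_derivative
     (\<lambda>a. (- homog_lin j (X.D x a) $ k / homog j (F x) $ k) *s N x (X.D x b)
        + (- homog_lin j (X.D x b) $ k / homog j (F x) $ k) *s N x (X.D x a) + N x (X.D2 x a b))) (at x)"
    by (rule has_derivative_transform_within_open[OF d2 openU x]) (simp add: comm_deriv)
  from has_derivative_unique[OF d1 this]
  have e: "Y.D2 (\<tau> x) (\<tau>' x a) (\<tau>' x b) + Y.D (\<tau> x) (\<tau>2 a) =
    (- homog_lin j (X.D x a) $ k / homog j (F x) $ k) *s N x (X.D x b)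
        + (- homog_lin j (X.D x b) $ k / homog j (F x) $ k) *s N x (X.D x a) + N x (X.D2 x a b)" by metis
  have n0: "Y.H (\<tau> x) (N x v) (Y.D (\<tau> x) t) = 0" for t
    using normal_vectors_N[OF x] v Y.normal_vectors_iff[OF tT] by blast
  have n1: "X.H x v (X.D x t) = 0" for t using v X.normal_vectors_iff[OF xS] by blast
  from arg_cong[OF e, of "Y.H (\<tau> x) (N x v)"] show ?thesis
    by (simp add: fs_herm_simps n0 n1 H_N[OF x])
qed

lemma shape_operator_change:
  assumes x: "x \<in> U" and v: "v \<in> normal_vectors fubini_study F x"
  shows "Y.A (\<tau> x) (N x v) (\<tau>' x u) = \<tau>' x (X.A x v u)"
proof (rule Y.shape_operator_eqI)
  show "\<tau> x \<in> T" using x UT by auto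
  show "N x v \<in> normal_vectors fubini_study G (\<tau> x)" using normal_vectors_N[OF x] v by blast
  fix t
  obtain t' where t: "t = \<tau>' x t'" using surj_\<tau>'[OF x] by blast
  show "Y.H (\<tau> x) (Y.D (\<tau> x) (\<tau>' x (X.A x v u))) (Y.D (\<tau> x) t) = Y.H (\<tau> x) (N x v) (Y.D2 (\<tau> x) (\<tau>' x u) t)"
    unfolding t comm_deriv2[OF x v] comm_deriv[OF x] H_N[OF x]
    by (rule X.H_shape_operator) (use US x v in auto)
qed

end

section \<open>Real determinants\<close>

lemma sum_UNIV_sum:
  "(\<Sum>k\<in>UNIV. g k) = (\<Sum>i\<in>UNIV. g (Inl i)) + (\<Sum>i\<in>UNIV. g (Inr i))" for g :: "'a::finite + 'b::finite \<Rightarrow> 'c::comm_monoid_add"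
  using sum.Plus[of "UNIV :: 'a set" "UNIV :: 'b set" g] by (simp add: UNIV_Plus_UNIV)

lemma prod_UNIV_sum:
  "(\<Prod>k\<in>UNIV. g k) = (\<Prod>i\<in>UNIV. g (Inl i)) * (\<Prod>i\<in>UNIV. g (Inr i))" for g :: "'a::finite + 'b::finite \<Rightarrow> 'c::comm_monoid_mult"
  using prod.Plus[of "UNIV :: 'a set" "UNIV :: 'b set" g] by (simp add: UNIV_Plus_UNIV)

lemma inner_real_basis:
  "v \<bullet> real_basis (Inl i) = Re (v $ i)" "v \<bullet> real_basis (Inr i) = Im (v $ i)"
  by (simp_all add: real_basis_def inner_axis inner_complex_def)

lemma real_basis_expansion: "(v :: complex ^ 'm::finite) = (\<Sum>k\<in>UNIV. (v \<bullet> real_basis k) *\<^sub>R real_basis k)"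
  unfolding sum_UNIV_sum inner_real_basis vec_eq_iff
  by (simp add: real_basis_def axis_def if_distrib sum.delta complex_eq_iff cong: if_cong)

lemma real_basis_inner: "real_basis k \<bullet> real_basis l = (if k = l then 1 else 0)"
  by (cases k; cases l) (auto simp: inner_real_basis, auto simp: real_basis_def axis_def)

lemma real_det_comp:
  assumes "linear S" shows "real_det (\<lambda>v. S (T v)) = real_det S * real_det T"
proof -
  have "S (T (real_basis k)) \<bullet> real_basis i =
     (\<Sum>l\<in>UNIV. (S (real_basis l) \<bullet> real_basis i) * (T (real_basis k) \<bullet> real_basis l))" for i k
    by (subst real_basis_expansion[of "T (real_basis k)"])
       (simp add: linear_sum[OF assms] linear_cmul[OF assms] inner_sum_left mult.commute)
  then show ?thesis
    unfolding real_det_def det_mul[symmetric]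
    by (intro arg_cong[of _ _ det]) (simp add: matrix_matrix_mult_def vec_eq_iff)
qed

lemma real_det_diag:
  assumes "\<And>k. T (real_basis k) = d k *\<^sub>R real_basis k" shows "real_det T = (\<Prod>k\<in>UNIV. d k)"
  unfolding real_det_def
  by (subst det_diagonal) (auto simp: assms real_basis_inner)

lemma real_det_nz:
  fixes T :: "complex ^ 'm::finite \<Rightarrow> complex ^ 'm"
  assumes "linear T" "inj T" shows "real_det T \<noteq> 0"
proof -
  obtain S where S: "linear S" "S \<circ> T = id" using linear_injective_left_inverse[OF assms] by blast
  have "real_det (\<lambda>v. S (T v)) = 1"
    by (subst real_det_diag[of _ "\<lambda>_. 1"]) (use S(2) in \<open>auto simp: fun_eq_iff\<close>)
  then show ?thesis using real_det_comp[OF S(1), of T] by auto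
qed

lemma real_det_conj:
  fixes P M N :: "complex ^ 'm::finite \<Rightarrow> complex ^ 'm"
  assumes "linear P" "inj P" "linear M" "\<And>v. M (P v) = P (N v)"
  shows "real_det M = real_det N"
proof -
  have "real_det M * real_det P = real_det P * real_det N"
    by (simp add: real_det_comp[symmetric] assms)
  then show ?thesis using real_det_nz[OF assms(1,2)] by simp
qed

text \<open>In the complex basis \<open>E\<close>, the map scales real parts of coefficients by
  \<open>a\<close> and imaginary parts by \<open>b\<close>; it is conjugate to a map that is
  diagonal in \<open>real_basis\<close>.\<close>

lemma real_det_eigen:
  fixes M :: "complex ^ 'm::finite \<Rightarrow> complex ^ 'm" and E :: "'m \<Rightarrow> complex ^ 'm"
  assumes M: "linear M" and indep: "\<And>t. (\<Sum>i\<in>UNIV. t $ i *s E i) = 0 \<Longrightarrow> t = 0"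
    and 1: "\<And>i. M (E i) = a i *\<^sub>R E i" and 2: "\<And>i. M (\<i> *s E i) = b i *\<^sub>R (\<i> *s E i)"
  shows "real_det M = (\<Prod>i\<in>UNIV. a i * b i)"
proof -
  define P where "P = (\<lambda>t :: complex ^ 'm. \<Sum>i\<in>UNIV. t $ i *s E i)"
  define N where "N = (\<lambda>t :: complex ^ 'm. \<chi> i. Complex (a i * Re (t $ i)) (b i * Im (t $ i)))"
  have P: "linear P"
    by (rule linearI) (simp_all add: P_def vec_eq_iff sum.distrib algebra_simps scaleR_sum_right)
  have "inj P" using indep by (simp add: linear_injective_0[OF P]) (simp add: P_def)
  have split: "z *s v = Re z *\<^sub>R v + Im z *\<^sub>R (\<i> *s v)" for z and v :: "complex ^ 'm"
    by (simp add: vec_eq_iff complex_eq_iff algebra_simps)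
  have "M (P t) = P (N t)" for t
    unfolding P_def linear_sum[OF M]
    by (intro sum.cong refl, subst (1 2) split)
       (simp add: linear_add[OF M] linear_cmul[OF M] 1 2 N_def mult.commute)
  from real_det_conj[OF P \<open>inj P\<close> M this] have "real_det M = real_det N" .
  also have "real_det N = (\<Prod>k\<in>UNIV. case k of Inl i \<Rightarrow> a i | Inr i \<Rightarrow> b i)"
    by (rule real_det_diag) (auto simp: N_def real_basis_def vec_eq_iff axis_def complex_eq_iff split: sum.splits)
  finally show ?thesis by (simp add: prod_UNIV_sum prod.distrib)
qed

text \<open>Expanding over subsets and grouping them by cardinality produces the elementary
  symmetric functions.\<close>

lemma prod_eq_sum_elem_sym:
  fixes K :: "'m::finite \<Rightarrow> real"
  shows "(\<Prod>k\<in>UNIV. a + b * K k) = (\<Sum>i=0..CARD('m). a ^ (CARD('m) - i) * b ^ i * elem_sym i K)"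
proof -
  have "(\<Prod>k\<in>UNIV. a + b * K k) = (\<Prod>k\<in>UNIV. b * K k + a)" by (simp add: add.commute)
  also have "\<dots> = (\<Sum>X\<in>Pow UNIV. (\<Prod>k\<in>X. b * K k) * (\<Prod>k\<in>UNIV - X. a))"
    by (rule prod_add) simp
  also have "\<dots> = (\<Sum>X\<in>Pow (UNIV :: 'm set). a ^ (CARD('m) - card X) * b ^ card X * (\<Prod>k\<in>X. K k))"
    by (intro sum.cong refl) (simp add: prod.distrib card_Diff_subset)
  also have "\<dots> = (\<Sum>i=0..CARD('m). \<Sum>X | X \<in> Pow (UNIV :: 'm set) \<and> card X = i. a ^ (CARD('m) - card X) * b ^ card X * (\<Prod>k\<in>X. K k))"
    by (rule sum.group[symmetric]) (simp_all add: image_subset_iff card_mono)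
  also have "\<dots> = (\<Sum>i=0..CARD('m). a ^ (CARD('m) - i) * b ^ i * elem_sym i K)"
    by (intro sum.cong refl) (simp add: elem_sym_def sum_distrib_left)
  finally show ?thesis .
qed

context hol_immersion begin

lemma linear_shape_operator:
  assumes "x \<in> S" "v \<in> normal_vectors fubini_study F x" shows "linear (A x v)"
  by (rule linearI) (simp_all add: shape_operator_lin[OF assms] scaleR_eq_smult)

lemma real_det_principal:
  fixes E :: "'m \<Rightarrow> complex ^ 'm"
  assumes x: "x \<in> S" and v: "v \<in> normal_vectors fubini_study F x"
    and on: "\<And>i k. h x (E i) (E k) = (if i = k then 1 else 0)" "\<And>i k. h x (E i) (\<i> *s E k) = 0"
    and pr: "\<And>i. A x v (E i) = \<kappa> i *\<^sub>R E i"
  shows "real_det (\<lambda>y. \<alpha> *\<^sub>R y - \<beta> *\<^sub>R A x (\<zeta> *s v) y) = (\<Prod>i\<in>UNIV. \<alpha>\<^sup>2 - (\<beta> * cmod \<zeta>)\<^sup>2 * (\<kappa> i)\<^sup>2)"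
proof -
  \<comment> \<open>A square root of the phase of \<open>\<zeta>\<close>. Zero needs its own case
    since \<open>sgn 0 = 0\<close>, and \<open>c\<close> must have modulus 1.\<close>
  define c where "c = (if \<zeta> = 0 then 1 else csqrt (sgn \<zeta>))"
  have c2: "c\<^sup>2 * of_real (cmod \<zeta>) = \<zeta>"
    by (simp add: c_def sgn_div_norm scaleR_conv_of_real)
  have "cmod (c\<^sup>2) = 1" by (simp add: c_def norm_sgn)
  then have nc: "cmod c = 1" by (simp add: norm_power power2_eq_1_iff) (smt (verit) norm_ge_zero)
  then have cc: "c * cnj c = 1" by (simp add: complex_norm_square[symmetric])
  then have c0: "c \<noteq> 0" by auto
  have zc: "\<zeta> * cnj c = of_real (cmod \<zeta>) * c"
  proof -
    have "\<zeta> * cnj c = of_real (cmod \<zeta>) * c * (c * cnj c)" by (subst c2[symmetric]) (simp add: power2_eq_square)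
    then show ?thesis by (simp add: cc)
  qed
  have zv: "\<zeta> *s v \<in> normal_vectors fubini_study F x"
    using v by (simp add: normal_vectors_iff[OF x] fs_herm_simps)
  have HE: "H x (D x (E i)) (D x (E k)) = (if i = k then 1 else 0)" for i k
    using on(1)[of i k] on(2)[of i k] by (auto simp: h_eq D_lin[OF x] fs_herm_simps complex_eq_iff)
  have indep: "t = 0" if "(\<Sum>i\<in>UNIV. t $ i *s (c *s E i)) = 0" for t
  proof -
    have "H x (D x (\<Sum>i\<in>UNIV. t $ i *s (c *s E i))) (D x (E k)) = t $ k * c" for k
      by (simp add: D_lin[OF x] fs_herm_sum fs_herm_simps HE if_distrib sum.delta cong: if_cong)
    then have "t $ k * c = 0" for k
      unfolding that by (simp add: D_lin[OF x] fs_herm_simps)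
    then show "t = 0" using c0 by (simp add: vec_eq_iff)
  qed
  have Ac: "A x (\<zeta> *s v) (d *s E i) = (cnj d * \<zeta> * of_real (\<kappa> i)) *s E i" for d i
    by (simp add: shape_operator_lin[OF x v] shape_operator_lin[OF x zv] pr scaleR_eq_smult vector_smult_assoc)
  have A1: "A x (\<zeta> *s v) (c *s E i) = (cmod \<zeta> * \<kappa> i) *\<^sub>R (c *s E i)" for i
    unfolding Ac using zc by (simp add: scaleR_eq_smult vector_smult_assoc mult_ac)
  have "real_det (\<lambda>y. \<alpha> *\<^sub>R y - \<beta> *\<^sub>R A x (\<zeta> *s v) y) =
      (\<Prod>i\<in>UNIV. (\<alpha> - \<beta> * (cmod \<zeta> * \<kappa> i)) * (\<alpha> + \<beta> * (cmod \<zeta> * \<kappa> i)))"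
  proof (rule real_det_eigen[where E = "\<lambda>i. c *s E i"])
    show "linear (\<lambda>y. \<alpha> *\<^sub>R y - \<beta> *\<^sub>R A x (\<zeta> *s v) y)"
      using linear_shape_operator[OF x zv]
      by (intro linear_compose_sub linear_compose_scale_right linear_ident)
    fix i
    show "\<alpha> *\<^sub>R (c *s E i) - \<beta> *\<^sub>R A x (\<zeta> *s v) (c *s E i) = (\<alpha> - \<beta> * (cmod \<zeta> * \<kappa> i)) *\<^sub>R (c *s E i)"
      unfolding A1 by (simp add: algebra_simps)
    \<comment> \<open>Antilinearity flips the sign of the eigenvalue on passing from a vector to
      \<open>\<i>\<close> times it.\<close>
    have "A x (\<zeta> *s v) (\<i> *s (c *s E i)) = - ((cmod \<zeta> * \<kappa> i) *\<^sub>R (\<i> *s (c *s E i)))"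
      unfolding shape_operator_lin(1)[OF x zv, of \<i> "c *s E i"] A1
      by (simp add: scaleR_eq_smult vector_smult_assoc vec_eq_iff)
    then show "\<alpha> *\<^sub>R (\<i> *s (c *s E i)) - \<beta> *\<^sub>R A x (\<zeta> *s v) (\<i> *s (c *s E i)) =
       (\<alpha> + \<beta> * (cmod \<zeta> * \<kappa> i)) *\<^sub>R (\<i> *s (c *s E i))"
      by (simp add: scaleR_add_left)
  qed (use indep in blast)
  then show ?thesis by (simp add: power2_eq_square algebra_simps)
qed

end

context hol_immersion_change begin

lemma real_det_change:
  assumes x: "x \<in> U" and v: "v \<in> normal_vectors fubini_study F x"
  shows "real_det (\<lambda>y. \<alpha> *\<^sub>R y - \<beta> *\<^sub>R Y.A (\<tau> x) (N x v) y) = real_det (\<lambda>y. \<alpha> *\<^sub>R y - \<beta> *\<^sub>R X.A x v y)"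
proof (rule real_det_conj[OF \<tau>'_lin[OF x] inj_\<tau>'[OF x]])
  have "N x v \<in> normal_vectors fubini_study G (\<tau> x)" "\<tau> x \<in> T" using normal_vectors_N[OF x] v UT x by auto
  then show "linear (\<lambda>y. \<alpha> *\<^sub>R y - \<beta> *\<^sub>R Y.A (\<tau> x) (N x v) y)"
    by (intro linear_compose_sub linear_compose_scale_right linear_ident Y.linear_shape_operator)
  show "\<alpha> *\<^sub>R \<tau>' x y - \<beta> *\<^sub>R Y.A (\<tau> x) (N x v) (\<tau>' x y) = \<tau>' x (\<alpha> *\<^sub>R y - \<beta> *\<^sub>R X.A x v y)" for y
    using \<tau>'_lin[OF x] by (simp add: shape_operator_change[OF x v] linear_diff linear_cmul)
qed

end

section \<open>Immersed complex manifolds\<close>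

text \<open>\<open>induced_metric\<close> picks an affine chart afresh at each point. This locality
  replaces it near a point by the pullback under one coordinate expression.\<close>

lemma sectional_curvature_cong:
  assumes S: "open S" "x \<in> S" and eq: "\<And>y. y \<in> S \<Longrightarrow> g y = g' y"
  shows "sectional_curvature g x u v = sectional_curvature g' x u v"
proof -
  have "frechet_derivative (\<lambda>z. g z a b) (at y) = frechet_derivative (\<lambda>z. g' z a b) (at y)" if "y \<in> S" for a b y
    by (rule frechet_derivative_cong[OF S(1) that]) (simp add: eq)
  then have chr: "christoffel g y a b = christoffel g' y a b" if "y \<in> S" for a b y
    unfolding christoffel_def using that by (simp add: eq)
  have "frechet_derivative (\<lambda>y. christoffel g y a b) (at x) = frechet_derivative (\<lambda>y. christoffel g' y a b) (at x)" for a b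
    by (rule frechet_derivative_cong[OF S]) (simp add: chr)
  then have "curvature_tensor g x a b c = curvature_tensor g' x a b c" for a b c
    unfolding curvature_tensor_def cov_deriv_def by (simp add: chr S)
  then show ?thesis unfolding sectional_curvature_def by (simp add: eq S)
qed

locale immersed =
  fixes \<A> :: "('a, 'm::finite) chart set" and f :: "'a \<Rightarrow> (complex ^ ('n::finite option)) set"
  assumes atlas: "complex_atlas \<A>" and imm: "holomorphic_immersion \<A> cproj_atlas f"
begin

definition "chart_dom c j = snd c ` (fst c \<inter> f -` fst (affine_chart j))"
definition "rep c j = local_rep c (affine_chart j) f"

lemma inj_chart: "c \<in> \<A> \<Longrightarrow> inj_on (snd c) (fst c)"
  using atlas by (simp add: complex_atlas_def)

lemma chart_inv_chart [simp]: "c \<in> \<A> \<Longrightarrow> p \<in> fst c \<Longrightarrow> chart_inv c (snd c p) = p"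
  unfolding chart_inv_def by (rule inv_into_f_f[OF inj_chart])

lemma rep_hol_immersion: "c \<in> \<A> \<Longrightarrow> hol_immersion (rep c j) (chart_dom c j)"
  using imm unfolding holomorphic_immersion_def hol_immersion_def rep_def chart_dom_def cproj_atlas_def by blast

lemma rep_chart: "c \<in> \<A> \<Longrightarrow> p \<in> fst c \<Longrightarrow> rep c j (snd c p) = snd (affine_chart j) (f p)"
  by (simp add: rep_def local_rep_def)

lemma chart_dom_chart: "p \<in> fst c \<Longrightarrow> f p \<in> fst (affine_chart j) \<Longrightarrow> snd c p \<in> chart_dom c j"
  by (auto simp: chart_dom_def)

lemma chart_at: "p \<in> points \<A> \<Longrightarrow> chart_at \<A> p \<in> \<A>" "p \<in> points \<A> \<Longrightarrow> p \<in> fst (chart_at \<A> p)"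
  unfolding chart_at_def points_def by (rule someI2_ex; auto)+

lemma f_cproj: "p \<in> points \<A> \<Longrightarrow> f p \<in> cproj"
proof -
  assume "p \<in> points \<A>"
  then have "f p \<in> points (cproj_atlas :: ((complex ^ ('n option)) set, 'n) chart set)"
    using imm by (auto simp: holomorphic_immersion_def)
  then show ?thesis by (auto simp: points_def cproj_atlas_def affine_chart_def)
qed

lemma affine_charts_cover: "l \<in> cproj \<Longrightarrow> \<exists>j. l \<in> fst (affine_chart j)"
proof -
  assume "l \<in> cproj"
  then obtain z where z: "z \<noteq> 0" "l = cline z" by (auto simp: cproj_eq)
  then obtain j where "z $ j \<noteq> 0" by (auto simp: vec_eq_iff)
  then show ?thesis using z cline_in_chart by blast
qed

text \<open>\<open>chart_at\<close> may choose the charts at different points incoherently. In a fixed pair of charts \<open>c\<close> and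
  \<open>affine_chart j\<close> everything is continuous, and the choice at \<open>p\<close> differs by a change of coordinates.\<close>

definition "aff_index p = (SOME j. f p \<in> fst (affine_chart j) \<and> chart_at cproj_atlas (f p) = affine_chart j)"

lemma aff_index:
  assumes "p \<in> points \<A>" shows "f p \<in> fst (affine_chart (aff_index p))" "chart_at cproj_atlas (f p) = affine_chart (aff_index p)"
proof -
  have "\<exists>c. c \<in> cproj_atlas \<and> f p \<in> fst c"
    using affine_charts_cover[OF f_cproj[OF assms]] by (auto simp: cproj_atlas_def)
  then have "chart_at cproj_atlas (f p) \<in> cproj_atlas \<and> f p \<in> fst (chart_at cproj_atlas (f p))"
    unfolding chart_at_def by (rule someI_ex)
  then have "\<exists>j. f p \<in> fst (affine_chart j) \<and> chart_at cproj_atlas (f p) = affine_chart j"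
    by (auto simp: cproj_atlas_def)
  from someI_ex[OF this] show "f p \<in> fst (affine_chart (aff_index p))" "chart_at cproj_atlas (f p) = affine_chart (aff_index p)"
    unfolding aff_index_def by auto
qed

lemma open_chart_inter: "c \<in> \<A> \<Longrightarrow> d \<in> \<A> \<Longrightarrow> open (snd c ` (fst c \<inter> fst d))"
  and transition_hol: "c \<in> \<A> \<Longrightarrow> d \<in> \<A> \<Longrightarrow> holomorphic_map_on (snd d \<circ> chart_inv c) (snd c ` (fst c \<inter> fst d))"
  using atlas by (auto simp: complex_atlas_def holomorphic_map_on_def)

lemma change:
  assumes c: "c \<in> \<A>" "c' \<in> \<A>"
  shows "hol_immersion_change (rep c j) (chart_dom c j) (rep c' k) (chart_dom c' k) (snd c' \<circ> chart_inv c)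
     (snd c ` (fst c \<inter> fst c' \<inter> f -` fst (affine_chart j) \<inter> f -` fst (affine_chart k))) j k"
proof -
  let ?U = "snd c ` (fst c \<inter> fst c' \<inter> f -` fst (affine_chart j) \<inter> f -` fst (affine_chart k))"
  have "?U = snd c ` (fst c \<inter> fst c') \<inter> chart_dom c j \<inter> chart_dom c k"
    unfolding chart_dom_def using inj_chart[OF c(1)] by (auto simp: inj_on_def)
  moreover have "open (chart_dom c l)" for l using hol_immersion.openS[OF rep_hol_immersion[OF c(1)]] .
  ultimately have "open ?U" using open_chart_inter[OF c] by (simp add: open_Int)
  then have \<tau>: "holomorphic_map_on (snd c' \<circ> chart_inv c) ?U"
    using transition_hol[OF c] unfolding holomorphic_map_on_def by (auto simp: image_iff Bex_def)
  have "homog j (rep c j (snd c p)) $ k \<noteq> 0 \<and> rep c' k (snd c' p) = trans_map j k (rep c j (snd c p))"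
    if p: "p \<in> fst c" "p \<in> fst c'" "f p \<in> fst (affine_chart j)" "f p \<in> fst (affine_chart k)" for p
  proof -
    have "chart_inv (affine_chart j) (snd (affine_chart j) (f p)) = f p"
      by (simp add: chart_inv_affine cline_homog_affine_chart p)
    then show ?thesis using affine_chart_in_iff[of j "snd (affine_chart j) (f p)" k]
        affine_transition[of j "snd (affine_chart j) (f p)" k] p c by (simp add: rep_chart)
  qed
  then show ?thesis
    unfolding hol_immersion_change_def hol_immersion_change_axioms_def
    using rep_hol_immersion c \<tau> by (auto simp: chart_dom_def)
qed

abbreviation "base_chart p \<equiv> chart_at \<A> p"
abbreviation "base_point p \<equiv> snd (base_chart p) p"

lemma rep_at_eq: "p \<in> points \<A> \<Longrightarrow> rep_at \<A> f p = rep (base_chart p) (aff_index p)"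
  by (simp add: rep_at_def rep_def aff_index)

lemma hol_immersion_at: "p \<in> points \<A> \<Longrightarrow> hol_immersion (rep (base_chart p) (aff_index p)) (chart_dom (base_chart p) (aff_index p))"
  by (rule rep_hol_immersion) (rule chart_at)

lemma base_point_in_dom: "p \<in> points \<A> \<Longrightarrow> base_point p \<in> chart_dom (base_chart p) (aff_index p)"
  by (intro chart_dom_chart chart_at aff_index)

lemma chart_subset: "c \<in> \<A> \<Longrightarrow> fst c \<subseteq> points \<A>" by (auto simp: points_def)

text \<open>Keeping the chart \<open>c\<close> and changing only the affine chart makes the source
  transition the identity near \<open>y\<close>; the target transition is an isometry.\<close>

lemma induced_metric_eq:
  assumes c: "c \<in> \<A>" and y: "y \<in> chart_dom c j"
  shows "induced_metric f c y = pullback_metric fubini_study (rep c j) y"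
proof (intro ext)
  fix u v
  obtain q where q: "y = snd c q" "q \<in> fst c" "f q \<in> fst (affine_chart j)" using y by (auto simp: chart_dom_def)
  have qp: "q \<in> points \<A>" using q c chart_subset by blast
  interpret ch: hol_immersion_change "rep c j" "chart_dom c j" "rep c (aff_index q)" "chart_dom c (aff_index q)" "snd c \<circ> chart_inv c"
     "snd c ` (fst c \<inter> fst c \<inter> f -` fst (affine_chart j) \<inter> f -` fst (affine_chart (aff_index q)))" j "aff_index q"
    by (rule change[OF c c])
  let ?U = "snd c ` (fst c \<inter> fst c \<inter> f -` fst (affine_chart j) \<inter> f -` fst (affine_chart (aff_index q)))"
  have yU: "y \<in> ?U" using q aff_index[OF qp] by auto
  have "frechet_derivative (snd c \<circ> chart_inv c) (at y) = frechet_derivative (\<lambda>x. x) (at y)"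
    by (rule frechet_derivative_cong[OF ch.openU yU]) (use c in auto)
  then have id: "dir_deriv (snd c \<circ> chart_inv c) y u = u" for u by simp
  have ty: "(snd c \<circ> chart_inv c) y = y" using q c by simp
  have "induced_metric f c y u v = pullback_metric fubini_study (rep c (aff_index q)) y u v"
    using q c by (simp add: induced_metric_def aff_index[OF qp] rep_def)
  also have "\<dots> = Re (ch.Y.H ((snd c \<circ> chart_inv c) y) (ch.Y.D ((snd c \<circ> chart_inv c) y) (dir_deriv (snd c \<circ> chart_inv c) y u))
      (ch.Y.D ((snd c \<circ> chart_inv c) y) (dir_deriv (snd c \<circ> chart_inv c) y v)))"
    unfolding id ty ch.Y.h_eq ..
  also have "\<dots> = pullback_metric fubini_study (rep c j) y u v"
    unfolding ch.comm_deriv[OF yU] ch.H_N[OF yU] ch.X.h_eq ..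
  finally show "induced_metric f c y u v = pullback_metric fubini_study (rep c j) y u v" .
qed

lemma tangent_inner_eq:
  "p \<in> points \<A> \<Longrightarrow> tangent_inner \<A> f p = pullback_metric fubini_study (rep (base_chart p) (aff_index p)) (base_point p)"
  by (intro ext) (simp add: tangent_inner_def induced_metric_eq[OF chart_at(1) base_point_in_dom])

lemma rep_base_point: "p \<in> points \<A> \<Longrightarrow> rep (base_chart p) (aff_index p) (base_point p) = snd (affine_chart (aff_index p)) (f p)"
  by (simp add: rep_chart chart_at)

lemma fs_inner_eq: "p \<in> points \<A> \<Longrightarrow> fs_inner (f p) = fubini_study (rep (base_chart p) (aff_index p) (base_point p))"
  by (intro ext) (simp add: fs_inner_def aff_index rep_base_point)

lemma normal_space_eq:
  "p \<in> points \<A> \<Longrightarrow> normal_space_at \<A> f p = normal_vectors fubini_study (rep (base_chart p) (aff_index p)) (base_point p)"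
  by (simp add: normal_space_at_def rep_at_eq)

lemma shape_op_eq:
  "p \<in> points \<A> \<Longrightarrow> shape_op \<A> f p = shape_operator fubini_study (rep (base_chart p) (aff_index p)) (base_point p)"
  by (intro ext) (simp add: shape_op_def rep_at_eq)

lemma holomorphic_sectional_curvature_eq:
  assumes p: "p \<in> points \<A>"
  shows "holomorphic_sectional_curvature \<A> f p e =
    sectional_curvature (pullback_metric fubini_study (rep (base_chart p) (aff_index p))) (base_point p) e (\<i> *s e)"
  unfolding holomorphic_sectional_curvature_def
  by (rule sectional_curvature_cong[OF hol_immersion.openS[OF hol_immersion_at[OF p]] base_point_in_dom[OF p]
      induced_metric_eq[OF chart_at(1)[OF p]]])

lemma fs_norm_eq_1: "p \<in> points \<A> \<Longrightarrow> fs_norm (f p) u = 1 \<longleftrightarrow> fubini_study (rep (base_chart p) (aff_index p) (base_point p)) u u = 1"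
  by (simp add: fs_norm_def fs_inner_eq)

lemma holomorphic_sectional_curvature_principal:
  assumes card: "CARD('n) = CARD('m) + 1" and p: "p \<in> points \<A>"
    and fam: "holomorphic_principal_family \<A> f p u e \<kappa>"
  shows "holomorphic_sectional_curvature \<A> f p (e i) = 4 - 2 * (\<kappa> i)\<^sup>2"
  unfolding holomorphic_sectional_curvature_eq[OF p]
  by (rule hol_immersion.sectional_curvature_principal[OF hol_immersion_at[OF p] card base_point_in_dom[OF p]])
     (use fam p in \<open>auto simp: holomorphic_principal_family_def normal_space_eq fs_norm_eq_1 tangent_inner_eq shape_op_eq\<close>)

lemma real_det_family:
  assumes p: "p \<in> points \<A>" and fam: "holomorphic_principal_family \<A> f p u e \<kappa>"
  shows "real_det (\<lambda>x. \<alpha> *\<^sub>R x - \<beta> *\<^sub>R shape_op \<A> f p (\<zeta> *s u) x) = (\<Prod>i\<in>UNIV. \<alpha>\<^sup>2 - (\<beta> * cmod \<zeta>)\<^sup>2 * (\<kappa> i)\<^sup>2)"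
  unfolding shape_op_eq[OF p]
  by (rule hol_immersion.real_det_principal[OF hol_immersion_at[OF p] base_point_in_dom[OF p], where E = e])
     (use fam p in \<open>auto simp: holomorphic_principal_family_def normal_space_eq fs_norm_eq_1 tangent_inner_eq shape_op_eq\<close>)

end

section \<open>Lebesgue measure on the complex plane\<close>

lemma emeasure_distr_nn_integral:
  assumes [measurable]: "h \<in> measurable M N" "X \<in> sets N"
  shows "emeasure (distr M N h) X = (\<integral>\<^sup>+t. indicator X (h t) \<partial>M)"
proof -
  have "(\<integral>\<^sup>+x. indicator X x \<partial>distr M N h) = (\<integral>\<^sup>+t. indicator X (h t) \<partial>M)"
    by (rule nn_integral_distr) measurable
  then show ?thesis by simp
qed

lemma emeasure_cball_complex:
  "0 \<le> a \<Longrightarrow> emeasure lborel (cball (0::complex) a) = ennreal (pi * a\<^sup>2)"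
  using emeasure_eq_ennreal_measure[of lborel "cball (0::complex) a"] emeasure_lborel_cball_finite[of "0::complex" a]
  by (simp add: content_cball unit_ball_vol_2)

text \<open>Polar coordinates with the angle integrated out. Both measures give the half-line up to
  \<open>a\<close> the area of the disc of radius \<open>a\<close>, and half-lines generate the
  Borel sets.\<close>

lemma distr_cmod:
  "distr lborel borel cmod = density lborel (\<lambda>r. ennreal (2 * pi * r) * indicator {0..} r)"
    (is "?L = ?R")
proof (rule measure_eqI_generator_eq[where E = "range atMost" and \<Omega> = UNIV and A = "\<lambda>n. {..real n}"])
  show "Int_stable (range (atMost :: real \<Rightarrow> _))" by (auto simp: Int_stable_def)
  have s: "sets (borel :: real measure) = sigma_sets UNIV (range atMost)"
    unfolding borel_eq_atMost by (rule sets_measure_of) simp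
  show "sets ?L = sigma_sets UNIV (range atMost)" "sets ?R = sigma_sets UNIV (range atMost)"
    by (simp_all add: s)
  have L: "emeasure ?L {..a} = (if 0 \<le> a then ennreal (pi * a\<^sup>2) else 0)" for a :: real
  proof -
    have "cmod -` {..a} = cball 0 a" by auto
    then show ?thesis by (simp add: emeasure_distr emeasure_cball_complex)
  qed
  have R: "emeasure ?R {..a} = (if 0 \<le> a then ennreal (pi * a\<^sup>2) else 0)" for a :: real
  proof -
    have e: "emeasure ?R {..a} = (\<integral>\<^sup>+r. ennreal (2 * pi * r) * indicator {0..a} r \<partial>lborel)"
      by (subst emeasure_density) (auto intro!: nn_integral_cong split: split_indicator)
    show ?thesis
    proof (cases "0 \<le> a")
      case True
      have "(\<integral>\<^sup>+r. ennreal (2 * pi * r) * indicator {0..a} r \<partial>lborel) = ennreal (pi * a\<^sup>2 - pi * 0\<^sup>2)"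
        by (rule nn_integral_FTC_Icc) (use True in \<open>auto intro!: derivative_eq_intros\<close>)
      then show ?thesis using True e by simp
    qed (simp add: e)
  qed
  show "emeasure ?L X = emeasure ?R X" if "X \<in> range atMost" for X using that L R by auto
  show "emeasure ?L {..real n} \<noteq> \<infinity>" for n by (simp add: L)
  show "(\<Union>n. {..real n}) = UNIV" using real_arch_simple by auto
qed auto

lemma nn_integral_radial:
  assumes [measurable]: "g \<in> borel_measurable borel"
  shows "(\<integral>\<^sup>+\<zeta>. g (cmod \<zeta>) \<partial>lborel) = (\<integral>\<^sup>+r. ennreal (2 * pi * r) * indicator {0..} r * g r \<partial>lborel)"
proof -
  have "(\<integral>\<^sup>+\<zeta>. g (cmod \<zeta>) \<partial>lborel) = (\<integral>\<^sup>+r. g r \<partial>distr lborel borel cmod)"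
    by (subst nn_integral_distr) auto
  also have "\<dots> = (\<integral>\<^sup>+r. ennreal (2 * pi * r) * indicator {0..} r * g r \<partial>lborel)"
    unfolding distr_cmod by (subst nn_integral_density) auto
  finally show ?thesis .
qed

lemma lborel_complex: "(lborel :: complex measure) = distr (lborel \<Otimes>\<^sub>M lborel) borel (\<lambda>(x, y). Complex x y)"
proof (rule lborel_eqI)
  have m[measurable]: "(\<lambda>(x, y). Complex x y) \<in> borel_measurable (lborel \<Otimes>\<^sub>M lborel)"
    by (subst borel_measurable_complex_iff) (simp add: case_prod_unfold)
  fix l u :: complex assume le: "\<And>b. b \<in> Basis \<Longrightarrow> l \<bullet> b \<le> u \<bullet> b"
  have e: "(\<lambda>(x, y). Complex x y) -` box l u = {Re l<..<Re u} \<times> {Im l<..<Im u}"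
    by (auto simp: box_def Basis_complex_def inner_complex_def)
  have "emeasure (distr (lborel \<Otimes>\<^sub>M lborel) borel (\<lambda>(x, y). Complex x y)) (box l u) =
    emeasure (lborel \<Otimes>\<^sub>M lborel) ({Re l<..<Re u} \<times> {Im l<..<Im u})"
    by (subst emeasure_distr) (auto simp: space_pair_measure e)
  also have "\<dots> = ennreal (Re u - Re l) * ennreal (Im u - Im l)"
    by (subst lborel.emeasure_pair_measure_Times)
       (use le[of 1] le[of \<i>] in \<open>auto simp: Basis_complex_def inner_complex_def\<close>)
  finally show "emeasure (distr (lborel \<Otimes>\<^sub>M lborel) borel (\<lambda>(x, y). Complex x y)) (box l u) = (\<Prod>b\<in>Basis. (u - l) \<bullet> b)"
    using le[of 1] le[of \<i>] by (simp add: Basis_complex_def inner_complex_def ennreal_mult)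
qed simp

lemma nn_integral_complex:
  assumes [measurable]: "g \<in> borel_measurable borel"
  shows "(\<integral>\<^sup>+\<zeta>. g \<zeta> \<partial>lborel) = (\<integral>\<^sup>+x. \<integral>\<^sup>+y. g (Complex x y) \<partial>lborel \<partial>lborel)"
proof -
  have m[measurable]: "(\<lambda>(x, y). Complex x y) \<in> borel_measurable (lborel \<Otimes>\<^sub>M lborel)"
    by (subst borel_measurable_complex_iff) (simp add: case_prod_unfold)
  have "(\<integral>\<^sup>+\<zeta>. g \<zeta> \<partial>lborel) = (\<integral>\<^sup>+z. g (case z of (x, y) \<Rightarrow> Complex x y) \<partial>(lborel \<Otimes>\<^sub>M lborel))"
    by (subst lborel_complex, subst nn_integral_distr) auto
  also have "\<dots> = (\<integral>\<^sup>+x. \<integral>\<^sup>+y. g (Complex x y) \<partial>lborel \<partial>lborel)"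
    by (subst lborel.nn_integral_fst[symmetric]) auto
  finally show ?thesis .
qed

lemma borel_measurable_Complex [measurable]:
  assumes "a \<in> borel_measurable M" "b \<in> borel_measurable M"
  shows "(\<lambda>x. Complex (a x) (b x)) \<in> borel_measurable M"
  by (subst borel_measurable_complex_iff) (use assms in simp)

text \<open>A linear change of variables in the plane reduces to one-dimensional ones: substitute
  \<open>u = a x + b y\<close> for fixed \<open>y\<close>, exchange the integrals, and substitute in \<open>y\<close> for fixed \<open>u\<close>.\<close>

lemma nn_integral_plane_linear_aux:
  assumes [measurable]: "g \<in> borel_measurable borel" and a: "a \<noteq> 0" and det: "\<bar>a * d - b * c\<bar> = 1"
  shows "(\<integral>\<^sup>+y. \<integral>\<^sup>+x. g (Complex (a * x + b * y) (c * x + d * y)) \<partial>lborel \<partial>lborel) = (\<integral>\<^sup>+\<zeta>. g \<zeta> \<partial>lborel)"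
proof -
  define e where "e = (a * d - b * c) / a"
  have e: "e \<noteq> 0" "\<bar>e\<bar> = 1 / \<bar>a\<bar>" using det a by (auto simp: e_def abs_divide)
  let ?G = "\<lambda>u y. g (Complex u (c / a * u + e * y))"
  have 1: "(\<integral>\<^sup>+u. ?G u y \<partial>lborel) = \<bar>a\<bar> * (\<integral>\<^sup>+x. g (Complex (a * x + b * y) (c * x + d * y)) \<partial>lborel)" for y
  proof -
    have "(\<integral>\<^sup>+u. ?G u y \<partial>lborel) = \<bar>a\<bar> * (\<integral>\<^sup>+x. ?G (b * y + a * x) y \<partial>lborel)"
      by (rule nn_integral_real_affine[OF _ a]) measurable
    moreover have "c / a * (b * y + a * x) + e * y = c * x + d * y" for x
      using a by (simp add: e_def field_simps)
    ultimately show ?thesis by (simp add: add.commute)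
  qed
  have 2: "(\<integral>\<^sup>+y. g (Complex u y) \<partial>lborel) = \<bar>e\<bar> * (\<integral>\<^sup>+y. ?G u y \<partial>lborel)" for u
    by (rule nn_integral_real_affine[OF _ e(1)]) measurable
  have "(\<integral>\<^sup>+\<zeta>. g \<zeta> \<partial>lborel) = (\<integral>\<^sup>+u. \<bar>e\<bar> * (\<integral>\<^sup>+y. ?G u y \<partial>lborel) \<partial>lborel)"
    by (simp add: nn_integral_complex 2)
  also have "\<dots> = \<bar>e\<bar> * (\<integral>\<^sup>+u. \<integral>\<^sup>+y. ?G u y \<partial>lborel \<partial>lborel)"
    by (rule nn_integral_cmult) measurable
  also have "(\<integral>\<^sup>+u. \<integral>\<^sup>+y. ?G u y \<partial>lborel \<partial>lborel) = (\<integral>\<^sup>+y. \<integral>\<^sup>+u. ?G u y \<partial>lborel \<partial>lborel)"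
    by (rule lborel_pair.Fubini') measurable
  also have "\<dots> = (\<integral>\<^sup>+y. \<bar>a\<bar> * (\<integral>\<^sup>+x. g (Complex (a * x + b * y) (c * x + d * y)) \<partial>lborel) \<partial>lborel)"
    unfolding 1 ..
  also have "\<dots> = \<bar>a\<bar> * (\<integral>\<^sup>+y. \<integral>\<^sup>+x. g (Complex (a * x + b * y) (c * x + d * y)) \<partial>lborel \<partial>lborel)"
    by (rule nn_integral_cmult) measurable
  finally show ?thesis using a
    by (simp add: e mult.assoc[symmetric] ennreal_mult[symmetric])
qed

lemma nn_integral_plane_linear:
  assumes [measurable]: "g \<in> borel_measurable borel" and det: "\<bar>a * d - b * c\<bar> = 1"
  shows "(\<integral>\<^sup>+y. \<integral>\<^sup>+x. g (Complex (a * x + b * y) (c * x + d * y)) \<partial>lborel \<partial>lborel) = (\<integral>\<^sup>+\<zeta>. g \<zeta> \<partial>lborel)"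
proof (cases "a = 0")
  case True
  \<comment> \<open>Exchanging the integration variables puts the nonzero coefficient
    \<open>b\<close> in first place.\<close>
  with det have b: "b \<noteq> 0" by auto
  have "(\<integral>\<^sup>+y. \<integral>\<^sup>+x. g (Complex (a * x + b * y) (c * x + d * y)) \<partial>lborel \<partial>lborel) =
    (\<integral>\<^sup>+x. \<integral>\<^sup>+y. g (Complex (b * y + a * x) (d * y + c * x)) \<partial>lborel \<partial>lborel)"
    by (subst lborel_pair.Fubini') (simp_all add: add.commute)
  also have "\<dots> = (\<integral>\<^sup>+\<zeta>. g \<zeta> \<partial>lborel)"
    by (rule nn_integral_plane_linear_aux[OF assms(1) b]) (use det in \<open>simp add: abs_minus_commute\<close>)
  finally show ?thesis .
qed (rule nn_integral_plane_linear_aux[OF assms(1) _ det])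

lemma nn_integral_orthonormal_plane:
  assumes g: "g \<in> borel_measurable borel" and on: "cmod \<alpha> = 1" "cmod \<beta> = 1" "\<alpha> \<bullet> \<beta> = 0"
  shows "(\<integral>\<^sup>+y. \<integral>\<^sup>+x. g (of_real x * \<alpha> + of_real y * \<beta>) \<partial>lborel \<partial>lborel) = (\<integral>\<^sup>+\<zeta>. g \<zeta> \<partial>lborel)"
proof -
  let ?a = "Re \<alpha>" and ?b = "Re \<beta>" and ?c = "Im \<alpha>" and ?d = "Im \<beta>"
  \<comment> \<open>Lagrange's identity; orthonormality then leaves determinant 1 or -1.\<close>
  have "(?a * ?d - ?b * ?c)\<^sup>2 + (\<alpha> \<bullet> \<beta>)\<^sup>2 = (cmod \<alpha>)\<^sup>2 * (cmod \<beta>)\<^sup>2"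
    by (simp add: inner_complex_def cmod_power2) algebra
  then have "\<bar>?a * ?d - ?b * ?c\<bar> = 1" by (simp add: on power2_eq_1_iff) (smt (verit))
  moreover have "of_real x * \<alpha> + of_real y * \<beta> = Complex (?a * x + ?b * y) (?c * x + ?d * y)" for x y
    by (simp add: complex_eq_iff mult.commute)
  ultimately show ?thesis using nn_integral_plane_linear[OF g] by simp
qed

section \<open>Lebesgue measure on a complex line\<close>

text \<open>The basis behind \<open>subspace_lebesgue\<close> is an unknown choice. Pulled back to
  the plane it consists of two orthonormal numbers, and plane Lebesgue measure is invariant under
  the corresponding orthogonal map.\<close>

lemma subspace_lebesgue_line:
  fixes u :: "complex ^ 'n::finite" and g :: "complex ^ 'n \<Rightarrow> complex ^ 'n \<Rightarrow> real"
  assumes g: "\<And>\<zeta> \<xi>. g (\<zeta> *s u) (\<xi> *s u) = \<zeta> \<bullet> \<xi>" and u: "u \<noteq> 0"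
  shows "subspace_lebesgue g (range (\<lambda>\<zeta>. \<zeta> *s u)) = distr lborel borel (\<lambda>\<zeta>. \<zeta> *s u)"
proof -
  let ?\<phi> = "\<lambda>\<zeta>. \<zeta> *s u"
  let ?W = "range ?\<phi>"
  have lin: "linear ?\<phi>"
    by (rule linearI) (simp_all add: vec_eq_iff algebra_simps)
  have inj: "inj ?\<phi>" using u by (auto simp: inj_def vec_eq_iff)
  define B where "B = (SOME B. orthonormal_basis_of g ?W B)"
  \<comment> \<open>The witness \<open>u\<close>, \<open>\<i> *s u\<close> guarantees that the
    choice yields an orthonormal basis.\<close>
  have "orthonormal_basis_of g ?W (?\<phi> ` {1, \<i>})"
    unfolding orthonormal_basis_of_def
  proof (intro conjI)
    show "?\<phi> ` {1, \<i>} \<subseteq> ?W" by (rule image_mono) simp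
    have "span {1, \<i>} = (UNIV :: complex set)"
      using span_Basis[where 'a = complex] by (simp add: Basis_complex_def)
    then show "span (?\<phi> ` {1, \<i>}) = ?W" using linear_span_image[OF lin, of "{1, \<i>}"] by simp
  qed (use g[of 1 1] g[of 1 \<i>] g[of \<i> 1] g[of \<i> \<i>] inj in \<open>auto simp: inner_complex_def dest: injD\<close>)
  then have B: "orthonormal_basis_of g ?W B" unfolding B_def by (rule someI)
  define Z where "Z = ?\<phi> -` B"
  have BZ: "B = ?\<phi> ` Z" using B by (auto simp: orthonormal_basis_of_def Z_def)
  have fZ: "finite Z" using B inj by (simp add: orthonormal_basis_of_def Z_def finite_vimageI)
  have onZ: "\<alpha> \<bullet> \<beta> = (if \<alpha> = \<beta> then 1 else 0)" if "\<alpha> \<in> Z" "\<beta> \<in> Z" for \<alpha> \<beta>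
    using B that g[of \<alpha> \<beta>] inj u by (auto simp: orthonormal_basis_of_def BZ dest: injD)
  have "?\<phi> ` span Z = ?\<phi> ` UNIV" using B linear_span_image[OF lin, of Z] by (simp add: orthonormal_basis_of_def BZ)
  then have sp: "span Z = UNIV" using inj by (simp add: inj_image_eq_iff)
  \<comment> \<open>Orthonormality and spanning force exactly two elements.\<close>
  have "independent Z"
    by (rule pairwise_orthogonal_independent)
       (use onZ in \<open>force simp: pairwise_def orthogonal_def\<close>)+
  then have "card Z = dim Z" by (simp add: dim_eq_card_independent)
  also have "dim Z = 2" using sp dim_span[of Z] by simp
  finally obtain \<alpha> \<beta> where ab: "Z = {\<alpha>, \<beta>}" "\<alpha> \<noteq> \<beta>" by (auto simp: card_2_iff)
  have nab: "cmod \<alpha> = 1" "cmod \<beta> = 1" "\<alpha> \<bullet> \<beta> = 0"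
    using onZ[of \<alpha> \<alpha>] onZ[of \<beta> \<beta>] onZ[of \<alpha> \<beta>] ab by (auto simp: norm_eq_sqrt_inner)
  let ?b1 = "?\<phi> \<alpha>" and ?b2 = "?\<phi> \<beta>"
  have b12: "?b1 \<noteq> ?b2" using ab inj by (auto dest: injD)
  have B12: "B = {?b2, ?b1}" using BZ ab by auto
  have sumB: "(\<Sum>b\<in>B. t b *\<^sub>R b) = t ?b2 *\<^sub>R ?b2 + t ?b1 *\<^sub>R ?b1" for t
    unfolding B12 using b12[symmetric] by simp
  have [measurable]: "?\<phi> \<in> borel_measurable borel"
    using linear_conv_bounded_linear lin by (intro borel_measurable_continuous_onI linear_continuous_on) auto
  have [measurable]: "(\<lambda>t. \<Sum>b\<in>B. t b *\<^sub>R b) \<in> borel_measurable (PiM B (\<lambda>_. lborel))"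
    by measurable
  have SL: "subspace_lebesgue g ?W = distr (PiM B (\<lambda>_. lborel)) borel (\<lambda>t. \<Sum>b\<in>B. t b *\<^sub>R b)"
    by (simp add: subspace_lebesgue_def Let_def B_def)
  interpret product_sigma_finite "\<lambda>_ :: complex ^ 'n. lborel :: real measure" by standard
  show ?thesis
  proof (rule measure_eqI)
    show "sets (subspace_lebesgue g ?W) = sets (distr lborel borel ?\<phi>)" by (simp add: SL)
    fix X assume "X \<in> sets (subspace_lebesgue g ?W)"
    then have X[measurable]: "X \<in> sets borel" by (simp add: SL)
    let ?h = "\<lambda>v. indicator X v :: ennreal"
    have "emeasure (subspace_lebesgue g ?W) X = (\<integral>\<^sup>+t. ?h (\<Sum>b\<in>B. t b *\<^sub>R b) \<partial>PiM B (\<lambda>_. lborel))"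
      unfolding SL by (rule emeasure_distr_nn_integral) measurable
    also have "\<dots> = (\<integral>\<^sup>+t. ?h (t ?b2 *\<^sub>R ?b2 + t ?b1 *\<^sub>R ?b1) \<partial>PiM (insert ?b2 {?b1}) (\<lambda>_. lborel))"
      by (simp only: sumB) (simp only: B12)
    also have "\<dots> = (\<integral>\<^sup>+t. (\<integral>\<^sup>+y. ?h (y *\<^sub>R ?b2 + t ?b1 *\<^sub>R ?b1) \<partial>lborel) \<partial>PiM {?b1} (\<lambda>_. lborel))"
      by (subst product_nn_integral_insert) (use b12 b12[symmetric] in simp_all)
    also have "\<dots> = (\<integral>\<^sup>+x. (\<integral>\<^sup>+y. ?h (y *\<^sub>R ?b2 + x *\<^sub>R ?b1) \<partial>lborel) \<partial>lborel)"
      by (subst product_nn_integral_singleton[symmetric, where i = ?b1]) simp_all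
    also have "\<dots> = (\<integral>\<^sup>+x. (\<integral>\<^sup>+y. ?h (?\<phi> (of_real y * \<beta> + of_real x * \<alpha>)) \<partial>lborel) \<partial>lborel)"
      by (simp add: scaleR_eq_smult vector_smult_assoc vector_sadd_rdistrib)
    also have "\<dots> = (\<integral>\<^sup>+\<zeta>. ?h (?\<phi> \<zeta>) \<partial>lborel)"
      by (rule nn_integral_orthonormal_plane[of "\<lambda>\<zeta>. ?h (?\<phi> \<zeta>)"]) (use nab in \<open>simp_all add: inner_commute\<close>)
    also have "\<dots> = emeasure (distr lborel borel ?\<phi>) X"
      by (rule emeasure_distr_nn_integral[symmetric]) measurable
    finally show "emeasure (subspace_lebesgue g ?W) X = emeasure (distr lborel borel ?\<phi>) X" .
  qed
qed

section \<open>Unit normal fields and measurability in coordinates\<close>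

lemma sets_borel_Collect_continuous_on:
  assumes "continuous_on A g" "A \<in> sets borel" "Y \<in> sets borel"
  shows "{z \<in> A. g z \<in> Y} \<in> sets borel"
proof -
  have "g \<in> borel_measurable (restrict_space borel A)"
    by (rule borel_measurable_continuous_on_restrict[OF assms(1)])
  from measurable_sets[OF this assms(3)] have "g -` Y \<inter> A \<in> sets (restrict_space borel A)"
    by (simp add: space_restrict_space)
  then have "g -` Y \<inter> A \<in> sets borel" using assms(2) by (simp add: sets_restrict_space_iff)
  then show ?thesis by (simp add: vimage_def Int_def conj_commute)
qed

lemma continuous_on_fs_herm [continuous_intros]:
  assumes "continuous_on A W" "continuous_on A a" "continuous_on A c"
  shows "continuous_on A (\<lambda>x. fs_herm (W x) (a x) (c x))"
  unfolding fs_herm_def by (intro continuous_intros assms) auto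

lemma continuous_on_det:
  fixes M :: "'d::topological_space \<Rightarrow> 'a::real_normed_field ^ 'm::finite ^ 'm"
  assumes "\<And>i j. continuous_on A (\<lambda>x. M x $ i $ j)"
  shows "continuous_on A (\<lambda>x. det (M x))"
  unfolding det_def by (intro continuous_intros assms)

lemma continuous_on_gram_solve:
  assumes W: "continuous_on A W" and E: "\<And>i. continuous_on A (\<lambda>y. E y i)" and r: "\<And>i. continuous_on A (\<lambda>y. r y i)"
    and indep: "\<And>x t. x \<in> A \<Longrightarrow> (\<Sum>k\<in>UNIV. t $ k *s E x k) = 0 \<Longrightarrow> t = 0"
  shows "continuous_on A (\<lambda>y. gram_solve (W y) (E y) (r y) $ k)"
proof -
  have g: "continuous_on A (\<lambda>y. gram (W y) (E y) $ i $ j)" for i j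
    unfolding gram_def by (simp add: continuous_on_fs_herm W E)
  have "continuous_on A (\<lambda>y. if j = k then r y i else gram (W y) (E y) $ i $ j)" for i j
    using r g by (cases "j = k") auto
  moreover have "det (gram (W x) (E x)) \<noteq> 0" if "x \<in> A" for x
    by (rule det_gram) (rule indep[OF that])
  ultimately show ?thesis
    unfolding gram_solve_def by (auto intro!: continuous_intros continuous_on_det g)
qed

lemma borel_measurable_det:
  fixes M :: "'d \<Rightarrow> real ^ 'm::finite ^ 'm"
  assumes "\<And>i j. (\<lambda>x. M x $ i $ j) \<in> borel_measurable N"
  shows "(\<lambda>x. det (M x)) \<in> borel_measurable N"
  unfolding det_def by (intro borel_measurable_sum borel_measurable_times borel_measurable_const borel_measurable_prod assms)

context hol_immersion begin

lemma continuous_on_F: "continuous_on S F"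
  by (rule has_derivative_continuous_on[OF has_derivative_at_withinI[OF deriv_F]])

lemma continuous_on_D: "continuous_on S (\<lambda>x. D x v)"
  by (rule has_derivative_continuous_on[OF has_derivative_at_withinI[OF deriv_D]])

lemma continuous_on_D2: "continuous_on S (\<lambda>x. D2 x u v)"
  by (rule has_derivative_continuous_on[OF has_derivative_at_withinI[OF deriv_D2(1)]])

definition "nproj x a = a - D x (tan_coef x a)"
text \<open>Where the \<open>k\<close>-th coordinate vector has a nonzero normal part, normalising
  that part gives a continuous unit normal field. These local fields stand in for a global choice
  without regularity.\<close>

definition "nset k = {x \<in> S. nproj x (axis k 1) \<noteq> 0}"
definition "unit_normal k x = (1 / sqrt (fubini_study (F x) (nproj x (axis k 1)) (nproj x (axis k 1)))) *\<^sub>R nproj x (axis k 1)"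

lemma continuous_on_nproj: "continuous_on S (\<lambda>x. nproj x a)"
proof -
  have "continuous_on S (\<lambda>x. D x (tan_coef x a))"
    unfolding continuous_on_eq_continuous_at[OF openS]
  proof
    fix x assume x: "x \<in> S"
    obtain g' where "((\<lambda>y. tan_coef y a) has_derivative g') (at x)"
      using tan_coef_differentiable[OF x, of "\<lambda>_. a"] by (auto simp: differentiable_def)
    from has_derivative_D_comp[OF openS x _ has_derivative_ident this]
    show "isCont (\<lambda>x. D x (tan_coef x a)) x" by (auto intro: has_derivative_continuous)
  qed
  then show ?thesis unfolding nproj_def by (intro continuous_intros)
qed

lemma open_nset: "open (nset k)"
proof -
  have "nset k = S \<inter> (\<lambda>x. nproj x (axis k 1)) -` (- {0})" by (auto simp: nset_def)
  then show ?thesis using continuous_open_preimage[OF continuous_on_nproj openS, of "- {0}"]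
    by (simp add: open_Compl)
qed

lemma nset_subset: "nset k \<subseteq> S" by (auto simp: nset_def)

lemma unit_normal:
  assumes "x \<in> nset k"
  shows "unit_normal k x \<in> normal_vectors fubini_study F x"
    and "fubini_study (F x) (unit_normal k x) (unit_normal k x) = 1"
proof -
  let ?n = "nproj x (axis k 1)"
  have x: "x \<in> S" and n: "?n \<noteq> 0" using assms by (auto simp: nset_def)
  show "unit_normal k x \<in> normal_vectors fubini_study F x"
    unfolding normal_vectors_iff[OF x] unit_normal_def using tan_coef[OF x] by (simp add: nproj_def fs_herm_simps)
  show "fubini_study (F x) (unit_normal k x) (unit_normal k x) = 1"
    using fubini_study_pos[OF n, of "F x"] unfolding fubini_study_eq unit_normal_def
    by (simp add: fs_herm_simps real_sqrt_mult_self field_simps)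
qed

lemma continuous_on_unit_normal: "continuous_on (nset k) (unit_normal k)"
proof -
  have c: "continuous_on (nset k) (\<lambda>x. nproj x (axis k 1))" "continuous_on (nset k) F"
    using continuous_on_nproj continuous_on_F nset_subset by (blast intro: continuous_on_subset)+
  have "fubini_study (F x) (nproj x (axis k 1)) (nproj x (axis k 1)) \<noteq> 0" if "x \<in> nset k" for x
    using fubini_study_pos[of "nproj x (axis k 1)" "F x"] that by (simp add: nset_def)
  then have "\<forall>x\<in>nset k. sqrt (Re (H x (nproj x (axis k 1)) (nproj x (axis k 1)))) \<noteq> 0"
    by (simp add: fubini_study_eq)
  then show ?thesis
    unfolding unit_normal_def[abs_def] fubini_study_eq by (intro continuous_intros c)
qed

text \<open>Otherwise every coordinate vector would be tangent, and a unit normal would be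
  orthogonal to itself.\<close>

lemma nset_cover:
  assumes x: "x \<in> S" and v: "v \<in> normal_vectors fubini_study F x" "fubini_study (F x) v v = 1"
  shows "\<exists>k. x \<in> nset k"
proof (rule ccontr)
  assume "\<not> ?thesis"
  then have *: "axis k 1 = D x (tan_coef x (axis k 1))" for k using x by (auto simp: nset_def nproj_def)
  have "H x v (axis k 1) = 0" for k
    using v(1) normal_vectors_iff[OF x] by (subst *) simp
  then have "H x v v = 0"
    by (subst (2) vec_eq_sum_smult_axis[of v]) (simp add: fs_herm_sum fs_herm_simps)
  then show False using v(2) by (simp only: fubini_study_eq) simp
qed

lemma normal_set_borel: "{(x, v). x \<in> S \<and> v \<in> normal_vectors fubini_study F x} \<in> sets borel"
proof -
  have c: "continuous_on (S \<times> UNIV) (\<lambda>z. H (fst z) (snd z) (D (fst z) t))" for t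
    by (intro continuous_intros continuous_on_compose2[OF continuous_on_F] continuous_on_compose2[OF continuous_on_D]) auto
  have "S \<times> (UNIV :: (complex ^ 'n) set) \<in> sets borel"
    by (intro borel_open open_Times openS) simp
  then have "{z \<in> S \<times> UNIV. H (fst z) (snd z) (D (fst z) t) \<in> {0}} \<in> sets borel" for t
    by (intro sets_borel_Collect_continuous_on c) auto
  then have "(\<Inter>k\<in>UNIV. {z \<in> S \<times> UNIV. H (fst z) (snd z) (D (fst z) (axis k 1)) \<in> {0}}) \<in> sets borel"
    by (intro sets.finite_INT) auto
  moreover have "v \<in> normal_vectors fubini_study F x \<longleftrightarrow> (\<forall>k. H x v (D x (axis k 1)) = 0)" if x: "x \<in> S" for x v
  proof
    assume *: "\<forall>k. H x v (D x (axis k 1)) = 0"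
    have "H x v (D x t) = 0" for t
      by (subst D_sum_axis[OF x, symmetric]) (simp add: fs_herm_sum fs_herm_simps *)
    then show "v \<in> normal_vectors fubini_study F x" by (simp add: normal_vectors_iff[OF x])
  qed (simp add: normal_vectors_iff[OF x])
  then have "{(x, v). x \<in> S \<and> v \<in> normal_vectors fubini_study F x} =
      (\<Inter>k\<in>UNIV. {z \<in> S \<times> UNIV. H (fst z) (snd z) (D (fst z) (axis k 1)) \<in> {0}})" by auto
  ultimately show ?thesis by simp
qed

text \<open>Makes sense, and is continuous, for every vector \<open>v\<close>, whereas
  \<open>shape_operator\<close> is described through normal fields. On normal vectors the two
  agree.\<close>

definition "shape_coord x v u = gram_solve (F x) (\<lambda>k. D x (axis k 1)) (\<lambda>i. H x v (D2 x u (axis i 1)))"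

lemma shape_operator_coord:
  assumes "x \<in> S" "v \<in> normal_vectors fubini_study F x"
  shows "A x v u = shape_coord x v u"
  unfolding shape_coord_def
  by (subst gram_solve_iff[symmetric]) (simp_all add: D_sum_axis[OF assms(1)] D_eq_0[OF assms(1)] H_shape_operator[OF assms])

lemma continuous_on_shape_coord: "continuous_on (S \<times> UNIV) (\<lambda>z. shape_coord (fst z) (snd z) u $ k)"
  unfolding shape_coord_def
  by (rule continuous_on_gram_solve)
     (auto intro!: continuous_intros continuous_on_compose2[OF continuous_on_F] continuous_on_compose2[OF continuous_on_D]
       continuous_on_compose2[OF continuous_on_D2] simp: D_sum_axis D_eq_0)

text \<open>The integrand of the total absolute curvature in one fixed pair of charts, set to zero
  from radius \<open>pi / 2\<close> on; \<open>e\<close> is the exponent of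
  \<open>sin r / r\<close>.\<close>

definition jacobian :: "nat \<Rightarrow> complex ^ 'm \<Rightarrow> complex ^ 'n \<Rightarrow> real" where
  "jacobian e x v = (let r = sqrt (fubini_study (F x) v v) in
     if r < pi / 2 then \<bar>real_det (\<lambda>y. cos r *\<^sub>R y - (sin r / r) *\<^sub>R A x v y)\<bar> * cos r * (sin r / r) ^ e else 0)"

lemma jacobian_borel:
  assumes Y: "Y \<in> sets borel"
  shows "{(x, v). x \<in> S \<and> v \<in> normal_vectors fubini_study F x \<and> jacobian e x v \<in> Y} \<in> sets borel"
proof -
  let ?M = "restrict_space borel (S \<times> (UNIV :: (complex ^ 'n) set))"
  define r where "r = (\<lambda>z. sqrt (fubini_study (F (fst z)) (snd z) (snd z)))"
  have "continuous_on (S \<times> UNIV) r"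
    unfolding r_def fubini_study_eq
    by (intro continuous_intros continuous_on_compose2[OF continuous_on_F]) auto
  then have r[measurable]: "r \<in> borel_measurable ?M" by (rule borel_measurable_continuous_on_restrict)
  have [measurable]: "(\<lambda>z. shape_coord (fst z) (snd z) u \<bullet> real_basis i) \<in> borel_measurable ?M" for u i
    by (rule borel_measurable_continuous_on_restrict)
       (cases i; auto simp: inner_real_basis intro!: continuous_intros continuous_on_shape_coord)
  define g where "g = (\<lambda>z. if r z < pi / 2 then \<bar>det (\<chi> i k. cos (r z) * (real_basis k \<bullet> real_basis i)
      - (sin (r z) / r z) * (shape_coord (fst z) (snd z) (real_basis k) \<bullet> real_basis i) :: real ^ ('m + 'm) ^ ('m + 'm))\<bar>
      * cos (r z) * (sin (r z) / r z) ^ e else 0)"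
  have "g \<in> borel_measurable ?M"
    unfolding g_def
    by (intro measurable_If borel_measurable_times borel_measurable_abs borel_measurable_det) (simp_all, measurable)
  from measurable_sets[OF this Y] have "g -` Y \<inter> (S \<times> UNIV) \<in> sets ?M" by (simp add: space_restrict_space)
  moreover have "S \<times> (UNIV :: (complex ^ 'n) set) \<in> sets borel"
    by (intro borel_open open_Times openS) simp
  ultimately have "g -` Y \<inter> (S \<times> UNIV) \<in> sets borel" by (simp add: sets_restrict_space_iff)
  then have "(g -` Y \<inter> (S \<times> UNIV)) \<inter> {(x, v). x \<in> S \<and> v \<in> normal_vectors fubini_study F x} \<in> sets borel"
    by (rule sets.Int) (rule normal_set_borel)
  moreover have "jacobian e x v = g (x, v)" if "x \<in> S" "v \<in> normal_vectors fubini_study F x" for x v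
    by (simp add: jacobian_def g_def r_def Let_def real_det_def inner_diff_left shape_operator_coord[OF that])
  then have "{(x, v). x \<in> S \<and> v \<in> normal_vectors fubini_study F x \<and> jacobian e x v \<in> Y} =
      (g -` Y \<inter> (S \<times> UNIV)) \<inter> {(x, v). x \<in> S \<and> v \<in> normal_vectors fubini_study F x}" by auto
  ultimately show ?thesis by simp
qed

end

lemma (in hol_immersion_change) jacobian_change:
  assumes x: "x \<in> U" and v: "v \<in> normal_vectors fubini_study F x"
  shows "Y.jacobian e (\<tau> x) (N x v) = X.jacobian e x v"
  unfolding Y.jacobian_def X.jacobian_def by (simp add: fubini_study_eq H_N[OF x] Let_def real_det_change[OF x v])

section \<open>Borel sets of the manifold\<close>

text \<open>Injectivity of the charts is what lets images commute with intersections.\<close>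

lemma istopology_manifold:
  assumes inj: "\<And>c. c \<in> \<A> \<Longrightarrow> inj_on (snd c) (fst c)"
  shows "istopology (\<lambda>W. W \<subseteq> points \<A> \<and> (\<forall>c\<in>\<A>. open (snd c ` (W \<inter> fst c))))"
  unfolding istopology_def
proof (intro conjI allI impI)
  fix V W assume *: "V \<subseteq> points \<A> \<and> (\<forall>c\<in>\<A>. open (snd c ` (V \<inter> fst c)))"
    "W \<subseteq> points \<A> \<and> (\<forall>c\<in>\<A>. open (snd c ` (W \<inter> fst c)))"
  show "\<forall>c\<in>\<A>. open (snd c ` (V \<inter> W \<inter> fst c))"
  proof
    fix c assume c: "c \<in> \<A>"
    have "snd c ` (V \<inter> W \<inter> fst c) = snd c ` (V \<inter> fst c) \<inter> snd c ` (W \<inter> fst c)"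
      using inj[OF c] by (auto simp: inj_on_def)
    then show "open (snd c ` (V \<inter> W \<inter> fst c))" using * c by auto
  qed
  show "V \<inter> W \<subseteq> points \<A>" using * by auto
next
  fix \<K> assume *: "\<forall>K\<in>\<K>. K \<subseteq> points \<A> \<and> (\<forall>c\<in>\<A>. open (snd c ` (K \<inter> fst c)))"
  show "\<Union>\<K> \<subseteq> points \<A>" using * by auto
  show "\<forall>c\<in>\<A>. open (snd c ` (\<Union>\<K> \<inter> fst c))"
  proof
    fix c assume c: "c \<in> \<A>"
    have "snd c ` (\<Union>\<K> \<inter> fst c) = (\<Union>K\<in>\<K>. snd c ` (K \<inter> fst c))" by auto
    then show "open (snd c ` (\<Union>\<K> \<inter> fst c))" using * c by auto
  qed
qed

context immersed begin

abbreviation "vol \<equiv> riemannian_volume \<A> f"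

lemma openin_manifold:
  "openin (manifold_topology \<A>) W \<longleftrightarrow> W \<subseteq> points \<A> \<and> (\<forall>c\<in>\<A>. open (snd c ` (W \<inter> fst c)))"
  unfolding manifold_topology_def
  by (subst topology_inverse') (use istopology_manifold inj_chart in auto)

lemma openin_chart_preimage:
  assumes c: "c \<in> \<A>" and Y: "open Y" shows "openin (manifold_topology \<A>) {p \<in> fst c. snd c p \<in> Y}"
  unfolding openin_manifold
proof (intro conjI ballI)
  show "{p \<in> fst c. snd c p \<in> Y} \<subseteq> points \<A>" using chart_subset[OF c] by auto
  fix d assume d: "d \<in> \<A>"
  let ?T = "snd d ` (fst d \<inter> fst c)"
  have "continuous_on ?T (snd c \<circ> chart_inv d)"
    using transition_hol[OF d c] unfolding holomorphic_map_on_def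
    by (intro continuous_at_imp_continuous_on ballI) (blast intro: has_derivative_continuous)
  from continuous_open_preimage[OF this open_chart_inter[OF d c] Y]
  have "open (?T \<inter> (snd c \<circ> chart_inv d) -` Y)" .
  moreover have "snd d ` ({p \<in> fst c. snd c p \<in> Y} \<inter> fst d) = ?T \<inter> (snd c \<circ> chart_inv d) -` Y"
    using d by auto
  ultimately show "open (snd d ` ({p \<in> fst c. snd c p \<in> Y} \<inter> fst d))" by simp
qed

lemma openin_chart: "c \<in> \<A> \<Longrightarrow> openin (manifold_topology \<A>) (fst c)"
  using openin_chart_preimage[OF _ open_UNIV] by simp

lemma topspace_manifold: "topspace (manifold_topology \<A>) = points \<A>"
proof -
  have "openin (manifold_topology \<A>) (points \<A>)"
    unfolding points_def by (rule openin_Union) (use openin_chart in auto)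
  then show ?thesis using openin_manifold by (auto simp: topspace_def)
qed

lemma manifold_borel: "space (manifold_borel \<A>) = points \<A>"
  "openin (manifold_topology \<A>) W \<Longrightarrow> W \<in> sets (manifold_borel \<A>)"
proof -
  have *: "{W. openin (manifold_topology \<A>) W} \<subseteq> Pow (points \<A>)" using openin_manifold by auto
  show "space (manifold_borel \<A>) = points \<A>"
    unfolding manifold_borel_def by (rule space_measure_of[OF *])
  show "openin (manifold_topology \<A>) W \<Longrightarrow> W \<in> sets (manifold_borel \<A>)"
    unfolding manifold_borel_def by (subst sets_measure_of[OF *]) auto
qed

lemma sets_vol: "sets vol = sets (manifold_borel \<A>)"
proof (cases "\<A> = {}")
  case False
  then show ?thesis
    unfolding riemannian_volume_def by (intro sets_SUP) (simp_all add: chart_volume_def)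
next
  \<comment> \<open>The supremum over the empty atlas is the bottom measure, whose only measurable
    set is empty.\<close>
  case True
  then have "space (manifold_borel \<A>) = {}" unfolding manifold_borel(1) by (simp add: points_def)
  then have "sets (manifold_borel \<A>) = {{}}" by (simp add: space_empty_iff)
  then show ?thesis by (simp add: riemannian_volume_def True)
qed

lemma space_vol: "space vol = points \<A>"
  using sets_eq_imp_space_eq[OF sets_vol] manifold_borel by simp

lemma chart_preimage_borel:
  assumes c: "c \<in> \<A>" and Y: "Y \<in> sets borel" shows "{p \<in> fst c. snd c p \<in> Y} \<in> sets vol"
proof -
  have dom: "fst c \<in> sets vol"
    using openin_chart[OF c] manifold_borel sets_vol by simp
  have "snd c \<in> borel_measurable (restrict_space vol (fst c))"
  proof (rule borel_measurableI)
    fix Y :: "(complex ^ 'm) set" assume "open Y"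
    then have "{p \<in> fst c. snd c p \<in> Y} \<in> sets vol"
      using openin_chart_preimage[OF c] manifold_borel sets_vol by simp
    moreover have "snd c -` Y \<inter> space (restrict_space vol (fst c)) = {p \<in> fst c. snd c p \<in> Y}"
      using chart_subset[OF c] by (auto simp: space_restrict_space space_vol)
    ultimately show "snd c -` Y \<inter> space (restrict_space vol (fst c)) \<in> sets (restrict_space vol (fst c))"
      using dom by (subst sets_restrict_space_iff) (auto simp: sets.Int_space_eq2)
  qed
  from measurable_sets[OF this Y]
  have "snd c -` Y \<inter> space (restrict_space vol (fst c)) \<in> sets vol"
    using dom by (subst (asm) sets_restrict_space_iff) (auto simp: sets.Int_space_eq2)
  moreover have "snd c -` Y \<inter> space (restrict_space vol (fst c)) = {p \<in> fst c. snd c p \<in> Y}"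
    using chart_subset[OF c] by (auto simp: space_restrict_space space_vol)
  ultimately show ?thesis by simp
qed

end

section \<open>The normal bundle\<close>

text \<open>The field \<open>u\<close> is a bare choice of unit normals, as the theorem supplies it,
  without measurability.\<close>

locale compact_hypersurface = immersed \<A> f
  for \<A> :: "('a, 'm::finite) chart set" and f :: "'a \<Rightarrow> (complex ^ ('n::finite option)) set" +
  fixes u :: "'a \<Rightarrow> complex ^ 'n"
  assumes compact: "compact_space (manifold_topology \<A>)" and card: "CARD('n) = CARD('m) + 1"
    and u: "\<And>p. p \<in> points \<A> \<Longrightarrow> u p \<in> normal_space_at \<A> f p \<and> fs_norm (f p) (u p) = 1"
begin

abbreviation "patch c j k \<equiv> hol_immersion.nset (rep c j) (chart_dom c j) k"

text \<open>The atlas may be uncountable; compactness turns the gluing of measurable pieces into a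
  finite union.\<close>

lemma finite_subatlas: obtains \<C> where "finite \<C>" "\<C> \<subseteq> \<A>" "points \<A> = (\<Union>c\<in>\<C>. fst c)"
proof -
  have "compactin (manifold_topology \<A>) (points \<A>)"
    using compact by (simp add: compact_space_def topspace_manifold)
  moreover have "openin (manifold_topology \<A>) U" if "U \<in> fst ` \<A>" for U
    using that openin_chart by auto
  moreover have "points \<A> \<subseteq> \<Union> (fst ` \<A>)" by (simp add: points_def)
  ultimately obtain \<F> where F: "finite \<F>" "\<F> \<subseteq> fst ` \<A>" "points \<A> \<subseteq> \<Union>\<F>"
    unfolding compactin_def by meson
  from finite_subset_image[OF F(1,2)] obtain \<C> where "\<C> \<subseteq> \<A>" "finite \<C>" "\<F> = fst ` \<C>" by blast
  with F(3) chart_subset show thesis by (intro that[of \<C>]) blast+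
qed

text \<open>Carries tangent vectors at \<open>f p\<close> from the affine chart chosen there to
  chart \<open>j\<close>.\<close>

definition "dchart p j = dtrans_map (aff_index p) j (snd (affine_chart (aff_index p)) (f p))"

text \<open>The dictionary between the charts chosen at \<open>p\<close> and a fixed pair
  \<open>c\<close>, \<open>j\<close>: \<open>hol_immersion_change\<close> evaluated at the base
  point.\<close>

lemma change_at:
  assumes c: "c \<in> \<A>" and p: "p \<in> fst c" "f p \<in> fst (affine_chart j)"
  shows "v \<in> normal_space_at \<A> f p \<longleftrightarrow> dchart p j v \<in> normal_vectors fubini_study (rep c j) (snd c p)"
    and "fs_inner (f p) v w = fubini_study (rep c j (snd c p)) (dchart p j v) (dchart p j w)"
    and "v \<in> normal_space_at \<A> f p \<Longrightarrow>
      hol_immersion.jacobian (rep c j) e (snd c p) (dchart p j v) = hol_immersion.jacobian (rep (base_chart p) (aff_index p)) e (base_point p) v"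
    and "bij (dchart p j)" and "linear (dchart p j)" and "dchart p j (\<zeta> *s v) = \<zeta> *s dchart p j v"
    and "bundle_coords f c (affine_chart j) (p, v) = (snd c p, dchart p j v)"
proof -
  have pp: "p \<in> points \<A>" using c p chart_subset by blast
  let ?\<tau> = "snd c \<circ> chart_inv (base_chart p)"
  let ?U = "snd (base_chart p) ` (fst (base_chart p) \<inter> fst c \<inter> f -` fst (affine_chart (aff_index p)) \<inter> f -` fst (affine_chart j))"
  interpret ch: hol_immersion_change "rep (base_chart p) (aff_index p)" "chart_dom (base_chart p) (aff_index p)" "rep c j" "chart_dom c j" ?\<tau> ?U "aff_index p" j
    by (rule change[OF chart_at(1)[OF pp] c])
  have xU: "base_point p \<in> ?U" using chart_at[OF pp] aff_index[OF pp] p by auto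
  have \<tau>x: "?\<tau> (base_point p) = snd c p" using chart_at[OF pp] by simp
  have L: "dchart p j = ch.N (base_point p)" by (simp add: dchart_def rep_base_point[OF pp])
  show "v \<in> normal_space_at \<A> f p \<longleftrightarrow> dchart p j v \<in> normal_vectors fubini_study (rep c j) (snd c p)"
    using ch.normal_vectors_N[OF xU] by (simp only: L normal_space_eq[OF pp] \<tau>x)
  show "fs_inner (f p) v w = fubini_study (rep c j (snd c p)) (dchart p j v) (dchart p j w)"
    using ch.H_N[OF xU] by (simp only: L fs_inner_eq[OF pp] \<tau>x fubini_study_eq)
  show "hol_immersion.jacobian (rep c j) e (snd c p) (dchart p j v) = hol_immersion.jacobian (rep (base_chart p) (aff_index p)) e (base_point p) v"
    if "v \<in> normal_space_at \<A> f p"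
    using ch.jacobian_change[OF xU, of v e] that by (simp only: L normal_space_eq[OF pp] \<tau>x)
  have "inj (dchart p j)" unfolding L by (rule dtrans_map_inj[OF ch.chart[OF xU]])
  then show "bij (dchart p j)" using ch.surj_N[OF xU] by (simp add: L bij_def)
  show "linear (dchart p j)" by (rule linearI) (simp_all add: dchart_def dtrans_map_lin)
  show "dchart p j (\<zeta> *s v) = \<zeta> *s dchart p j v" by (simp add: dchart_def dtrans_map_lin)
  let ?w = "snd (affine_chart (aff_index p)) (f p)"
  have hw: "homog (aff_index p) ?w $ j \<noteq> 0" using ch.chart[OF xU] by (simp add: rep_base_point[OF pp])
  have "continuous_on UNIV (\<lambda>w. homog (aff_index p) w $ j)"
    by (intro continuous_at_imp_continuous_on ballI has_derivative_continuous[OF has_derivative_homog_nth[OF has_derivative_ident]])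
  then have op: "open {w. homog (aff_index p) w $ j \<noteq> 0}"
    by (rule open_Collect_neq) (rule continuous_on_const)
  \<comment> \<open>The transition agrees with \<open>trans_map\<close> only where coordinate
    \<open>j\<close> is nonzero; this set is open, which suffices for equal derivatives.\<close>
  have "frechet_derivative (snd (affine_chart j) \<circ> chart_inv (affine_chart (aff_index p))) (at ?w)
     = frechet_derivative (trans_map (aff_index p) j) (at ?w)"
    by (rule frechet_derivative_cong[OF op]) (use hw in \<open>simp_all add: affine_transition\<close>)
  also have "\<dots> = dchart p j" unfolding dchart_def by (rule has_derivative_frechet[OF has_derivative_trans_map[OF hw]])
  finally show "bundle_coords f c (affine_chart j) (p, v) = (snd c p, dchart p j v)"
    by (simp add: bundle_coords_def Let_def aff_index[OF pp])
qed

section \<open>Borel sets of the bundle in coordinates\<close>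

abbreviation "coord_image E c j \<equiv> bundle_coords f c (affine_chart j) ` {(p, v) \<in> E. p \<in> fst c \<and> f p \<in> fst (affine_chart j)}"

text \<open>Bundle coordinates are injective: the chart recovers the point, and
  \<open>dchart\<close> is bijective on vectors. Complements can therefore be taken in
  coordinates.\<close>

lemma coord_image_iff:
  assumes c: "c \<in> \<A>" and p: "p \<in> fst c" "f p \<in> fst (affine_chart j)"
  shows "(snd c p, dchart p j v) \<in> coord_image E c j \<longleftrightarrow> (p, v) \<in> E"
proof
  assume "(snd c p, dchart p j v) \<in> coord_image E c j"
  then obtain q w where q: "(q, w) \<in> E" "q \<in> fst c" "f q \<in> fst (affine_chart j)"
    "(snd c p, dchart p j v) = bundle_coords f c (affine_chart j) (q, w)" by auto
  then have "snd c p = snd c q" "dchart p j v = dchart q j w" by (simp_all add: change_at(7)[OF c])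
  moreover from this have "p = q" using inj_chart[OF c] p q by (auto dest: inj_onD)
  ultimately show "(p, v) \<in> E" using change_at(4)[OF c p] q by (auto simp: bij_def dest: injD)
next
  assume "(p, v) \<in> E"
  then show "(snd c p, dchart p j v) \<in> coord_image E c j"
    using p change_at(7)[OF c p] by (intro image_eqI[of _ _ "(p, v)"]) auto
qed

lemma coord_image_cases:
  assumes c: "c \<in> \<A>" and z: "z \<in> {(x, w). x \<in> chart_dom c j \<and> w \<in> normal_vectors fubini_study (rep c j) x}"
  obtains p v where "p \<in> fst c" "f p \<in> fst (affine_chart j)" "v \<in> normal_space_at \<A> f p" "z = (snd c p, dchart p j v)"
    "(p, v) \<in> normal_bundle \<A> f"
proof -
  obtain x w where x: "z = (x, w)" "x \<in> chart_dom c j" "w \<in> normal_vectors fubini_study (rep c j) x" using z by auto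
  then obtain p where p: "p \<in> fst c" "f p \<in> fst (affine_chart j)" "x = snd c p" by (auto simp: chart_dom_def)
  obtain v where v: "w = dchart p j v" using change_at(4)[OF c p(1,2)] by (metis bij_pointE)
  show thesis
    using that[of p v] p v x change_at(1)[OF c p(1,2), of v] chart_subset[OF c] by (auto simp: normal_bundle_def)
qed

lemma coord_image_subset:
  assumes c: "c \<in> \<A>" and E: "E \<subseteq> normal_bundle \<A> f"
  shows "coord_image E c j \<subseteq> {(x, w). x \<in> chart_dom c j \<and> w \<in> normal_vectors fubini_study (rep c j) x}"
  using E change_at[OF c] by (auto simp: normal_bundle_def chart_dom_def)

lemma coord_image_eq:
  assumes c: "c \<in> \<A>" and E: "E \<subseteq> normal_bundle \<A> f"
    and P: "\<And>p v. p \<in> fst c \<Longrightarrow> f p \<in> fst (affine_chart j) \<Longrightarrow> (p, v) \<in> normal_bundle \<A> f \<Longrightarrow>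
      (p, v) \<in> E \<longleftrightarrow> (snd c p, dchart p j v) \<in> Q"
  shows "coord_image E c j = {(x, w). x \<in> chart_dom c j \<and> w \<in> normal_vectors fubini_study (rep c j) x} \<inter> Q"
    (is "_ = ?N \<inter> Q")
proof (intro equalityI subsetI)
  fix z assume z: "z \<in> coord_image E c j"
  then have zN: "z \<in> ?N" using coord_image_subset[OF c E] by blast
  then obtain p v where p: "p \<in> fst c" "f p \<in> fst (affine_chart j)" "z = (snd c p, dchart p j v)" "(p, v) \<in> normal_bundle \<A> f"
    by (rule coord_image_cases[OF c])
  then show "z \<in> ?N \<inter> Q" using zN z coord_image_iff[OF c p(1,2)] P[OF p(1,2,4)] by simp
next
  fix z assume z: "z \<in> ?N \<inter> Q"
  then have "z \<in> ?N" by blast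
  then obtain p v where p: "p \<in> fst c" "f p \<in> fst (affine_chart j)" "z = (snd c p, dchart p j v)" "(p, v) \<in> normal_bundle \<A> f"
    by (rule coord_image_cases[OF c])
  then show "z \<in> coord_image E c j" using z coord_image_iff[OF c p(1,2)] P[OF p(1,2,4)] by simp
qed

lemma bundle_borel_iff:
  "E \<in> bundle_borel_sets \<A> f \<longleftrightarrow> E \<subseteq> normal_bundle \<A> f \<and> (\<forall>c\<in>\<A>. \<forall>j. coord_image E c j \<in> sets borel)"
  unfolding bundle_borel_sets_def cproj_atlas_def by auto

lemma normal_coord_borel:
  "c \<in> \<A> \<Longrightarrow> {(x, w). x \<in> chart_dom c j \<and> w \<in> normal_vectors fubini_study (rep c j) x} \<in> sets borel"
  by (rule hol_immersion.normal_set_borel[OF rep_hol_immersion])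

text \<open>Ensures that \<open>measure_of\<close> keeps exactly these sets. Complements are taken
  inside the coordinate image of the bundle, which is Borel.\<close>

lemma sigma_algebra_bundle: "sigma_algebra (normal_bundle \<A> f) (bundle_borel_sets \<A> f)"
  unfolding sigma_algebra_iff2
proof (intro conjI ballI allI impI)
  show "bundle_borel_sets \<A> f \<subseteq> Pow (normal_bundle \<A> f)" by (auto simp: bundle_borel_sets_def)
  show "{} \<in> bundle_borel_sets \<A> f" by (simp add: bundle_borel_iff)
next
  fix E assume E: "E \<in> bundle_borel_sets \<A> f"
  have "coord_image (normal_bundle \<A> f - E) c j \<in> sets borel" if c: "c \<in> \<A>" for c j
  proof -
    have "coord_image (normal_bundle \<A> f - E) c j =
      {(x, w). x \<in> chart_dom c j \<and> w \<in> normal_vectors fubini_study (rep c j) x} \<inter> - coord_image E c j"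
      by (rule coord_image_eq[OF c]) (use coord_image_iff[OF c] in auto)
    then show ?thesis using E c normal_coord_borel[OF c] by (auto simp: bundle_borel_iff)
  qed
  then show "normal_bundle \<A> f - E \<in> bundle_borel_sets \<A> f" by (auto simp: bundle_borel_iff)
next
  fix E :: "nat \<Rightarrow> _" assume E: "range E \<subseteq> bundle_borel_sets \<A> f"
  have "coord_image (\<Union>i. E i) c j \<in> sets borel" if c: "c \<in> \<A>" for c j
  proof -
    have "coord_image (\<Union>i. E i) c j = (\<Union>i. coord_image (E i) c j)" by auto
    then show ?thesis using E c by (auto simp: bundle_borel_iff image_subset_iff)
  qed
  then show "(\<Union>i. E i) \<in> bundle_borel_sets \<A> f" using E by (auto simp: bundle_borel_iff image_subset_iff)
qed

text \<open>Finitely many charts, affine charts and patches cover the manifold, so a function that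
  is Borel in coordinates on each patch has preimages that are finite unions of measurable
  sets.\<close>

lemma glue_measurable:
  fixes \<Phi> :: "'a \<Rightarrow> ennreal"
  assumes "\<And>c j k. c \<in> \<A> \<Longrightarrow> \<exists>\<psi>\<in>borel_measurable borel.
     \<forall>p\<in>fst c. f p \<in> fst (affine_chart j) \<longrightarrow> snd c p \<in> patch c j k \<longrightarrow> \<Phi> p = \<psi> (snd c p)"
  shows "\<Phi> \<in> borel_measurable vol"
proof (rule measurableI)
  fix Y :: "ennreal set" assume Y: "Y \<in> sets borel"
  have "\<forall>c\<in>\<A>. \<forall>j k. \<exists>\<psi>\<in>borel_measurable borel.
     \<forall>p\<in>fst c. f p \<in> fst (affine_chart j) \<longrightarrow> snd c p \<in> patch c j k \<longrightarrow> \<Phi> p = \<psi> (snd c p)" using assms by blast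
  then obtain \<psi> where \<psi>: "\<And>c j k. c \<in> \<A> \<Longrightarrow> \<psi> c j k \<in> borel_measurable borel"
    "\<And>c j k p. c \<in> \<A> \<Longrightarrow> p \<in> fst c \<Longrightarrow> f p \<in> fst (affine_chart j) \<Longrightarrow> snd c p \<in> patch c j k \<Longrightarrow> \<Phi> p = \<psi> c j k (snd c p)"
    by metis
  obtain \<C> where \<C>: "finite \<C>" "\<C> \<subseteq> \<A>" "points \<A> = (\<Union>c\<in>\<C>. fst c)" by (rule finite_subatlas)
  let ?Y = "\<lambda>c j k. patch c j k \<inter> \<psi> c j k -` Y"
  have Yb: "?Y c j k \<in> sets borel" if "c \<in> \<A>" for c j k
    using hol_immersion.open_nset[OF rep_hol_immersion[OF that]] measurable_sets[OF \<psi>(1)[OF that] Y] by simp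
  \<comment> \<open>A point is determined by its coordinates in \<open>c\<close>, so lying in the
    patch already places \<open>f p\<close> in affine chart \<open>j\<close>.\<close>
  have dom: "f p \<in> fst (affine_chart j)" if "c \<in> \<A>" "p \<in> fst c" "snd c p \<in> patch c j k" for c p j k
  proof -
    have "snd c p \<in> chart_dom c j" using that hol_immersion.nset_subset[OF rep_hol_immersion] by blast
    then show ?thesis using inj_chart[OF that(1)] that(2) by (auto simp: chart_dom_def inj_on_def)
  qed
  have "\<Phi> -` Y \<inter> space vol = (\<Union>c\<in>\<C>. \<Union>j. \<Union>k. {p \<in> fst c. snd c p \<in> ?Y c j k})"
  proof (intro equalityI subsetI)
    fix p assume p: "p \<in> \<Phi> -` Y \<inter> space vol"
    then have pp: "p \<in> points \<A>" by (simp add: space_vol)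
    then obtain c where c: "c \<in> \<C>" "p \<in> fst c" using \<C> by auto
    then have cA: "c \<in> \<A>" using \<C> by auto
    obtain j where j: "f p \<in> fst (affine_chart j)" using affine_charts_cover[OF f_cproj[OF pp]] by auto
    have "fs_inner (f p) (u p) (u p) = 1" using u[OF pp] by (simp add: fs_norm_def)
    then obtain k where "snd c p \<in> patch c j k"
      using hol_immersion.nset_cover[OF rep_hol_immersion[OF cA] chart_dom_chart[OF c(2) j], of "dchart p j (u p)"]
        u[OF pp] change_at(1,2)[OF cA c(2) j] by auto
    then show "p \<in> (\<Union>c\<in>\<C>. \<Union>j. \<Union>k. {p \<in> fst c. snd c p \<in> ?Y c j k})"
      using p c \<psi>(2)[OF cA c(2) j] by auto
  next
    fix p assume "p \<in> (\<Union>c\<in>\<C>. \<Union>j. \<Union>k. {p \<in> fst c. snd c p \<in> ?Y c j k})"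
    then obtain c j k where *: "c \<in> \<C>" "p \<in> fst c" "snd c p \<in> patch c j k" "\<psi> c j k (snd c p) \<in> Y" by auto
    then have cA: "c \<in> \<A>" using \<C> by auto
    show "p \<in> \<Phi> -` Y \<inter> space vol"
      using \<psi>(2)[OF cA *(2) dom[OF cA *(2,3)] *(3)] * chart_subset[OF cA] by (auto simp: space_vol)
  qed
  also have "\<dots> \<in> sets vol"
    using \<C> by (intro sets.finite_UN chart_preimage_borel Yb) auto
  finally show "\<Phi> -` Y \<inter> space vol \<in> sets vol" .
qed simp

section \<open>Fibre measures and integration over the bundle\<close>

abbreviation "fibre p \<equiv> subspace_lebesgue (fs_inner (f p)) (normal_space_at \<A> f p)"

text \<open>Any unit normal parametrises the fibre isometrically by the plane. This allows
  \<open>u p\<close> to be exchanged for a continuous local normal.\<close>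

lemma fibre_eq:
  assumes p: "p \<in> points \<A>" and w: "w \<in> normal_space_at \<A> f p" "fs_inner (f p) w w = 1"
  shows "fibre p = distr lborel borel (\<lambda>\<zeta>. \<zeta> *s w)"
proof -
  interpret hol_immersion "rep (base_chart p) (aff_index p)" "chart_dom (base_chart p) (aff_index p)" by (rule hol_immersion_at[OF p])
  have wn: "H (base_point p) w (D (base_point p) t) = 0" for t
    using w(1) normal_vectors_iff[OF base_point_in_dom[OF p]] by (simp add: normal_space_eq[OF p])
  have ww: "H (base_point p) w w = 1" using w(2) by (simp add: fs_inner_eq[OF p] fs_herm_self)
  have "normal_space_at \<A> f p = range (\<lambda>\<zeta>. \<zeta> *s w)"
  proof (intro equalityI subsetI)
    fix v assume "v \<in> normal_space_at \<A> f p"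
    then have "H (base_point p) v (D (base_point p) t) = 0" for t
      using normal_vectors_iff[OF base_point_in_dom[OF p]] by (simp add: normal_space_eq[OF p])
    from normal_line[OF card base_point_in_dom[OF p] wn ww this] show "v \<in> range (\<lambda>\<zeta>. \<zeta> *s w)" by blast
  next
    fix v assume "v \<in> range (\<lambda>\<zeta>. \<zeta> *s w)"
    then show "v \<in> normal_space_at \<A> f p"
      using wn by (auto simp: normal_space_eq[OF p] normal_vectors_iff[OF base_point_in_dom[OF p]] fs_herm_simps)
  qed
  moreover have "subspace_lebesgue (fs_inner (f p)) (range (\<lambda>\<zeta>. \<zeta> *s w)) = distr lborel borel (\<lambda>\<zeta>. \<zeta> *s w)"
  proof (rule subspace_lebesgue_line)
    show "fs_inner (f p) (\<zeta> *s w) (\<xi> *s w) = \<zeta> \<bullet> \<xi>" for \<zeta> \<xi>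
      by (simp add: fs_inner_eq[OF p] fubini_study_eq fs_herm_simps ww inner_complex_def)
    show "w \<noteq> 0" using ww by (auto simp: fs_herm_simps)
  qed
  ultimately show ?thesis by simp
qed

lemma borel_measurable_line: "(\<lambda>\<zeta>. \<zeta> *s (w :: complex ^ 'n)) \<in> borel_measurable borel"
  by (intro borel_measurable_continuous_onI continuous_intros)

lemma section_borel:
  assumes E: "E \<in> bundle_borel_sets \<A> f" and p: "p \<in> points \<A>"
  shows "{v. (p, v) \<in> E} \<in> sets borel"
proof -
  note c = chart_at[OF p] aff_index(1)[OF p]
  have "linear (dchart p (aff_index p))" using change_at(5)[OF c] .
  then have "(\<lambda>v. (base_point p, dchart p (aff_index p) v)) \<in> borel_measurable borel"
    by (intro borel_measurable_continuous_onI continuous_intros linear_continuous_on)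
       (simp add: linear_conv_bounded_linear)
  moreover have "coord_image E (base_chart p) (aff_index p) \<in> sets borel" using E c bundle_borel_iff by blast
  ultimately have "(\<lambda>v. (base_point p, dchart p (aff_index p) v)) -` coord_image E (base_chart p) (aff_index p) \<inter> space borel \<in> sets borel"
    by (rule measurable_sets)
  then show ?thesis by (simp only: vimage_def coord_image_iff[OF c] space_borel Int_UNIV_right)
qed

text \<open>On a patch, the continuous unit normal turns the fibre measure of \<open>E\<close> into
  the plane measure of a slice of the Borel set \<open>Q\<close>, which is measurable in the base
  point.\<close>

lemma emeasure_fibre_measurable:
  assumes E: "E \<in> bundle_borel_sets \<A> f"
  shows "(\<lambda>p. emeasure (fibre p) {v. (p, v) \<in> E}) \<in> borel_measurable vol"
proof (rule glue_measurable)
  fix c j k assume c: "c \<in> \<A>"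
  interpret X: hol_immersion "rep c j" "chart_dom c j" by (rule rep_hol_immersion[OF c])
  define Q where "Q = {z \<in> X.nset k \<times> UNIV. (fst z, snd z *s X.unit_normal k (fst z)) \<in> coord_image E c j}"
  have "Q \<in> sets borel"
    unfolding Q_def
  proof (rule sets_borel_Collect_continuous_on)
    show "continuous_on (X.nset k \<times> UNIV) (\<lambda>z. (fst z, snd z *s X.unit_normal k (fst z)))"
      by (intro continuous_intros continuous_on_compose2[OF X.continuous_on_unit_normal]) auto
    show "X.nset k \<times> UNIV \<in> sets borel" by (intro borel_open open_Times X.open_nset open_UNIV)
    show "coord_image E c j \<in> sets borel" using E c bundle_borel_iff by blast
  qed
  then have "Q \<in> sets (borel \<Otimes>\<^sub>M lborel)"
    by (simp add: borel_prod[symmetric] cong: sets_pair_measure_cong)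
  then have m: "(\<lambda>x. emeasure lborel (Pair x -` Q)) \<in> borel_measurable borel"
    by (rule lborel.measurable_emeasure_Pair)
  show "\<exists>\<psi>\<in>borel_measurable borel. \<forall>p\<in>fst c. f p \<in> fst (affine_chart j) \<longrightarrow> snd c p \<in> X.nset k \<longrightarrow>
      emeasure (fibre p) {v. (p, v) \<in> E} = \<psi> (snd c p)"
  proof (intro bexI[OF _ m] ballI impI)
    fix p assume p: "p \<in> fst c" "f p \<in> fst (affine_chart j)" and n: "snd c p \<in> X.nset k"
    have pp: "p \<in> points \<A>" using c p chart_subset by blast
    obtain w where w: "X.unit_normal k (snd c p) = dchart p j w" using change_at(4)[OF c p] by (metis bij_pointE)
    have "fibre p = distr lborel borel (\<lambda>\<zeta>. \<zeta> *s w)"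
      by (rule fibre_eq[OF pp]) (use X.unit_normal[OF n] change_at(1,2)[OF c p] w in auto)
    then have "emeasure (fibre p) {v. (p, v) \<in> E} = emeasure lborel {\<zeta>. (p, \<zeta> *s w) \<in> E}"
      using section_borel[OF E pp] borel_measurable_line by (simp add: emeasure_distr vimage_def)
    also have "{\<zeta>. (p, \<zeta> *s w) \<in> E} = Pair (snd c p) -` Q"
      using n by (auto simp: Q_def w change_at(6)[OF c p, symmetric] coord_image_iff[OF c p])
    finally show "emeasure (fibre p) {v. (p, v) \<in> E} = emeasure lborel (Pair (snd c p) -` Q)" .
  qed
qed

abbreviation "bvol \<equiv> normal_bundle_volume \<A> f"

lemma space_bvol: "space bvol = normal_bundle \<A> f"
  and sets_bvol: "sets bvol = bundle_borel_sets \<A> f"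
  using sigma_algebra_bundle unfolding normal_bundle_volume_def
  by (simp_all add: sigma_algebra.sets_measure_of_eq sigma_algebra.space_measure_of_eq)

text \<open>\<open>measure_of\<close> returns the given set function only if that function is
  countably additive. Measurability of the fibre measures allows sum and integral to be
  exchanged.\<close>

lemma emeasure_bvol:
  assumes E: "E \<in> bundle_borel_sets \<A> f"
  shows "emeasure bvol E = (\<integral>\<^sup>+p. emeasure (fibre p) {v. (p, v) \<in> E} \<partial>vol)"
  unfolding normal_bundle_volume_def
proof (rule emeasure_measure_of_sigma[OF sigma_algebra_bundle _ _ E])
  show "positive (bundle_borel_sets \<A> f) (\<lambda>S. \<integral>\<^sup>+p. emeasure (fibre p) {v. (p, v) \<in> S} \<partial>vol)"
    by (simp add: positive_def)
  show "countably_additive (bundle_borel_sets \<A> f) (\<lambda>S. \<integral>\<^sup>+p. emeasure (fibre p) {v. (p, v) \<in> S} \<partial>vol)"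
    unfolding countably_additive_def
  proof (intro allI impI)
    fix S :: "nat \<Rightarrow> _" assume S: "range S \<subseteq> bundle_borel_sets \<A> f" and d: "disjoint_family S"
    have "(\<Sum>i. \<integral>\<^sup>+p. emeasure (fibre p) {v. (p, v) \<in> S i} \<partial>vol) = (\<integral>\<^sup>+p. (\<Sum>i. emeasure (fibre p) {v. (p, v) \<in> S i}) \<partial>vol)"
      by (rule nn_integral_suminf[symmetric]) (use S emeasure_fibre_measurable in auto)
    also have "\<dots> = (\<integral>\<^sup>+p. emeasure (fibre p) {v. (p, v) \<in> (\<Union>i. S i)} \<partial>vol)"
    proof (rule nn_integral_cong)
      fix p assume "p \<in> space vol"
      then have p: "p \<in> points \<A>" by (simp add: space_vol)
      have "sets (fibre p) = sets borel" by (simp add: subspace_lebesgue_def Let_def)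
      then have "range (\<lambda>i. {v. (p, v) \<in> S i}) \<subseteq> sets (fibre p)"
        using section_borel[OF _ p] S by auto
      moreover have "disjoint_family (\<lambda>i. {v. (p, v) \<in> S i})" using d by (auto simp: disjoint_family_on_def)
      ultimately have "(\<Sum>i. emeasure (fibre p) {v. (p, v) \<in> S i}) = emeasure (fibre p) (\<Union>i. {v. (p, v) \<in> S i})"
        by (rule suminf_emeasure)
      also have "(\<Union>i. {v. (p, v) \<in> S i}) = {v. (p, v) \<in> (\<Union>i. S i)}" by auto
      finally show "(\<Sum>i. emeasure (fibre p) {v. (p, v) \<in> S i}) = emeasure (fibre p) {v. (p, v) \<in> (\<Union>i. S i)}" .
    qed
    finally show "(\<Sum>i. \<integral>\<^sup>+p. emeasure (fibre p) {v. (p, v) \<in> S i} \<partial>vol) = (\<integral>\<^sup>+p. emeasure (fibre p) {v. (p, v) \<in> (\<Union>i. S i)} \<partial>vol)" .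
  qed
qed

lemma u_unit: "p \<in> points \<A> \<Longrightarrow> fs_inner (f p) (u p) (u p) = 1"
  using u[of p] by (simp add: fs_norm_def)

lemma fibre_inclusion_measurable:
  assumes p: "p \<in> points \<A>" shows "(\<lambda>\<zeta>. (p, \<zeta> *s u p)) \<in> measurable borel bvol"
proof (rule measurableI)
  have un: "\<zeta> *s u p \<in> normal_space_at \<A> f p" for \<zeta>
    using u[OF p] hol_immersion.normal_vectors_iff[OF hol_immersion_at[OF p] base_point_in_dom[OF p]]
    by (simp add: normal_space_eq[OF p] fs_herm_simps)
  then show "(p, \<zeta> *s u p) \<in> space bvol" for \<zeta> by (simp add: space_bvol normal_bundle_def p)
  fix E assume "E \<in> sets bvol"
  then have "{v. (p, v) \<in> E} \<in> sets borel" using section_borel[OF _ p] sets_bvol by auto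
  from measurable_sets[OF borel_measurable_line this]
  show "(\<lambda>\<zeta>. (p, \<zeta> *s u p)) -` E \<inter> space borel \<in> sets borel" by (simp add: vimage_def)
qed

text \<open>Fubini for the bundle. The map \<open>(p, \<zeta>)\<close> to
  \<open>(p, \<zeta> *s u p)\<close> need not be measurable jointly, so measurability in
  \<open>p\<close> is carried through the induction, starting from \<open>fibre\<close>, which does
  not mention \<open>u\<close>.\<close>

lemma nn_integral_bvol:
  assumes "G \<in> borel_measurable bvol"
  shows "(\<lambda>p. \<integral>\<^sup>+\<zeta>. G (p, \<zeta> *s u p) \<partial>lborel) \<in> borel_measurable vol \<and>
    (\<integral>\<^sup>+z. G z \<partial>bvol) = (\<integral>\<^sup>+p. \<integral>\<^sup>+\<zeta>. G (p, \<zeta> *s u p) \<partial>lborel \<partial>vol)"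
  using assms
proof (induction rule: borel_measurable_induct)
  case (cong g h)
  have "g (p, \<zeta> *s u p) = h (p, \<zeta> *s u p)" if "p \<in> space vol" for p \<zeta>
    using cong(3) measurable_space[OF fibre_inclusion_measurable] that by (auto simp: space_vol)
  then have e: "(\<integral>\<^sup>+\<zeta>. g (p, \<zeta> *s u p) \<partial>lborel) = (\<integral>\<^sup>+\<zeta>. h (p, \<zeta> *s u p) \<partial>lborel)" if "p \<in> space vol" for p
    using that by simp
  have "(\<integral>\<^sup>+z. g z \<partial>bvol) = (\<integral>\<^sup>+z. h z \<partial>bvol)" by (rule nn_integral_cong) (rule cong(3))
  then show ?case using cong(4) e by (simp cong: measurable_cong nn_integral_cong)
next
  case (set E)
  then have E: "E \<in> bundle_borel_sets \<A> f" by (simp add: sets_bvol)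
  have e: "(\<integral>\<^sup>+\<zeta>. indicator E (p, \<zeta> *s u p) \<partial>lborel) = emeasure (fibre p) {v. (p, v) \<in> E}" if "p \<in> space vol" for p
  proof -
    have p: "p \<in> points \<A>" using that by (simp add: space_vol)
    have "emeasure (fibre p) {v. (p, v) \<in> E} = (\<integral>\<^sup>+\<zeta>. indicator {v. (p, v) \<in> E} (\<zeta> *s u p) \<partial>lborel)"
      unfolding fibre_eq[OF p conjunct1[OF u[OF p]] u_unit[OF p]]
      by (rule emeasure_distr_nn_integral) (use section_borel[OF E p] borel_measurable_line in auto)
    then show ?thesis by (simp add: indicator_def)
  qed
  show ?case
    using emeasure_fibre_measurable[OF E] e emeasure_bvol[OF E] set
    by (simp cong: measurable_cong nn_integral_cong)
next
  case (mult g c)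
  have [measurable]: "(\<lambda>\<zeta>. g (p, \<zeta> *s u p)) \<in> borel_measurable borel" if "p \<in> space vol" for p
    using measurable_compose[OF fibre_inclusion_measurable mult(2)] that by (simp add: space_vol)
  then have e: "(\<integral>\<^sup>+\<zeta>. c * g (p, \<zeta> *s u p) \<partial>lborel) = c * (\<integral>\<^sup>+\<zeta>. g (p, \<zeta> *s u p) \<partial>lborel)" if "p \<in> space vol" for p
    using that by (intro nn_integral_cmult) simp
  have [measurable]: "(\<lambda>p. \<integral>\<^sup>+\<zeta>. g (p, \<zeta> *s u p) \<partial>lborel) \<in> borel_measurable vol" using mult by blast
  then have "(\<lambda>p. c * (\<integral>\<^sup>+\<zeta>. g (p, \<zeta> *s u p) \<partial>lborel)) \<in> borel_measurable vol" by measurable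
  then show ?case using mult e by (simp add: nn_integral_cmult cong: measurable_cong nn_integral_cong)
next
  case (add g h)
  have m: "(\<lambda>\<zeta>. g (p, \<zeta> *s u p)) \<in> borel_measurable borel" "(\<lambda>\<zeta>. h (p, \<zeta> *s u p)) \<in> borel_measurable borel" if "p \<in> space vol" for p
    using measurable_compose[OF fibre_inclusion_measurable \<open>g \<in> borel_measurable bvol\<close>] measurable_compose[OF fibre_inclusion_measurable \<open>h \<in> borel_measurable bvol\<close>] that
    by (simp_all add: space_vol)
  then have e: "(\<integral>\<^sup>+\<zeta>. h (p, \<zeta> *s u p) + g (p, \<zeta> *s u p) \<partial>lborel) =
     (\<integral>\<^sup>+\<zeta>. h (p, \<zeta> *s u p) \<partial>lborel) + (\<integral>\<^sup>+\<zeta>. g (p, \<zeta> *s u p) \<partial>lborel)" if "p \<in> space vol" for p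
    using that by (intro nn_integral_add) simp_all
  have [measurable]: "(\<lambda>p. \<integral>\<^sup>+\<zeta>. g (p, \<zeta> *s u p) \<partial>lborel) \<in> borel_measurable vol"
    "(\<lambda>p. \<integral>\<^sup>+\<zeta>. h (p, \<zeta> *s u p) \<partial>lborel) \<in> borel_measurable vol" using add by blast+
  then have "(\<lambda>p. (\<integral>\<^sup>+\<zeta>. h (p, \<zeta> *s u p) \<partial>lborel) + (\<integral>\<^sup>+\<zeta>. g (p, \<zeta> *s u p) \<partial>lborel)) \<in> borel_measurable vol"
    by measurable
  then show ?case using add e by (simp add: nn_integral_add cong: measurable_cong nn_integral_cong)
next
  case (seq U)
  have IH: "(\<lambda>p. \<integral>\<^sup>+\<zeta>. U i (p, \<zeta> *s u p) \<partial>lborel) \<in> borel_measurable vol"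
    "(\<integral>\<^sup>+z. U i z \<partial>bvol) = (\<integral>\<^sup>+p. \<integral>\<^sup>+\<zeta>. U i (p, \<zeta> *s u p) \<partial>lborel \<partial>vol)" for i
    using seq by blast+
  have m: "(\<lambda>\<zeta>. U i (p, \<zeta> *s u p)) \<in> borel_measurable borel" if "p \<in> space vol" for p i
    using measurable_compose[OF fibre_inclusion_measurable seq(1)] that by (simp add: space_vol)
  have e: "(\<integral>\<^sup>+\<zeta>. (SUP i. U i) (p, \<zeta> *s u p) \<partial>lborel) = (SUP i. \<integral>\<^sup>+\<zeta>. U i (p, \<zeta> *s u p) \<partial>lborel)" if p: "p \<in> space vol" for p
    unfolding SUP_apply
    by (rule nn_integral_monotone_convergence_SUP)
       (use seq(3) m[OF p] in \<open>auto simp: incseq_def le_fun_def\<close>)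
  have inc: "incseq (\<lambda>i p. \<integral>\<^sup>+\<zeta>. U i (p, \<zeta> *s u p) \<partial>lborel)"
    using seq(3) by (auto simp: incseq_def le_fun_def intro!: nn_integral_mono)
  have "(\<integral>\<^sup>+z. (SUP i. U i) z \<partial>bvol) = (SUP i. \<integral>\<^sup>+z. U i z \<partial>bvol)"
    unfolding SUP_apply by (rule nn_integral_monotone_convergence_SUP) (use seq in auto)
  also have "\<dots> = (\<integral>\<^sup>+p. (SUP i. \<integral>\<^sup>+\<zeta>. U i (p, \<zeta> *s u p) \<partial>lborel) \<partial>vol)"
    using IH inc by (subst nn_integral_monotone_convergence_SUP) auto
  also have "\<dots> = (\<integral>\<^sup>+p. \<integral>\<^sup>+\<zeta>. (SUP i. U i) (p, \<zeta> *s u p) \<partial>lborel \<partial>vol)"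
    by (rule nn_integral_cong) (rule e[symmetric])
  finally have 1: "(\<integral>\<^sup>+z. (SUP i. U i) z \<partial>bvol) = (\<integral>\<^sup>+p. \<integral>\<^sup>+\<zeta>. (SUP i. U i) (p, \<zeta> *s u p) \<partial>lborel \<partial>vol)" .
  have "(\<lambda>p. SUP i. \<integral>\<^sup>+\<zeta>. U i (p, \<zeta> *s u p) \<partial>lborel) \<in> borel_measurable vol"
    by (rule borel_measurable_SUP) (use IH in auto)
  then have 2: "(\<lambda>p. \<integral>\<^sup>+\<zeta>. (SUP i. U i) (p, \<zeta> *s u p) \<partial>lborel) \<in> borel_measurable vol"
    by (rule measurable_cong[THEN iffD2, rotated]) (rule e)
  show ?case using 1 2 seq by simp
qed

text \<open>Invariance under the change of charts rewrites the integrand, formed in the charts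
  chosen at each point, in one fixed pair, where \<open>jacobian_borel\<close> applies.\<close>

lemma jacobian_measurable:
  "(\<lambda>z. hol_immersion.jacobian (rep (base_chart (fst z)) (aff_index (fst z))) e (base_point (fst z)) (snd z)) \<in> borel_measurable bvol"
  (is "?J \<in> _")
proof (rule measurableI)
  fix Y :: "real set" assume Y: "Y \<in> sets borel"
  have "coord_image (?J -` Y \<inter> normal_bundle \<A> f) c j \<in> sets borel" if c: "c \<in> \<A>" for c j
  proof -
    let ?Q = "{(x, v). hol_immersion.jacobian (rep c j) e x v \<in> Y}"
    have "coord_image (?J -` Y \<inter> normal_bundle \<A> f) c j =
       {(x, w). x \<in> chart_dom c j \<and> w \<in> normal_vectors fubini_study (rep c j) x} \<inter> ?Q"
      by (rule coord_image_eq[OF c]) (use change_at(3)[OF c] in \<open>auto simp: normal_bundle_def\<close>)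
    also have "\<dots> = {(x, v). x \<in> chart_dom c j \<and> v \<in> normal_vectors fubini_study (rep c j) x \<and> hol_immersion.jacobian (rep c j) e x v \<in> Y}"
      by auto
    also have "\<dots> \<in> sets borel" by (rule hol_immersion.jacobian_borel[OF rep_hol_immersion[OF c] Y])
    finally show ?thesis .
  qed
  then show "?J -` Y \<inter> space bvol \<in> sets bvol"
    by (auto simp: sets_bvol space_bvol bundle_borel_iff)
qed simp

end

section \<open>The total absolute curvature\<close>

context compact_hypersurface begin

text \<open>The factor \<open>sin r / r\<close> of the integrand and the factor \<open>r\<close> of polar coordinates combine to \<open>sin r\<close>.\<close>

definition "rad_density \<kappa> r = \<bar>\<Prod>i\<in>UNIV. (cos r)\<^sup>2 - (sin r)\<^sup>2 * (\<kappa> i)\<^sup>2\<bar> * cos r * sin r" for \<kappa> :: "'m \<Rightarrow> real"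

lemma jacobian_u:
  assumes p: "p \<in> points \<A>" and fam: "holomorphic_principal_family \<A> f p (u p) e \<kappa>"
  shows "hol_immersion.jacobian (rep (base_chart p) (aff_index p)) 1 (base_point p) (\<zeta> *s u p) * cmod \<zeta> =
    (if cmod \<zeta> < pi / 2 then rad_density \<kappa> (cmod \<zeta>) else 0)"
proof -
  have r: "sqrt (fubini_study (rep (base_chart p) (aff_index p) (base_point p)) (\<zeta> *s u p) (\<zeta> *s u p)) = cmod \<zeta>"
  proof -
    have "fs_herm (rep (base_chart p) (aff_index p) (base_point p)) (u p) (u p) = 1"
      using u_unit[OF p] by (simp add: fs_inner_eq[OF p] fs_herm_self)
    then have "fubini_study (rep (base_chart p) (aff_index p) (base_point p)) (\<zeta> *s u p) (\<zeta> *s u p) = (cmod \<zeta>)\<^sup>2"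
      unfolding cmod_power2 by (simp add: fubini_study_eq fs_herm_simps power2_eq_square)
    then show ?thesis by simp
  qed
  \<comment> \<open>At \<open>\<zeta> = 0\<close> the default value of \<open>sin r / r\<close> is
    annihilated by \<open>cmod \<zeta>\<close> on the left, and \<open>sin 0 = 0\<close> gives zero
    on the right.\<close>
  show ?thesis
    unfolding hol_immersion.jacobian_def[OF hol_immersion_at[OF p]] Let_def r
      shape_op_eq[OF p, symmetric] real_det_family[OF p fam]
    by (cases "\<zeta> = 0") (simp_all add: rad_density_def)
qed

lemma continuous_on_rad_density: "continuous_on A (rad_density \<kappa>)"
  unfolding rad_density_def[abs_def] by (intro continuous_intros)

lemma rad_density_nonneg: "0 \<le> r \<Longrightarrow> r \<le> pi / 2 \<Longrightarrow> 0 \<le> rad_density \<kappa> r"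
  unfolding rad_density_def by (intro mult_nonneg_nonneg abs_ge_zero cos_ge_zero sin_ge_zero) auto

lemma nn_integral_jacobian_fibre:
  assumes p: "p \<in> points \<A>" and fam: "holomorphic_principal_family \<A> f p (u p) e \<kappa>"
  shows "(\<integral>\<^sup>+\<zeta>. ennreal (hol_immersion.jacobian (rep (base_chart p) (aff_index p)) 1 (base_point p) (\<zeta> *s u p)) \<partial>lborel) =
    ennreal (2 * pi * (LBINT r:{0..pi/2}. rad_density \<kappa> r))"
proof -
  \<comment> \<open>Dividing by \<open>r\<close> undoes the factor \<open>cmod \<zeta>\<close> of
    \<open>jacobian_u\<close>; the \<open>2 * pi * r\<close> of polar coordinates restores
    it.\<close>
  define g where "g = (\<lambda>r. ennreal (if 0 < r \<and> r < pi / 2 then rad_density \<kappa> r / r else 0))"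
  have rm[measurable]: "rad_density \<kappa> \<in> borel_measurable borel"
    by (rule borel_measurable_continuous_onI[OF continuous_on_rad_density])
  have g[measurable]: "g \<in> borel_measurable borel" unfolding g_def by measurable
  have "(\<integral>\<^sup>+\<zeta>. ennreal (hol_immersion.jacobian (rep (base_chart p) (aff_index p)) 1 (base_point p) (\<zeta> *s u p)) \<partial>lborel) = (\<integral>\<^sup>+\<zeta>. g (cmod \<zeta>) \<partial>lborel)"
  proof (rule nn_integral_cong_AE, rule AE_mp[OF AE_lborel_singleton[of 0]], intro AE_I2 impI)
    fix \<zeta> :: complex assume z: "\<zeta> \<noteq> 0"
    then have "hol_immersion.jacobian (rep (base_chart p) (aff_index p)) 1 (base_point p) (\<zeta> *s u p) =
      (if cmod \<zeta> < pi / 2 then rad_density \<kappa> (cmod \<zeta>) else 0) / cmod \<zeta>"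
      using jacobian_u[OF p fam, of \<zeta>] by (simp add: field_simps)
    then show "ennreal (hol_immersion.jacobian (rep (base_chart p) (aff_index p)) 1 (base_point p) (\<zeta> *s u p)) = g (cmod \<zeta>)"
      using z by (simp add: g_def)
  qed
  also have "\<dots> = (\<integral>\<^sup>+r. ennreal (2 * pi * r) * indicator {0..} r * g r \<partial>lborel)"
    by (rule nn_integral_radial[OF g])
  also have "\<dots> = (\<integral>\<^sup>+r. ennreal (indicator {0..pi/2} r * (2 * pi * rad_density \<kappa> r)) \<partial>lborel)"
  proof (rule nn_integral_cong_AE, rule AE_mp[OF AE_lborel_singleton[of "pi/2"]], rule AE_mp[OF AE_lborel_singleton[of 0]], intro AE_I2 impI)
    \<comment> \<open>The open interval in \<open>g\<close> and the closed interval on the right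
      differ by these two null points.\<close>
    fix r :: real assume r: "r \<noteq> pi / 2" "r \<noteq> 0"
    show "ennreal (2 * pi * r) * indicator {0..} r * g r = ennreal (indicator {0..pi/2} r * (2 * pi * rad_density \<kappa> r))"
      using r by (auto simp: g_def ennreal_mult[symmetric] rad_density_nonneg split: split_indicator)
  qed
  also have "\<dots> = ennreal (LINT r|lborel. indicator {0..pi/2} r * (2 * pi * rad_density \<kappa> r))"
  proof (rule nn_integral_eq_integral)
    have "set_integrable lborel {0..pi/2} (\<lambda>r. 2 * pi * rad_density \<kappa> r)"
      by (intro borel_integrable_atLeastAtMost' continuous_intros continuous_on_rad_density)
    then show "integrable lborel (\<lambda>r. indicator {0..pi/2} r * (2 * pi * rad_density \<kappa> r))"
      by (simp add: set_integrable_def)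
    show "AE r in lborel. 0 \<le> indicator {0..pi/2} r * (2 * pi * rad_density \<kappa> r)"
      by (intro AE_I2) (auto simp: rad_density_nonneg split: split_indicator)
  qed
  also have "(LINT r|lborel. indicator {0..pi/2} r * (2 * pi * rad_density \<kappa> r)) = 2 * pi * (LBINT r:{0..pi/2}. rad_density \<kappa> r)"
    unfolding set_lebesgue_integral_def
    by (subst integral_mult_right_zero[symmetric]) (simp add: mult_ac)
  finally show ?thesis .
qed

lemma jacobian_nonneg: "0 \<le> hol_immersion.jacobian (rep (base_chart p) (aff_index p)) 1 (base_point p) v" if p: "p \<in> points \<A>"
proof -
  let ?r = "sqrt (fubini_study (rep (base_chart p) (aff_index p) (base_point p)) v v)"
  have r0: "0 \<le> ?r" using fubini_study_pos[of v] by (cases "v = 0") (auto simp: fubini_study_eq fs_herm_simps intro: less_imp_le)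
  show ?thesis
  proof (cases "?r < pi / 2")
    case True
    have "0 \<le> cos ?r" by (rule cos_ge_zero) (use r0 True pi_gt_zero in linarith)+
    moreover have "0 \<le> sin ?r" by (rule sin_ge_zero) (use r0 True pi_gt_zero in linarith)+
    moreover note True
    ultimately show ?thesis using r0 unfolding hol_immersion.jacobian_def[OF hol_immersion_at[OF p]] Let_def
      by (auto intro!: mult_nonneg_nonneg divide_nonneg_nonneg)
  qed (simp add: hol_immersion.jacobian_def[OF hol_immersion_at[OF p]])
qed

lemma total_absolute_curvature_eq:
  assumes fam: "\<And>p. p \<in> points \<A> \<Longrightarrow> holomorphic_principal_family \<A> f p (u p) (e p) (\<kappa> p)"
  shows "total_absolute_curvature \<A> f = 4 * pi / cproj_volume TYPE('n) *
    (LINT p|vol. (LBINT r:{0..pi/2}. rad_density (\<kappa> p) r))"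
proof -
  define J where "J = (\<lambda>z. hol_immersion.jacobian (rep (base_chart (fst z)) (aff_index (fst z))) 1 (base_point (fst z)) (snd z))"
  define I where "I = (\<lambda>p. LBINT r:{0..pi/2}. rad_density (\<kappa> p) r)"
  have exponent: "2 * CARD('n) - 2 * CARD('m) - 1 = 1" by (simp add: card)
  have Jm[measurable]: "J \<in> borel_measurable bvol" unfolding J_def by (rule jacobian_measurable)
  have Jn: "0 \<le> J z" if "z \<in> space bvol" for z
    using that jacobian_nonneg by (auto simp: J_def space_bvol normal_bundle_def)
  have I0: "0 \<le> I p" for p
    unfolding I_def set_lebesgue_integral_def
    by (rule integral_nonneg_AE) (auto simp: rad_density_nonneg split: split_indicator)
  have fib: "(\<integral>\<^sup>+\<zeta>. ennreal (J (p, \<zeta> *s u p)) \<partial>lborel) = ennreal (2 * pi) * ennreal (I p)" if "p \<in> space vol" for p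
    using nn_integral_jacobian_fibre[OF _ fam] that by (simp add: J_def I_def space_vol ennreal_mult' )
  have N: "(\<lambda>p. \<integral>\<^sup>+\<zeta>. ennreal (J (p, \<zeta> *s u p)) \<partial>lborel) \<in> borel_measurable vol"
    "(\<integral>\<^sup>+z. ennreal (J z) \<partial>bvol) = (\<integral>\<^sup>+p. \<integral>\<^sup>+\<zeta>. ennreal (J (p, \<zeta> *s u p)) \<partial>lborel \<partial>vol)"
    using nn_integral_bvol[of "\<lambda>z. ennreal (J z)"] by auto
  have "(\<lambda>p. ennreal (2 * pi) * ennreal (I p)) \<in> borel_measurable vol"
    by (rule measurable_cong[THEN iffD1, OF _ N(1)]) (rule fib)
  \<comment> \<open>The principal curvatures may be chosen without measurability in
    \<open>p\<close>; that of \<open>I\<close> is recovered from the fibre integral, of which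
    \<open>I\<close> is a constant multiple.\<close>
  then have "(\<lambda>p. enn2real (ennreal (2 * pi) * ennreal (I p)) / (2 * pi)) \<in> borel_measurable vol" by measurable
  then have Im[measurable]: "I \<in> borel_measurable vol"
    by (simp add: ennreal_mult'[symmetric] I0)
  \<comment> \<open>For nonnegative functions the Bochner integral is \<open>enn2real\<close> of the
    nonnegative one, infinite values included, so both sides are compared in
    \<open>ennreal\<close>.\<close>
  have "(LINT z|bvol. J z) = enn2real (\<integral>\<^sup>+z. ennreal (J z) \<partial>bvol)"
    by (rule integral_eq_nn_integral) (use Jn in auto)
  also have "\<dots> = enn2real (\<integral>\<^sup>+p. ennreal (2 * pi) * ennreal (I p) \<partial>vol)"
    unfolding N(2) by (rule arg_cong[of _ _ enn2real], rule nn_integral_cong) (rule fib)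
  also have "\<dots> = 2 * pi * enn2real (\<integral>\<^sup>+p. ennreal (I p) \<partial>vol)"
    by (subst nn_integral_cmult) (auto simp: enn2real_mult)
  also have "enn2real (\<integral>\<^sup>+p. ennreal (I p) \<partial>vol) = (LINT p|vol. I p)"
    by (rule integral_eq_nn_integral[symmetric]) (use I0 in auto)
  finally have "(LINT z|bvol. J z) = 2 * pi * (LINT p|vol. I p)" .
  moreover have "total_absolute_curvature \<A> f = 2 / cproj_volume TYPE('n) * (LINT z|bvol. J z)"
    unfolding total_absolute_curvature_def set_lebesgue_integral_def exponent
  proof (intro arg_cong[where f = "\<lambda>x. 2 / cproj_volume TYPE('n) * x"] Bochner_Integration.integral_cong refl)
    fix z assume z: "z \<in> space bvol"
    obtain p v where pv: "z = (p, v)" by fastforce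
    have p: "p \<in> points \<A>" using z pv by (simp add: space_bvol normal_bundle_def)
    show "indicator {(p, v) \<in> normal_bundle \<A> f. fs_norm (f p) v < pi / 2} z *\<^sub>R
       (case z of (p, v) \<Rightarrow> let r = fs_norm (f p) v in
           \<bar>real_det (\<lambda>x. cos r *\<^sub>R x - (sin r / r) *\<^sub>R shape_op \<A> f p v x)\<bar> * cos r * (sin r / r) ^ 1) = J z"
      using z unfolding pv J_def
      by (simp add: hol_immersion.jacobian_def[OF hol_immersion_at[OF p]] space_bvol Let_def
          fs_norm_def fs_inner_eq[OF p] shape_op_eq[OF p])
  qed
  ultimately show ?thesis by (simp add: I_def)
qed

end

lemma rad_density_elem_sym:
  fixes \<kappa> K :: "'m::finite \<Rightarrow> real"
  assumes K: "\<And>i. K i = 4 - 2 * (\<kappa> i)\<^sup>2"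
  shows "(\<Prod>i\<in>UNIV. (cos r)\<^sup>2 - (sin r)\<^sup>2 * (\<kappa> i)\<^sup>2) =
    (\<Sum>i=0..CARD('m). (1 - 3 * (sin r)\<^sup>2) ^ (CARD('m) - i) * ((sin r) ^ (2 * i) / 2 ^ i) * elem_sym i K)"
proof -
  have "(cos r)\<^sup>2 - (sin r)\<^sup>2 * (\<kappa> i)\<^sup>2 = (1 - 3 * (sin r)\<^sup>2) + (sin r)\<^sup>2 / 2 * K i" for i
    by (simp add: K cos_squared_eq algebra_simps)
  then show ?thesis
    by (simp only: prod_eq_sum_elem_sym) (simp add: power_mult power_divide)
qed

theorem theorem6p4:
  fixes \<A> :: "('a, 'm::finite) chart set"
    and f :: "'a \<Rightarrow> (complex ^ ('n::finite option)) set"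
    and u :: "'a \<Rightarrow> complex ^ 'n"
    and e :: "'a \<Rightarrow> 'm \<Rightarrow> complex ^ 'm"
    and \<kappa> K :: "'a \<Rightarrow> 'm \<Rightarrow> real"
  assumes "compact_complex_manifold \<A>"
    and "holomorphic_immersion \<A> cproj_atlas f"
    and "CARD('n) = CARD('m) + 1"
    and "\<And>p. p \<in> points \<A> \<Longrightarrow> holomorphic_principal_family \<A> f p (u p) (e p) (\<kappa> p)"
    and "\<And>p i. p \<in> points \<A> \<Longrightarrow> K p i = holomorphic_sectional_curvature \<A> f p (e p i)"
  shows "(\<forall>p\<in>points \<A>. \<forall>i. K p i = 4 - 2 * (\<kappa> p i)\<^sup>2) \<and>
    total_absolute_curvature \<A> f =
      4 * pi / cproj_volume TYPE('n) *
      (LINT p|riemannian_volume \<A> f. (LBINT r:{0..pi/2}.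
         \<bar>\<Sum>i=0..CARD('m). (1 - 3 * (sin r)\<^sup>2) ^ (CARD('m) - i) * ((sin r) ^ (2 * i) / 2 ^ i)
             * elem_sym i (K p)\<bar>
           * cos r * (sin r) ^ (2 * CARD('n) - 2 * CARD('m) - 1)))"
proof -
  interpret compact_hypersurface \<A> f u
    by unfold_locales
       (use assms in \<open>auto simp: compact_complex_manifold_def holomorphic_principal_family_def\<close>)
  have K: "K p i = 4 - 2 * (\<kappa> p i)\<^sup>2" if "p \<in> points \<A>" for p i
    using holomorphic_sectional_curvature_principal[OF assms(3) that assms(4)[OF that]] assms(5)[OF that] by simp
  \<comment> \<open>Codimension one leaves a single factor \<open>sin r\<close>, matching
    \<open>rad_density\<close>.\<close>
  have exponent: "2 * CARD('n) - 2 * CARD('m) - 1 = 1" by (simp add: assms(3))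
  have "(LBINT r:{0..pi/2}. rad_density (\<kappa> p) r) = (LBINT r:{0..pi/2}.
         \<bar>\<Sum>i=0..CARD('m). (1 - 3 * (sin r)\<^sup>2) ^ (CARD('m) - i) * ((sin r) ^ (2 * i) / 2 ^ i)
             * elem_sym i (K p)\<bar> * cos r * (sin r) ^ (2 * CARD('n) - 2 * CARD('m) - 1))"
    if "p \<in> space vol" for p
    unfolding exponent using that K by (simp add: rad_density_def rad_density_elem_sym[of "K p"] space_vol)
  then have "(LINT p|vol. (LBINT r:{0..pi/2}. rad_density (\<kappa> p) r)) = (LINT p|vol. (LBINT r:{0..pi/2}.
         \<bar>\<Sum>i=0..CARD('m). (1 - 3 * (sin r)\<^sup>2) ^ (CARD('m) - i) * ((sin r) ^ (2 * i) / 2 ^ i)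
             * elem_sym i (K p)\<bar> * cos r * (sin r) ^ (2 * CARD('n) - 2 * CARD('m) - 1)))"
    by (rule Bochner_Integration.integral_cong[OF refl])
  with K total_absolute_curvature_eq[OF assms(4)] show ?thesis by simp
qed

end
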